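(* The following are provable in $\mathbf{ZF}$: (1) The sentence "Every compact Tychonoff $P$-space is finite" implies $\mathbf{IQDI}$. (2) The sentence "Every locally compact Tychonoff $P$-space is discrete" implies $\mathbf{IQDI}$. (3) $\mathbf{IQDI}$ is equivalent to the sentence "Every $P$-space which is a limit point compact $T_1$-space is finite". (4) The sentence "Every strongly zero-dimensional $T_1$-space whose underlying set is quasi Dedekind-finite is a $P$-space" implies $\mathbf{IDI}(\mathbb{R})$.
   Context: The base theory is $\mathbf{ZF}$ (no Axiom of Choice). A set is Dedekind-infinite if it is equipotent to a proper subset of itself. A set $X$ is quasi Dedekind-infinite if the set $[X]^{<\omega}$ of its finite subsets is Dedekind-infinite, and quasi Dedekind-finite otherwise. $\mathbf{IQDI}$: every infinite set is quasi Dedekind-infinite. $\mathbf{IDI}(\mathbb{R})$: every infinite subset of $\mathbb{R}$ is Dedekind-infinite. A topological space is a $P$-space if all its $G_\delta$-sets are open. A zero-set of $\mathbf{X}$ is a set $f^{-1}[\{0\}]$ with $f:\mathbf{X}\to\mathbb{R}$ continuous; a co-zero set is the complement of a zero-set. $\mathbf{X}$ is completely regular if its co-zero sets form a base; Tychonoff means completely regular and $T_1$. $\mathbf{X}$ is strongly zero-dimensional if it is completely regular and for every pair $Z_1,Z_2$ of disjoint zero-sets there is a clopen set $U$ with $Z_1\subseteq U\subseteq X\setminus Z_2$. $\mathbf{X}$ is limit point compact if every infinite subset of $\mathbf{X}$ has an accumulation point in $\mathbf{X}$; compact means every open cover has a finite subcover. *)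

theory Defs
  imports Main
begin

text \<open>
  HOL has a choice operator, so the choice principles below are theorems of HOL when stated about
  HOL sets.  Provability in ZF is therefore rendered literally: first-order formulas
  over \<open>\<in>\<close> and \<open>=\<close>, a calculus of natural deduction for classical first-order logic with
  equality, and the axioms of ZF.
\<close>

section \<open>First-order logic of the language of set theory\<close>

text \<open>De Bruijn indices: \<open>Univ\<close> binds the index 0.\<close>

datatype fm =
    Mem nat nat
  | Eq nat nat
  | Bot
  | Imp fm fm
  | Univ fm

primrec ren :: "(nat \<Rightarrow> nat) \<Rightarrow> fm \<Rightarrow> fm" where
  "ren f (Mem i j) = Mem (f i) (f j)"
| "ren f (Eq i j) = Eq (f i) (f j)"
| "ren f Bot = Bot"
| "ren f (Imp p q) = Imp (ren f p) (ren f q)"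
| "ren f (Univ p) = Univ (ren (case_nat 0 (\<lambda>i. Suc (f i))) p)"

primrec free_vars :: "fm \<Rightarrow> nat set" where
  "free_vars (Mem i j) = {i, j}"
| "free_vars (Eq i j) = {i, j}"
| "free_vars Bot = {}"
| "free_vars (Imp p q) = free_vars p \<union> free_vars q"
| "free_vars (Univ p) = {i. Suc i \<in> free_vars p}"

text \<open>The language has no function symbols, so variables are the only terms:
  instantiating the index 0 by the term \<open>t\<close> is a renaming.\<close>

definition inst :: "nat \<Rightarrow> fm \<Rightarrow> fm" where
  "inst t p = ren (case_nat t (\<lambda>i. i)) p"

inductive deriv :: "fm set \<Rightarrow> fm \<Rightarrow> bool" (infix "\<turnstile>" 50) where
  Assm: "p \<in> \<Gamma> \<Longrightarrow> \<Gamma> \<turnstile> p"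
| ImpI: "insert p \<Gamma> \<turnstile> q \<Longrightarrow> \<Gamma> \<turnstile> Imp p q"
| ImpE: "\<Gamma> \<turnstile> Imp p q \<Longrightarrow> \<Gamma> \<turnstile> p \<Longrightarrow> \<Gamma> \<turnstile> q"
| Raa: "insert (Imp p Bot) \<Gamma> \<turnstile> Bot \<Longrightarrow> \<Gamma> \<turnstile> p"
| UnivI: "ren Suc ` \<Gamma> \<turnstile> p \<Longrightarrow> \<Gamma> \<turnstile> Univ p"
| UnivE: "\<Gamma> \<turnstile> Univ p \<Longrightarrow> \<Gamma> \<turnstile> inst t p"
| EqI: "\<Gamma> \<turnstile> Eq t t"
| EqE: "\<Gamma> \<turnstile> Eq s t \<Longrightarrow> \<Gamma> \<turnstile> inst s p \<Longrightarrow> \<Gamma> \<turnstile> inst t p"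


section \<open>Writing formulas with named bound variables\<close>

text \<open>
  A \<open>pform\<close> maps the number \<open>d\<close> of enclosing quantifiers to a formula.  A set variable is the
  number of quantifiers outside its binder (a de Bruijn level), so at depth \<open>d\<close> the variable \<open>x\<close> is
  the index \<open>d - Suc x\<close>, and HOL's own binding can be used to write formulas.  The sentence
  denoted by a closed \<open>F\<close> is \<open>F 0\<close>.
\<close>

type_synonym var = nat
type_synonym pform = "nat \<Rightarrow> fm"

definition pmem :: "var \<Rightarrow> var \<Rightarrow> pform" (infix "\<^bold>\<in>" 50) where
  "(x \<^bold>\<in> y) = (\<lambda>d. Mem (d - Suc x) (d - Suc y))"

definition peq :: "var \<Rightarrow> var \<Rightarrow> pform" (infix "\<^bold>=" 50) where
  "(x \<^bold>= y) = (\<lambda>d. Eq (d - Suc x) (d - Suc y))"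

definition pimp :: "pform \<Rightarrow> pform \<Rightarrow> pform" (infixr "\<^bold>\<longrightarrow>" 25) where
  "(P \<^bold>\<longrightarrow> Q) = (\<lambda>d. Imp (P d) (Q d))"

definition pnot :: "pform \<Rightarrow> pform" ("\<^bold>\<not> _" [40] 40) where
  "(\<^bold>\<not> P) = (P \<^bold>\<longrightarrow> (\<lambda>d. Bot))"

definition pdisj :: "pform \<Rightarrow> pform \<Rightarrow> pform" (infixr "\<^bold>\<or>" 30) where
  "(P \<^bold>\<or> Q) = (\<^bold>\<not> P \<^bold>\<longrightarrow> Q)"

definition pconj :: "pform \<Rightarrow> pform \<Rightarrow> pform" (infixr "\<^bold>\<and>" 35) where
  "(P \<^bold>\<and> Q) = (\<^bold>\<not> (P \<^bold>\<longrightarrow> \<^bold>\<not> Q))"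

definition piff :: "pform \<Rightarrow> pform \<Rightarrow> pform" (infixr "\<^bold>\<longleftrightarrow>" 25) where
  "(P \<^bold>\<longleftrightarrow> Q) = ((P \<^bold>\<longrightarrow> Q) \<^bold>\<and> (Q \<^bold>\<longrightarrow> P))"

definition pall :: "(var \<Rightarrow> pform) \<Rightarrow> pform" (binder "\<^bold>\<forall>" 10) where
  "(\<^bold>\<forall>x. F x) = (\<lambda>d. Univ (F d (Suc d)))"

definition pex :: "(var \<Rightarrow> pform) \<Rightarrow> pform" (binder "\<^bold>\<exists>" 10) where
  "(\<^bold>\<exists>x. F x) = (\<^bold>\<not> (\<^bold>\<forall>x. \<^bold>\<not> F x))"

text \<open>The formula \<open>p\<close> with its free variables \<open>0, 1, \<dots>\<close> replaced by \<open>xs ! 0, xs ! 1, \<dots>\<close>.\<close>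

definition papply :: "fm \<Rightarrow> var list \<Rightarrow> pform" where
  "papply p xs = (\<lambda>d. ren (\<lambda>i. d - Suc (xs ! i)) p)"


section \<open>The axioms of ZF\<close>

definition extensionality_axiom :: pform where
  "extensionality_axiom = (\<^bold>\<forall>x y. (\<^bold>\<forall>z. z \<^bold>\<in> x \<^bold>\<longleftrightarrow> z \<^bold>\<in> y) \<^bold>\<longrightarrow> x \<^bold>= y)"

definition foundation_axiom :: pform where
  "foundation_axiom = (\<^bold>\<forall>x. (\<^bold>\<exists>y. y \<^bold>\<in> x) \<^bold>\<longrightarrow> (\<^bold>\<exists>y. y \<^bold>\<in> x \<^bold>\<and> \<^bold>\<not> (\<^bold>\<exists>z. z \<^bold>\<in> x \<^bold>\<and> z \<^bold>\<in> y)))"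

definition is_upair :: "var \<Rightarrow> var \<Rightarrow> var \<Rightarrow> pform" where
  "is_upair p a b = (\<^bold>\<forall>z. z \<^bold>\<in> p \<^bold>\<longleftrightarrow> z \<^bold>= a \<^bold>\<or> z \<^bold>= b)"

definition pairing_axiom :: pform where
  "pairing_axiom = (\<^bold>\<forall>a b. \<^bold>\<exists>p. is_upair p a b)"

definition is_Union :: "var \<Rightarrow> var \<Rightarrow> pform" where
  "is_Union U S = (\<^bold>\<forall>z. z \<^bold>\<in> U \<^bold>\<longleftrightarrow> (\<^bold>\<exists>A. A \<^bold>\<in> S \<^bold>\<and> z \<^bold>\<in> A))"

definition union_axiom :: pform where
  "union_axiom = (\<^bold>\<forall>S. \<^bold>\<exists>U. is_Union U S)"

definition psubset_eq :: "var \<Rightarrow> var \<Rightarrow> pform" (infix "\<^bold>\<subseteq>" 50) where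
  "(A \<^bold>\<subseteq> B) = (\<^bold>\<forall>z. z \<^bold>\<in> A \<^bold>\<longrightarrow> z \<^bold>\<in> B)"

definition power_set_axiom :: pform where
  "power_set_axiom = (\<^bold>\<forall>A. \<^bold>\<exists>P. \<^bold>\<forall>B. B \<^bold>\<in> P \<^bold>\<longleftrightarrow> B \<^bold>\<subseteq> A)"

definition is_empty :: "var \<Rightarrow> pform" where
  "is_empty x = (\<^bold>\<forall>z. \<^bold>\<not> z \<^bold>\<in> x)"

definition is_succ :: "var \<Rightarrow> var \<Rightarrow> pform" where
  "is_succ y x = (\<^bold>\<forall>z. z \<^bold>\<in> y \<^bold>\<longleftrightarrow> z \<^bold>\<in> x \<^bold>\<or> z \<^bold>= x)"

definition is_inductive :: "var \<Rightarrow> pform" where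
  "is_inductive w =
     ((\<^bold>\<exists>z. is_empty z \<^bold>\<and> z \<^bold>\<in> w) \<^bold>\<and> (\<^bold>\<forall>x. x \<^bold>\<in> w \<^bold>\<longrightarrow> (\<^bold>\<exists>y. is_succ y x \<^bold>\<and> y \<^bold>\<in> w)))"

definition infinity_axiom :: pform where
  "infinity_axiom = (\<^bold>\<exists>w. is_inductive w)"

text \<open>In both schemas the quantifiers \<open>Univ ^^ n\<close> bind the parameters, which are the
  variables \<open>0, \<dots>, n - 1\<close>.\<close>

definition separation :: "nat \<Rightarrow> fm \<Rightarrow> fm" where
  "separation n p = (Univ ^^ n)
     ((\<^bold>\<forall>A. \<^bold>\<exists>B. \<^bold>\<forall>x. x \<^bold>\<in> B \<^bold>\<longleftrightarrow> x \<^bold>\<in> A \<^bold>\<and> papply p (x # [0..<n])) n)"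

definition replacement :: "nat \<Rightarrow> fm \<Rightarrow> fm" where
  "replacement n p = (Univ ^^ n)
     ((\<^bold>\<forall>A. (\<^bold>\<forall>x y z. x \<^bold>\<in> A \<^bold>\<and> papply p (x # y # [0..<n]) \<^bold>\<and> papply p (x # z # [0..<n]) \<^bold>\<longrightarrow> y \<^bold>= z)
         \<^bold>\<longrightarrow> (\<^bold>\<exists>B. \<^bold>\<forall>y. y \<^bold>\<in> B \<^bold>\<longleftrightarrow> (\<^bold>\<exists>x. x \<^bold>\<in> A \<^bold>\<and> papply p (x # y # [0..<n])))) n)"

definition ZF :: "fm set" where
  "ZF = {extensionality_axiom 0, foundation_axiom 0, pairing_axiom 0, union_axiom 0,
         power_set_axiom 0, infinity_axiom 0}
      \<union> {separation n p | n p. free_vars p \<subseteq> {..<Suc n}}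
      \<union> {replacement n p | n p. free_vars p \<subseteq> {..<Suc (Suc n)}}"

definition ZF_proves :: "pform \<Rightarrow> bool" where
  "ZF_proves F \<longleftrightarrow> ZF \<turnstile> F 0"


section \<open>Sets and functions\<close>

definition is_pair :: "var \<Rightarrow> var \<Rightarrow> var \<Rightarrow> pform" where
  "is_pair p a b = (\<^bold>\<forall>z. z \<^bold>\<in> p \<^bold>\<longleftrightarrow> is_upair z a a \<^bold>\<or> is_upair z a b)"

definition pair_in :: "var \<Rightarrow> var \<Rightarrow> var \<Rightarrow> pform" where
  "pair_in a b f = (\<^bold>\<exists>p. is_pair p a b \<^bold>\<and> p \<^bold>\<in> f)"

definition is_Times :: "var \<Rightarrow> var \<Rightarrow> var \<Rightarrow> pform" where
  "is_Times P A B = (\<^bold>\<forall>p. p \<^bold>\<in> P \<^bold>\<longleftrightarrow> (\<^bold>\<exists>a b. a \<^bold>\<in> A \<^bold>\<and> b \<^bold>\<in> B \<^bold>\<and> is_pair p a b))"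

definition is_Un :: "var \<Rightarrow> var \<Rightarrow> var \<Rightarrow> pform" where
  "is_Un C A B = (\<^bold>\<forall>z. z \<^bold>\<in> C \<^bold>\<longleftrightarrow> z \<^bold>\<in> A \<^bold>\<or> z \<^bold>\<in> B)"

definition is_Int :: "var \<Rightarrow> var \<Rightarrow> var \<Rightarrow> pform" where
  "is_Int C A B = (\<^bold>\<forall>z. z \<^bold>\<in> C \<^bold>\<longleftrightarrow> z \<^bold>\<in> A \<^bold>\<and> z \<^bold>\<in> B)"

definition is_Diff :: "var \<Rightarrow> var \<Rightarrow> var \<Rightarrow> pform" where
  "is_Diff C A B = (\<^bold>\<forall>z. z \<^bold>\<in> C \<^bold>\<longleftrightarrow> z \<^bold>\<in> A \<^bold>\<and> \<^bold>\<not> z \<^bold>\<in> B)"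

definition disjoint :: "var \<Rightarrow> var \<Rightarrow> pform" where
  "disjoint A B = (\<^bold>\<not> (\<^bold>\<exists>z. z \<^bold>\<in> A \<^bold>\<and> z \<^bold>\<in> B))"

definition is_function :: "var \<Rightarrow> var \<Rightarrow> var \<Rightarrow> pform" where
  "is_function f A B =
     ((\<^bold>\<forall>p. p \<^bold>\<in> f \<^bold>\<longrightarrow> (\<^bold>\<exists>a b. a \<^bold>\<in> A \<^bold>\<and> b \<^bold>\<in> B \<^bold>\<and> is_pair p a b)) \<^bold>\<and>
      (\<^bold>\<forall>a. a \<^bold>\<in> A \<^bold>\<longrightarrow> (\<^bold>\<exists>b. pair_in a b f)) \<^bold>\<and>
      (\<^bold>\<forall>a b c. pair_in a b f \<^bold>\<and> pair_in a c f \<^bold>\<longrightarrow> b \<^bold>= c))"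

definition is_bijection :: "var \<Rightarrow> var \<Rightarrow> var \<Rightarrow> pform" where
  "is_bijection f A B =
     (is_function f A B \<^bold>\<and>
      (\<^bold>\<forall>a b c. pair_in a c f \<^bold>\<and> pair_in b c f \<^bold>\<longrightarrow> a \<^bold>= b) \<^bold>\<and>
      (\<^bold>\<forall>b. b \<^bold>\<in> B \<^bold>\<longrightarrow> (\<^bold>\<exists>a. pair_in a b f)))"

definition equipotent :: "var \<Rightarrow> var \<Rightarrow> pform" where
  "equipotent A B = (\<^bold>\<exists>f. is_bijection f A B)"

definition is_omega :: "var \<Rightarrow> pform" where
  "is_omega w = (is_inductive w \<^bold>\<and> (\<^bold>\<forall>v. is_inductive v \<^bold>\<longrightarrow> w \<^bold>\<subseteq> v))"

definition is_nat :: "var \<Rightarrow> pform" where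
  "is_nat n = (\<^bold>\<exists>w. is_omega w \<^bold>\<and> n \<^bold>\<in> w)"

definition is_finite :: "var \<Rightarrow> pform" where
  "is_finite A = (\<^bold>\<exists>n. is_nat n \<^bold>\<and> equipotent A n)"

definition Dedekind_infinite :: "var \<Rightarrow> pform" where
  "Dedekind_infinite A = (\<^bold>\<exists>B. B \<^bold>\<subseteq> A \<^bold>\<and> \<^bold>\<not> B \<^bold>= A \<^bold>\<and> equipotent A B)"

definition is_Fin :: "var \<Rightarrow> var \<Rightarrow> pform" where
  "is_Fin F X = (\<^bold>\<forall>A. A \<^bold>\<in> F \<^bold>\<longleftrightarrow> A \<^bold>\<subseteq> X \<^bold>\<and> is_finite A)"

definition quasi_Dedekind_infinite :: "var \<Rightarrow> pform" where
  "quasi_Dedekind_infinite X = (\<^bold>\<exists>F. is_Fin F X \<^bold>\<and> Dedekind_infinite F)"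

definition quasi_Dedekind_finite :: "var \<Rightarrow> pform" where
  "quasi_Dedekind_finite X = (\<^bold>\<not> quasi_Dedekind_infinite X)"

definition IQDI :: pform where
  "IQDI = (\<^bold>\<forall>X. \<^bold>\<not> is_finite X \<^bold>\<longrightarrow> quasi_Dedekind_infinite X)"


section \<open>The real line\<close>

text \<open>Natural numbers are added and multiplied as cardinals.\<close>

definition is_plus :: "var \<Rightarrow> var \<Rightarrow> var \<Rightarrow> pform" where
  "is_plus k m n = (is_nat k \<^bold>\<and>
     (\<^bold>\<exists>A B C. equipotent A m \<^bold>\<and> equipotent B n \<^bold>\<and> disjoint A B \<^bold>\<and> is_Un C A B \<^bold>\<and> equipotent k C))"

definition is_times :: "var \<Rightarrow> var \<Rightarrow> var \<Rightarrow> pform" where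
  "is_times k m n = (is_nat k \<^bold>\<and> (\<^bold>\<exists>P. is_Times P m n \<^bold>\<and> equipotent k P))"

text \<open>
  The triple \<open>((a, b), c)\<close> of natural numbers with \<open>c \<noteq> 0\<close> represents the rational number
  \<open>(a - b) / c\<close>.  Representatives need not be identified: \<open>frac_less\<close> compares the represented
  numbers, and a Dedekind cut, being downward closed without a greatest element, contains with a
  representative all representatives of the same rational number.  Natural numbers are compared
  by \<open>\<in>\<close>.
\<close>

definition is_frac :: "var \<Rightarrow> var \<Rightarrow> var \<Rightarrow> var \<Rightarrow> pform" where
  "is_frac q a b c =
     (is_nat a \<^bold>\<and> is_nat b \<^bold>\<and> is_nat c \<^bold>\<and> \<^bold>\<not> is_empty c \<^bold>\<and> (\<^bold>\<exists>p. is_pair p a b \<^bold>\<and> is_pair q p c))"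

definition is_rat :: "var \<Rightarrow> pform" where
  "is_rat q = (\<^bold>\<exists>a b c. is_frac q a b c)"

text \<open>\<open>(a - b) / c < (a' - b') / c'\<close> iff \<open>a * c' + b' * c < a' * c + b * c'\<close>.\<close>

definition frac_less :: "var \<Rightarrow> var \<Rightarrow> pform" where
  "frac_less q q' = (\<^bold>\<exists>a b c a' b' c'. is_frac q a b c \<^bold>\<and> is_frac q' a' b' c' \<^bold>\<and>
     (\<^bold>\<exists>s t u v m n. is_times s a c' \<^bold>\<and> is_times t b' c \<^bold>\<and> is_plus m s t \<^bold>\<and>
                     is_times u a' c \<^bold>\<and> is_times v b c' \<^bold>\<and> is_plus n u v \<^bold>\<and> m \<^bold>\<in> n))"

text \<open>A real number is the lower half of a Dedekind cut of the rationals.\<close>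

definition is_real :: "var \<Rightarrow> pform" where
  "is_real r =
     ((\<^bold>\<forall>q. q \<^bold>\<in> r \<^bold>\<longrightarrow> is_rat q) \<^bold>\<and>
      (\<^bold>\<exists>q. q \<^bold>\<in> r) \<^bold>\<and>
      (\<^bold>\<exists>q. is_rat q \<^bold>\<and> \<^bold>\<not> q \<^bold>\<in> r) \<^bold>\<and>
      (\<^bold>\<forall>p q. q \<^bold>\<in> r \<^bold>\<and> frac_less p q \<^bold>\<longrightarrow> p \<^bold>\<in> r) \<^bold>\<and>
      (\<^bold>\<forall>q. q \<^bold>\<in> r \<^bold>\<longrightarrow> (\<^bold>\<exists>p. p \<^bold>\<in> r \<^bold>\<and> frac_less q p)))"

definition is_Reals :: "var \<Rightarrow> pform" where
  "is_Reals R = (\<^bold>\<forall>r. r \<^bold>\<in> R \<^bold>\<longleftrightarrow> is_real r)"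

definition real_less :: "var \<Rightarrow> var \<Rightarrow> pform" where
  "real_less r s = (r \<^bold>\<subseteq> s \<^bold>\<and> \<^bold>\<not> r \<^bold>= s)"

text \<open>The cut \<open>{q. q < 0}\<close>.\<close>

definition is_real_zero :: "var \<Rightarrow> pform" where
  "is_real_zero r = (\<^bold>\<forall>q. q \<^bold>\<in> r \<^bold>\<longleftrightarrow> (\<^bold>\<exists>a b c. is_frac q a b c \<^bold>\<and> a \<^bold>\<in> b))"

definition real_open :: "var \<Rightarrow> pform" where
  "real_open V = (\<^bold>\<forall>r. r \<^bold>\<in> V \<^bold>\<longrightarrow> is_real r \<^bold>\<and>
     (\<^bold>\<exists>a b. is_real a \<^bold>\<and> is_real b \<^bold>\<and> real_less a r \<^bold>\<and> real_less r b \<^bold>\<and>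
            (\<^bold>\<forall>s. is_real s \<^bold>\<and> real_less a s \<^bold>\<and> real_less s b \<^bold>\<longrightarrow> s \<^bold>\<in> V)))"

definition IDI_Reals :: pform where
  "IDI_Reals = (\<^bold>\<forall>R A. is_Reals R \<^bold>\<and> A \<^bold>\<subseteq> R \<^bold>\<and> \<^bold>\<not> is_finite A \<^bold>\<longrightarrow> Dedekind_infinite A)"


section \<open>Topological spaces\<close>

text \<open>\<open>X\<close> is the underlying set and \<open>T\<close> the set of open sets.\<close>

definition is_topology :: "var \<Rightarrow> var \<Rightarrow> pform" where
  "is_topology X T =
     ((\<^bold>\<forall>U. U \<^bold>\<in> T \<^bold>\<longrightarrow> U \<^bold>\<subseteq> X) \<^bold>\<and>
      (\<^bold>\<forall>E. is_empty E \<^bold>\<longrightarrow> E \<^bold>\<in> T) \<^bold>\<and>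
      X \<^bold>\<in> T \<^bold>\<and>
      (\<^bold>\<forall>U V W. U \<^bold>\<in> T \<^bold>\<and> V \<^bold>\<in> T \<^bold>\<and> is_Int W U V \<^bold>\<longrightarrow> W \<^bold>\<in> T) \<^bold>\<and>
      (\<^bold>\<forall>S U. S \<^bold>\<subseteq> T \<^bold>\<and> is_Union U S \<^bold>\<longrightarrow> U \<^bold>\<in> T))"

definition T1_space :: "var \<Rightarrow> var \<Rightarrow> pform" where
  "T1_space X T = (\<^bold>\<forall>x y. x \<^bold>\<in> X \<^bold>\<and> y \<^bold>\<in> X \<^bold>\<and> \<^bold>\<not> x \<^bold>= y \<^bold>\<longrightarrow> (\<^bold>\<exists>U. U \<^bold>\<in> T \<^bold>\<and> x \<^bold>\<in> U \<^bold>\<and> \<^bold>\<not> y \<^bold>\<in> U))"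

definition G_delta :: "var \<Rightarrow> var \<Rightarrow> var \<Rightarrow> pform" where
  "G_delta X T G = (\<^bold>\<exists>w u. is_omega w \<^bold>\<and> is_function u w T \<^bold>\<and>
     (\<^bold>\<forall>x. x \<^bold>\<in> G \<^bold>\<longleftrightarrow> x \<^bold>\<in> X \<^bold>\<and> (\<^bold>\<forall>n U. pair_in n U u \<^bold>\<longrightarrow> x \<^bold>\<in> U)))"

definition P_space :: "var \<Rightarrow> var \<Rightarrow> pform" where
  "P_space X T = (\<^bold>\<forall>G. G_delta X T G \<^bold>\<longrightarrow> G \<^bold>\<in> T)"

definition continuous_real :: "var \<Rightarrow> var \<Rightarrow> var \<Rightarrow> pform" where
  "continuous_real X T f = (\<^bold>\<exists>R. is_Reals R \<^bold>\<and> is_function f X R \<^bold>\<and>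
     (\<^bold>\<forall>V W. real_open V \<^bold>\<and> (\<^bold>\<forall>x. x \<^bold>\<in> W \<^bold>\<longleftrightarrow> x \<^bold>\<in> X \<^bold>\<and> (\<^bold>\<exists>r. r \<^bold>\<in> V \<^bold>\<and> pair_in x r f)) \<^bold>\<longrightarrow> W \<^bold>\<in> T))"

definition zero_set :: "var \<Rightarrow> var \<Rightarrow> var \<Rightarrow> pform" where
  "zero_set X T Z = (\<^bold>\<exists>f z. continuous_real X T f \<^bold>\<and> is_real_zero z \<^bold>\<and>
     (\<^bold>\<forall>x. x \<^bold>\<in> Z \<^bold>\<longleftrightarrow> x \<^bold>\<in> X \<^bold>\<and> pair_in x z f))"

definition cozero_set :: "var \<Rightarrow> var \<Rightarrow> var \<Rightarrow> pform" where
  "cozero_set X T C = (\<^bold>\<exists>Z. zero_set X T Z \<^bold>\<and> is_Diff C X Z)"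

definition is_base :: "(var \<Rightarrow> pform) \<Rightarrow> var \<Rightarrow> pform" where
  "is_base B T = ((\<^bold>\<forall>C. B C \<^bold>\<longrightarrow> C \<^bold>\<in> T) \<^bold>\<and>
     (\<^bold>\<forall>U x. U \<^bold>\<in> T \<^bold>\<and> x \<^bold>\<in> U \<^bold>\<longrightarrow> (\<^bold>\<exists>C. B C \<^bold>\<and> x \<^bold>\<in> C \<^bold>\<and> C \<^bold>\<subseteq> U)))"

definition completely_regular :: "var \<Rightarrow> var \<Rightarrow> pform" where
  "completely_regular X T = is_base (cozero_set X T) T"

definition Tychonoff :: "var \<Rightarrow> var \<Rightarrow> pform" where
  "Tychonoff X T = (completely_regular X T \<^bold>\<and> T1_space X T)"

definition clopen :: "var \<Rightarrow> var \<Rightarrow> var \<Rightarrow> pform" where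
  "clopen X T U = (U \<^bold>\<in> T \<^bold>\<and> (\<^bold>\<exists>V. is_Diff V X U \<^bold>\<and> V \<^bold>\<in> T))"

definition strongly_zero_dimensional :: "var \<Rightarrow> var \<Rightarrow> pform" where
  "strongly_zero_dimensional X T = (completely_regular X T \<^bold>\<and>
     (\<^bold>\<forall>Z Z'. zero_set X T Z \<^bold>\<and> zero_set X T Z' \<^bold>\<and> disjoint Z Z' \<^bold>\<longrightarrow>
        (\<^bold>\<exists>U D. clopen X T U \<^bold>\<and> is_Diff D X Z' \<^bold>\<and> Z \<^bold>\<subseteq> U \<^bold>\<and> U \<^bold>\<subseteq> D)))"

definition covers :: "var \<Rightarrow> var \<Rightarrow> pform" where
  "covers S K = (\<^bold>\<forall>x. x \<^bold>\<in> K \<^bold>\<longrightarrow> (\<^bold>\<exists>U. U \<^bold>\<in> S \<^bold>\<and> x \<^bold>\<in> U))"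

definition compact_subset :: "var \<Rightarrow> var \<Rightarrow> pform" where
  "compact_subset T K = (\<^bold>\<forall>S. S \<^bold>\<subseteq> T \<^bold>\<and> covers S K \<^bold>\<longrightarrow>
     (\<^bold>\<exists>F. F \<^bold>\<subseteq> S \<^bold>\<and> is_finite F \<^bold>\<and> covers F K))"

definition compact_space :: "var \<Rightarrow> var \<Rightarrow> pform" where
  "compact_space X T = compact_subset T X"

definition locally_compact_space :: "var \<Rightarrow> var \<Rightarrow> pform" where
  "locally_compact_space X T = (\<^bold>\<forall>x. x \<^bold>\<in> X \<^bold>\<longrightarrow>
     (\<^bold>\<exists>U K. U \<^bold>\<in> T \<^bold>\<and> x \<^bold>\<in> U \<^bold>\<and> U \<^bold>\<subseteq> K \<^bold>\<and> K \<^bold>\<subseteq> X \<^bold>\<and> compact_subset T K))"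

definition discrete_space :: "var \<Rightarrow> var \<Rightarrow> pform" where
  "discrete_space X T = (\<^bold>\<forall>A. A \<^bold>\<subseteq> X \<^bold>\<longrightarrow> A \<^bold>\<in> T)"

definition accumulation_point :: "var \<Rightarrow> var \<Rightarrow> var \<Rightarrow> pform" where
  "accumulation_point T A x = (\<^bold>\<forall>U. U \<^bold>\<in> T \<^bold>\<and> x \<^bold>\<in> U \<^bold>\<longrightarrow> (\<^bold>\<exists>y. y \<^bold>\<in> U \<^bold>\<and> y \<^bold>\<in> A \<^bold>\<and> \<^bold>\<not> y \<^bold>= x))"

definition limit_point_compact :: "var \<Rightarrow> var \<Rightarrow> pform" where
  "limit_point_compact X T = (\<^bold>\<forall>A. A \<^bold>\<subseteq> X \<^bold>\<and> \<^bold>\<not> is_finite A \<^bold>\<longrightarrow>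
     (\<^bold>\<exists>x. x \<^bold>\<in> X \<^bold>\<and> accumulation_point T A x))"


section \<open>The sentences\<close>

definition compact_Tychonoff_P_spaces_finite :: pform where
  "compact_Tychonoff_P_spaces_finite = (\<^bold>\<forall>X T. is_topology X T \<^bold>\<and>
     compact_space X T \<^bold>\<and> Tychonoff X T \<^bold>\<and> P_space X T \<^bold>\<longrightarrow> is_finite X)"

definition locally_compact_Tychonoff_P_spaces_discrete :: pform where
  "locally_compact_Tychonoff_P_spaces_discrete = (\<^bold>\<forall>X T. is_topology X T \<^bold>\<and>
     locally_compact_space X T \<^bold>\<and> Tychonoff X T \<^bold>\<and> P_space X T \<^bold>\<longrightarrow> discrete_space X T)"

definition limit_point_compact_T1_P_spaces_finite :: pform where
  "limit_point_compact_T1_P_spaces_finite = (\<^bold>\<forall>X T. is_topology X T \<^bold>\<and>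
     P_space X T \<^bold>\<and> limit_point_compact X T \<^bold>\<and> T1_space X T \<^bold>\<longrightarrow> is_finite X)"

definition quasi_Dedekind_finite_strongly_zero_dimensional_T1_spaces_P :: pform where
  "quasi_Dedekind_finite_strongly_zero_dimensional_T1_spaces_P = (\<^bold>\<forall>X T. is_topology X T \<^bold>\<and>
     strongly_zero_dimensional X T \<^bold>\<and> T1_space X T \<^bold>\<and> quasi_Dedekind_finite X \<^bold>\<longrightarrow> P_space X T)"

end

theory Submission
  imports Defs "HOL-Library.Countable_Set"
begin

text \<open>
  By the completeness theorem it suffices to verify the implications in an arbitrary model
  \<open>E\<close> of ZF with a countable universe.  There we argue as in set theory, with HOL predicates for
  the sets and functions of the model; separation and replacement apply to predicates that are
  definable by a formula with parameters.

  An infinite set \<open>X\<close> that is quasi Dedekind-finite becomes a counterexample to the first three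
  sentences when all points but one point \<open>x0\<close> are isolated and \<open>x0\<close> has the cofinite sets containing
  it as neighbourhoods: a \<open>G\<^sub>\<delta>\<close>-set containing \<open>x0\<close> misses the union of a sequence of finite sets,
  which is finite.  Conversely, if \<open>[X]\<^sup><\<^sup>\<omega>\<close> is Dedekind-infinite, there is a sequence of finite subsets
  of \<open>X\<close> with an infinite union; in a \<open>T\<^sub>1\<close> P-space every subset of this union is closed, so it has no
  accumulation point.

  Let \<open>A\<close> be an infinite Dedekind-finite set of reals.  Since finite sets of reals are well-ordered
  by the order of the reals, \<open>A\<close> is quasi Dedekind-finite.  Comparing the elements of \<open>A\<close> with an
  accumulation point on finite sets of rationals yields a decreasing sequence of infinite subsets
  of \<open>A\<close> with empty intersection.  Taking these as the punctured neighbourhoods of a point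
  \<open>x0\<close> of \<open>A\<close>, and all other points isolated, makes \<open>A\<close> a strongly zero-dimensional \<open>T\<^sub>1\<close>-space in
  which \<open>{x0}\<close> is a \<open>G\<^sub>\<delta>\<close>-set but not open.
\<close>

section \<open>Completeness of the calculus\<close>

text \<open>HOL has choice, so an external function or sequence proves nothing about the model. A
  function must be an element of the model, or definable with parameters, in which case replacement
  makes its restriction to a set an element; and every induction needs a definable predicate.
  Moreover the natural numbers \<open>N\<close> of the model may be nonstandard, so HOL's induction,
  arithmetic and finiteness do not apply to them, and finiteness, arithmetic, recursion and the
  reals are rebuilt inside the model. The predicates \<open>dfn\<close> and \<open>dfnt\<close>
  follow the syntax of HOL terms so that these side conditions are discharged by introduction rules.

  Choice is replaced by canonical picks: unique descriptions via \<open>the_elt\<close>, least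
  natural numbers, the inclusion order of Dedekind cuts, or the family of all sets with a property.
  In the same spirit, the accumulation point of a set of reals is described by its rationals:
  \<open>q\<close> lies below it if infinitely many elements of the set contain \<open>q\<close>.

  The universe of the models can be all of \<open>nat\<close> because a model of ZF is infinite, so
  the quotient of the countable term model can be renumbered.\<close>

lemma ren_ren: "ren f (ren g p) = ren (\<lambda>i. f (g i)) p"
proof (induction p arbitrary: f g)
  case (Univ p)
  have "(\<lambda>i. case_nat 0 (\<lambda>i. Suc (f i)) (case_nat 0 (\<lambda>i. Suc (g i)) i)) = case_nat 0 (\<lambda>i. Suc (f (g i)))"
    by (auto split: nat.split)
  with Univ show ?case by simp
qed auto

lemma ren_cong: "(\<And>i. i \<in> free_vars p \<Longrightarrow> f i = g i) \<Longrightarrow> ren f p = ren g p"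
proof (induction p arbitrary: f g)
  case (Univ p)
  show ?case
    using Univ.prems by (auto intro!: Univ.IH split: nat.split)
next
  case (Imp p q)
  have "ren f p = ren g p" "ren f q = ren g q"
    by (rule Imp.IH; simp add: Imp.prems)+
  then show ?case by simp
qed simp_all

lemma ren_id [simp]: "ren (\<lambda>i. i) p = p"
proof (induction p)
  case (Univ p)
  have "case_nat 0 Suc = (\<lambda>i. i)" by (auto split: nat.split)
  with Univ show ?case by simp
qed auto

lemma finite_free_vars: "finite (free_vars p)"
proof (induction p)
  case (Univ p)
  have "{i. Suc i \<in> free_vars p} = Suc -` free_vars p" by auto
  with Univ show ?case by (simp add: finite_vimageI)
qed auto

lemma ren_inst: "ren f (inst t p) = inst (f t) (ren (case_nat 0 (\<lambda>i. Suc (f i))) p)"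
  unfolding inst_def ren_ren by (rule ren_cong) (auto split: nat.split)

lemma ren_lift_Suc: "ren (case_nat 0 (\<lambda>i. Suc (f i))) (ren Suc p) = ren Suc (ren f p)"
  unfolding ren_ren by simp

text \<open>\<open>f\<close> need not be injective, since instantiation commutes with every renaming
  (\<open>ren_inst\<close>). This serves to free infinitely many variables and to turn a fresh
  variable into a bound one.\<close>

lemma deriv_ren: "\<Gamma> \<turnstile> p \<Longrightarrow> ren f ` \<Gamma> \<turnstile> ren f p"
proof (induction arbitrary: f rule: deriv.induct)
  case (Assm p \<Gamma>)
  then show ?case by (simp add: deriv.Assm)
next
  case (ImpI p \<Gamma> q)
  then show ?case by (simp add: deriv.ImpI)
next
  case (ImpE \<Gamma> p q)
  from ImpE.IH(1)[of f] ImpE.IH(2)[of f] show ?case unfolding ren.simps by (rule deriv.ImpE)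
next
  case (Raa p \<Gamma>)
  from Raa.IH[of f] show ?case using deriv.Raa[of "ren f p"] by simp
next
  case (UnivI \<Gamma> p)
  have "ren (case_nat 0 (\<lambda>i. Suc (f i))) ` ren Suc ` \<Gamma> = ren Suc ` ren f ` \<Gamma>"
    by (simp add: image_image ren_lift_Suc)
  with UnivI.IH[of "case_nat 0 (\<lambda>i. Suc (f i))"] show ?case
    by (simp add: deriv.UnivI)
next
  case (UnivE \<Gamma> p t)
  then have "ren f ` \<Gamma> \<turnstile> Univ (ren (case_nat 0 (\<lambda>i. Suc (f i))) p)" by simp
  then show ?case unfolding ren_inst by (rule deriv.UnivE)
next
  case (EqI \<Gamma> t)
  then show ?case by (simp add: deriv.EqI)
next
  case (EqE \<Gamma> s t p)
  from EqE.IH(1)[of f] EqE.IH(2)[of f] show ?case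
    unfolding ren_inst ren.simps by (rule deriv.EqE)
qed

lemma deriv_mono: "\<Gamma> \<turnstile> p \<Longrightarrow> \<Gamma> \<subseteq> \<Delta> \<Longrightarrow> \<Delta> \<turnstile> p"
proof (induction arbitrary: \<Delta> rule: deriv.induct)
  case (ImpI p \<Gamma> q)
  then show ?case by (meson deriv.ImpI insert_mono)
next
  case (ImpE \<Gamma> p q)
  then show ?case by (meson deriv.ImpE)
next
  case (Raa p \<Gamma>)
  then show ?case by (meson deriv.Raa insert_mono)
next
  case (UnivI \<Gamma> p)
  then show ?case by (meson deriv.UnivI image_mono)
next
  case (UnivE \<Gamma> p t)
  then show ?case by (meson deriv.UnivE)
next
  case (EqE \<Gamma> s t p)
  then show ?case by (meson deriv.EqE)
qed (auto intro: deriv.Assm deriv.EqI)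

text \<open>Contexts may be infinite sets; that each derivation uses only finitely many assumptions
  makes consistency pass to the union of the Henkin chain.\<close>

lemma deriv_finite: "\<Gamma> \<turnstile> p \<Longrightarrow> \<exists>\<Delta>. finite \<Delta> \<and> \<Delta> \<subseteq> \<Gamma> \<and> \<Delta> \<turnstile> p"
proof (induction rule: deriv.induct)
  case (Assm p \<Gamma>)
  then show ?case by (intro exI[of _ "{p}"]) (auto intro: deriv.Assm)
next
  case (ImpI p \<Gamma> q)
  then obtain \<Delta> where "finite \<Delta>" "\<Delta> \<subseteq> insert p \<Gamma>" "\<Delta> \<turnstile> q" by blast
  then have "\<Delta> - {p} \<turnstile> Imp p q" 
    by - (rule deriv.ImpI, rule deriv_mono[of \<Delta> q], auto)
  with \<open>finite \<Delta>\<close> \<open>\<Delta> \<subseteq> insert p \<Gamma>\<close> show ?case by (intro exI[of _ "\<Delta> - {p}"]) auto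
next
  case (ImpE \<Gamma> p q)
  then obtain \<Delta> \<Delta>' where "finite \<Delta>" "\<Delta> \<subseteq> \<Gamma>" "\<Delta> \<turnstile> Imp p q" "finite \<Delta>'" "\<Delta>' \<subseteq> \<Gamma>" "\<Delta>' \<turnstile> p"
    by blast
  then have "\<Delta> \<union> \<Delta>' \<turnstile> q" 
    using deriv.ImpE[of "\<Delta> \<union> \<Delta>'" p q] deriv_mono[of \<Delta> _ "\<Delta> \<union> \<Delta>'"] deriv_mono[of \<Delta>' _ "\<Delta> \<union> \<Delta>'"]
    by simp
  with \<open>finite \<Delta>\<close> \<open>\<Delta> \<subseteq> \<Gamma>\<close> \<open>finite \<Delta>'\<close> \<open>\<Delta>' \<subseteq> \<Gamma>\<close> show ?case
    by (intro exI[of _ "\<Delta> \<union> \<Delta>'"]) auto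
next
  case (Raa p \<Gamma>)
  then obtain \<Delta> where "finite \<Delta>" "\<Delta> \<subseteq> insert (Imp p Bot) \<Gamma>" "\<Delta> \<turnstile> Bot" by blast
  then have "\<Delta> - {Imp p Bot} \<turnstile> p" 
    by - (rule deriv.Raa[of p], rule deriv_mono[of \<Delta> Bot], auto)
  with \<open>finite \<Delta>\<close> \<open>\<Delta> \<subseteq> insert (Imp p Bot) \<Gamma>\<close> show ?case
    by (intro exI[of _ "\<Delta> - {Imp p Bot}"]) auto
next
  case (UnivI \<Gamma> p)
  then obtain \<Delta> where \<Delta>: "finite \<Delta>" "\<Delta> \<subseteq> ren Suc ` \<Gamma>" "\<Delta> \<turnstile> p" by blast
  then obtain \<Delta>' where "\<Delta>' \<subseteq> \<Gamma>" "finite \<Delta>'" "\<Delta> = ren Suc ` \<Delta>'"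
    using finite_subset_image by metis
  with \<Delta> deriv.UnivI[of \<Delta>' p] show ?case by blast
next
  case (UnivE \<Gamma> p t)
  then obtain \<Delta> where "finite \<Delta>" "\<Delta> \<subseteq> \<Gamma>" "\<Delta> \<turnstile> Univ p" by blast
  with deriv.UnivE[of \<Delta> p t] show ?case by blast
next
  case (EqI \<Gamma> t)
  then show ?case by (intro exI[of _ "{}"]) (auto intro: deriv.EqI)
next
  case (EqE \<Gamma> s t p)
  then obtain \<Delta> \<Delta>' where "finite \<Delta>" "\<Delta> \<subseteq> \<Gamma>" "\<Delta> \<turnstile> Eq s t" "finite \<Delta>'" "\<Delta>' \<subseteq> \<Gamma>" "\<Delta>' \<turnstile> inst s p"
    by blast
  then have "\<Delta> \<union> \<Delta>' \<turnstile> inst t p" 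
    using deriv.EqE[of "\<Delta> \<union> \<Delta>'" s t p] deriv_mono[of \<Delta> _ "\<Delta> \<union> \<Delta>'"] deriv_mono[of \<Delta>' _ "\<Delta> \<union> \<Delta>'"]
    by simp
  with \<open>finite \<Delta>\<close> \<open>\<Delta> \<subseteq> \<Gamma>\<close> \<open>finite \<Delta>'\<close> \<open>\<Delta>' \<subseteq> \<Gamma>\<close> show ?case
    by (intro exI[of _ "\<Delta> \<union> \<Delta>'"]) auto
qed

section \<open>Henkin extension of a consistent set\<close>

instance fm :: countable
  by countable_datatype

definition free_vars_set :: "fm set \<Rightarrow> nat set" where
  "free_vars_set \<Gamma> = (\<Union>p\<in>\<Gamma>. free_vars p)"

text \<open>\<open>Univ\<close> is the only quantifier, so witnesses are required for negated
  universals: \<open>c\<close> names a counterexample.\<close>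

fun witness :: "nat \<Rightarrow> fm \<Rightarrow> fm set" where
  "witness c (Imp (Univ q) Bot) = {Imp (inst c q) Bot}"
| "witness c p = {}"

lemma finite_witness: "finite (witness c p)"
  by (cases "(c, p)" rule: witness.cases) auto

text \<open>Renaming the fresh variable \<open>c\<close> to 0 turns a derivation of the instance at \<open>c\<close> into a
  premise of the rule \<open>UnivI\<close>.\<close>

lemma deriv_generalize:
  assumes "\<Gamma> \<turnstile> inst c q" "c \<notin> free_vars_set \<Gamma>" "c \<notin> free_vars (Univ q)"
  shows "\<Gamma> \<turnstile> Univ q"
proof -
  define f where "f = (\<lambda>i. if i = c then 0 else Suc i)"
  have "ren f ` \<Gamma> = ren Suc ` \<Gamma>"
    using assms(2) by (intro image_cong refl ren_cong) (auto simp: f_def free_vars_set_def)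
  moreover have "ren f (inst c q) = ren (\<lambda>i. i) q"
    unfolding inst_def ren_ren
    by (rule ren_cong) (use assms(3) in \<open>auto simp: f_def split: nat.split\<close>)
  ultimately show ?thesis
    using deriv_ren[OF assms(1), of f] by (simp add: deriv.UnivI)
qed

text \<open>If the witness were contradictory, \<open>inst c q\<close> would follow, and
  generalizing the fresh \<open>c\<close> would give the very universal formula that
  \<open>p\<close> denies.\<close>

lemma witness_consistent:
  assumes "\<not> insert p \<Gamma> \<turnstile> Bot" "c \<notin> free_vars_set (insert p \<Gamma>)"
  shows "\<not> witness c p \<union> insert p \<Gamma> \<turnstile> Bot"
proof (cases "(c, p)" rule: witness.cases)
  case (1 c' q)
  then have p: "p = Imp (Univ q) Bot" by simp
  show ?thesis
  proof
    assume "witness c p \<union> insert p \<Gamma> \<turnstile> Bot"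
    then have "insert p \<Gamma> \<turnstile> inst c q" unfolding p by (intro deriv.Raa[of "inst c q"]) (simp add: insert_commute)
    then have "insert p \<Gamma> \<turnstile> Univ q"
      by (rule deriv_generalize) (use assms(2) in \<open>auto simp: p free_vars_set_def\<close>)
    moreover have "insert p \<Gamma> \<turnstile> Imp (Univ q) Bot" unfolding p by (simp add: deriv.Assm)
    ultimately have "insert p \<Gamma> \<turnstile> Bot" by - (rule deriv.ImpE)
    with assms(1) show False by simp
  qed
qed (use assms(1) in auto)

text \<open>Accepting \<open>p\<close> and adding its witness in one step keeps every stage a finite
  extension of the initial set, so infinitely many variables remain fresh.\<close>

definition henkin_step :: "fm \<Rightarrow> fm set \<Rightarrow> fm set" where
  "henkin_step p \<Gamma> = (if insert p \<Gamma> \<turnstile> Bot then \<Gamma>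
     else witness (SOME c. c \<notin> free_vars_set (insert p \<Gamma>)) p \<union> insert p \<Gamma>)"

primrec henkin_seq :: "fm set \<Rightarrow> nat \<Rightarrow> fm set" where
  "henkin_seq \<Gamma> 0 = \<Gamma>"
| "henkin_seq \<Gamma> (Suc n) = henkin_step (from_nat n) (henkin_seq \<Gamma> n)"

definition henkin :: "fm set \<Rightarrow> fm set" where
  "henkin \<Gamma> = (\<Union>n. henkin_seq \<Gamma> n)"

lemma infinite_fresh:
  assumes "infinite (- free_vars_set \<Gamma>)" "finite \<Delta>"
  shows "infinite (- free_vars_set (\<Delta> \<union> \<Gamma>))"
proof -
  have "- free_vars_set (\<Delta> \<union> \<Gamma>) = - free_vars_set \<Gamma> - free_vars_set \<Delta>"
    by (auto simp: free_vars_set_def)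
  moreover have "finite (free_vars_set \<Delta>)"
    using assms(2) by (simp add: free_vars_set_def finite_free_vars)
  ultimately show ?thesis using assms(1) by (simp add: Diff_infinite_finite)
qed

context
  fixes \<Gamma> :: "fm set"
  assumes consistent: "\<not> \<Gamma> \<turnstile> Bot" and fresh: "infinite (- free_vars_set \<Gamma>)"
begin

text \<open>Names the chosen variable once, so that the later arguments need not handle
  \<open>SOME\<close>.\<close>

lemma henkin_step_eq:
  "\<exists>c. henkin_step p \<Delta> = (if insert p \<Delta> \<turnstile> Bot then \<Delta> else insert p (witness c p) \<union> \<Delta>) \<and>
    ((\<exists>c. c \<notin> free_vars_set (insert p \<Delta>)) \<longrightarrow> c \<notin> free_vars_set (insert p \<Delta>))"
proof (intro exI[of _ "SOME c. c \<notin> free_vars_set (insert p \<Delta>)"] conjI impI)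
  assume "\<exists>c. c \<notin> free_vars_set (insert p \<Delta>)"
  then show "(SOME c. c \<notin> free_vars_set (insert p \<Delta>)) \<notin> free_vars_set (insert p \<Delta>)"
    by (rule someI_ex)
qed (simp add: henkin_step_def)

lemma henkin_seq_infinite_fresh: "infinite (- free_vars_set (henkin_seq \<Gamma> n))"
proof (induction n)
  case (Suc n)
  obtain c where "henkin_seq \<Gamma> (Suc n) = (if insert (from_nat n) (henkin_seq \<Gamma> n) \<turnstile> Bot
      then henkin_seq \<Gamma> n else insert (from_nat n) (witness c (from_nat n)) \<union> henkin_seq \<Gamma> n)"
    using henkin_step_eq[of "from_nat n" "henkin_seq \<Gamma> n"] unfolding henkin_seq.simps by blast
  moreover have "infinite (- free_vars_set (insert (from_nat n) (witness c (from_nat n)) \<union> henkin_seq \<Gamma> n))"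
    by (rule infinite_fresh[OF Suc]) (simp add: finite_witness)
  ultimately show ?case using Suc by presburger
qed (use fresh in simp)

lemma henkin_seq_consistent: "\<not> henkin_seq \<Gamma> n \<turnstile> Bot"
proof (induction n)
  case (Suc n)
  let ?p = "from_nat n" let ?S = "henkin_seq \<Gamma> n"
  obtain c where c: "henkin_seq \<Gamma> (Suc n) = (if insert ?p ?S \<turnstile> Bot
      then ?S else insert ?p (witness c ?p) \<union> ?S)"
    "(\<exists>c. c \<notin> free_vars_set (insert ?p ?S)) \<longrightarrow> c \<notin> free_vars_set (insert ?p ?S)"
    using henkin_step_eq[of ?p ?S] unfolding henkin_seq.simps by blast
  have "infinite (- free_vars_set ({?p} \<union> ?S))"
    by (rule infinite_fresh[OF henkin_seq_infinite_fresh]) simp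
  then have "- free_vars_set (insert ?p ?S) \<noteq> {}" by auto
  then have "c \<notin> free_vars_set (insert ?p ?S)" using c(2) by blast
  then have "\<not> insert ?p ?S \<turnstile> Bot \<Longrightarrow> \<not> witness c ?p \<union> insert ?p ?S \<turnstile> Bot"
    using witness_consistent by blast
  moreover have "witness c ?p \<union> insert ?p ?S = insert ?p (witness c ?p) \<union> ?S" by blast
  ultimately show ?case
    using Suc c(1) by (cases "insert ?p ?S \<turnstile> Bot") (simp_all only: if_True if_False not_False_eq_True)
qed (use consistent in simp)

lemma henkin_seq_mono: "m \<le> n \<Longrightarrow> henkin_seq \<Gamma> m \<subseteq> henkin_seq \<Gamma> n"
  by (rule lift_Suc_mono_le) (auto simp: henkin_step_def)

lemma henkin_consistent: "\<not> henkin \<Gamma> \<turnstile> Bot"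
proof
  assume "henkin \<Gamma> \<turnstile> Bot"
  then obtain \<Delta> where \<Delta>: "finite \<Delta>" "\<Delta> \<subseteq> henkin \<Gamma>" "\<Delta> \<turnstile> Bot" using deriv_finite by blast
  have "\<exists>n. \<Delta> \<subseteq> henkin_seq \<Gamma> n"
    using \<Delta>(1,2)
  proof (induction \<Delta>)
    case (insert p \<Delta>)
    then obtain m n where "p \<in> henkin_seq \<Gamma> m" "\<Delta> \<subseteq> henkin_seq \<Gamma> n"
      by (auto simp: henkin_def)
    then show ?case
      using henkin_seq_mono[of m "max m n"] henkin_seq_mono[of n "max m n"]
      by (intro exI[of _ "max m n"]) auto
  qed simp
  then show False using \<Delta>(3) henkin_seq_consistent deriv_mono[of _ Bot] by blast
qed

text \<open>\<open>p\<close> is examined at stage \<open>to_nat p\<close> and rejected only if it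
  contradicts that stage, hence also the union.\<close>

lemma henkin_maximal: "p \<notin> henkin \<Gamma> \<Longrightarrow> henkin \<Gamma> \<turnstile> Imp p Bot"
proof (rule ccontr)
  assume p: "p \<notin> henkin \<Gamma>" and "\<not> henkin \<Gamma> \<turnstile> Imp p Bot"
  then have "\<not> insert p (henkin \<Gamma>) \<turnstile> Bot" using deriv.ImpI[of p _ Bot] by blast
  moreover have "insert p (henkin_seq \<Gamma> (to_nat p)) \<subseteq> insert p (henkin \<Gamma>)"
    by (auto simp: henkin_def)
  ultimately have "\<not> insert p (henkin_seq \<Gamma> (to_nat p)) \<turnstile> Bot"
    using deriv_mono[of _ Bot] by blast
  then have "p \<in> henkin_seq \<Gamma> (Suc (to_nat p))"
    by (simp add: henkin_step_def)
  then show False using p unfolding henkin_def by blast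
qed

lemma henkin_closed: "henkin \<Gamma> \<turnstile> p \<Longrightarrow> p \<in> henkin \<Gamma>"
  using henkin_maximal[of p] henkin_consistent deriv.ImpE[of "henkin \<Gamma>" p Bot] by blast

lemma henkin_Bot: "Bot \<notin> henkin \<Gamma>"
  using henkin_consistent deriv.Assm[of Bot] by blast

lemma henkin_Imp: "Imp p q \<in> henkin \<Gamma> \<longleftrightarrow> (p \<in> henkin \<Gamma> \<longrightarrow> q \<in> henkin \<Gamma>)"
proof
  assume "Imp p q \<in> henkin \<Gamma>"
  then show "p \<in> henkin \<Gamma> \<longrightarrow> q \<in> henkin \<Gamma>"
    using henkin_closed[of q] deriv.ImpE[of "henkin \<Gamma>" p q] deriv.Assm[of _ "henkin \<Gamma>"] by blast
next
  assume *: "p \<in> henkin \<Gamma> \<longrightarrow> q \<in> henkin \<Gamma>"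
  show "Imp p q \<in> henkin \<Gamma>"
  proof (cases "p \<in> henkin \<Gamma>")
    case True
    with * have "insert p (henkin \<Gamma>) \<turnstile> q" by (simp add: deriv.Assm)
    then show ?thesis using henkin_closed deriv.ImpI by simp
  next
    case False
    then have "insert (Imp q Bot) (insert p (henkin \<Gamma>)) \<turnstile> Imp p Bot"
      using deriv_mono[OF henkin_maximal[of p], of "insert (Imp q Bot) (insert p (henkin \<Gamma>))"]
      by blast
    moreover have "insert (Imp q Bot) (insert p (henkin \<Gamma>)) \<turnstile> p"
      by (simp add: deriv.Assm)
    ultimately have "insert (Imp q Bot) (insert p (henkin \<Gamma>)) \<turnstile> Bot" by (rule deriv.ImpE)
    then have "henkin \<Gamma> \<turnstile> Imp p q" by - (rule deriv.ImpI, rule deriv.Raa)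
    then show ?thesis by (rule henkin_closed)
  qed
qed

text \<open>If \<open>Univ q\<close> is absent, its negation is present and was accepted at its own
  stage together with a witness that refutes one instance.\<close>

lemma henkin_Univ: "Univ q \<in> henkin \<Gamma> \<longleftrightarrow> (\<forall>t. inst t q \<in> henkin \<Gamma>)"
proof
  assume "Univ q \<in> henkin \<Gamma>"
  then show "\<forall>t. inst t q \<in> henkin \<Gamma>"
    using henkin_closed[of "inst t q" for t] deriv.UnivE[of "henkin \<Gamma>" q] deriv.Assm[of _ "henkin \<Gamma>"]
    by blast
next
  assume *: "\<forall>t. inst t q \<in> henkin \<Gamma>"
  show "Univ q \<in> henkin \<Gamma>"
  proof (rule ccontr)
    let ?p = "Imp (Univ q) Bot" let ?n = "to_nat ?p"
    assume "Univ q \<notin> henkin \<Gamma>"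
    then have "?p \<in> henkin \<Gamma>" using henkin_Imp by blast
    then have "insert ?p (henkin_seq \<Gamma> ?n) \<subseteq> henkin \<Gamma>" by (auto simp: henkin_def)
    then have "\<not> insert ?p (henkin_seq \<Gamma> ?n) \<turnstile> Bot"
      using henkin_consistent deriv_mono[of _ Bot] by blast
    then obtain c where "Imp (inst c q) Bot \<in> henkin_seq \<Gamma> (Suc ?n)"
      by (auto simp: henkin_step_def)
    then have "Imp (inst c q) Bot \<in> henkin \<Gamma>" unfolding henkin_def by blast
    then show False using * henkin_Imp henkin_Bot by blast
  qed
qed

end

text \<open>Equality is interpreted by a relation \<open>Q\<close>, so that the term model need not be divided out
  at once.\<close>

primrec sat :: "('a \<Rightarrow> 'a \<Rightarrow> bool) \<Rightarrow> ('a \<Rightarrow> 'a \<Rightarrow> bool) \<Rightarrow> (nat \<Rightarrow> 'a) \<Rightarrow> fm \<Rightarrow> bool" where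
  "sat E Q e (Mem i j) = E (e i) (e j)"
| "sat E Q e (Eq i j) = Q (e i) (e j)"
| "sat E Q e Bot = False"
| "sat E Q e (Imp p q) = (sat E Q e p \<longrightarrow> sat E Q e q)"
| "sat E Q e (Univ p) = (\<forall>x. sat E Q (case_nat x e) p)"

lemma sat_ren: "sat E Q e (ren f p) = sat E Q (\<lambda>i. e (f i)) p"
proof (induction p arbitrary: e f)
  case (Univ p)
  have "(\<lambda>i. case_nat x e (case_nat 0 (\<lambda>i. Suc (f i)) i)) = case_nat x (\<lambda>i. e (f i))" for x
    by (auto split: nat.split)
  with Univ show ?case by simp
qed auto

lemma sat_cong: "(\<And>i. i \<in> free_vars p \<Longrightarrow> e i = e' i) \<Longrightarrow> sat E Q e p = sat E Q e' p"
proof (induction p arbitrary: e e')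
  case (Univ p)
  have "sat E Q (case_nat x e) p = sat E Q (case_nat x e') p" for x
    using Univ.prems by (auto intro!: Univ.IH split: nat.split)
  then show ?case by simp
next
  case (Imp p q)
  have "sat E Q e p = sat E Q e' p" "sat E Q e q = sat E Q e' q"
    by (rule Imp.IH; simp add: Imp.prems)+
  then show ?case by simp
qed simp_all

section \<open>The term model\<close>

definition congruence :: "('a \<Rightarrow> 'a \<Rightarrow> bool) \<Rightarrow> ('a \<Rightarrow> 'a \<Rightarrow> bool) \<Rightarrow> bool" where
  "congruence E Q \<longleftrightarrow> equivp Q \<and> (\<forall>x x' y y'. Q x x' \<longrightarrow> Q y y' \<longrightarrow> E x y \<longrightarrow> E x' y')"

text \<open>The elements of the model are the variables, and membership in the Henkin set decides
  the atomic formulas, equality included.\<close>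

lemma completeness:
  assumes "\<not> \<Gamma> \<turnstile> p"
  shows "\<exists>(E :: nat \<Rightarrow> nat \<Rightarrow> bool) Q e. congruence E Q \<and> (\<forall>q\<in>\<Gamma>. sat E Q e q) \<and> \<not> sat E Q e p"
proof -
  let ?f = "\<lambda>i::nat. 2 * i"
  define \<Delta> where "\<Delta> = ren ?f ` insert (Imp p Bot) \<Gamma>"
  have inv: "ren (\<lambda>i. i div 2) (ren ?f q) = q" for q by (simp add: ren_ren)
  have consistent: "\<not> \<Delta> \<turnstile> Bot"
  proof
    assume "\<Delta> \<turnstile> Bot"
    then have "ren (\<lambda>i. i div 2) ` \<Delta> \<turnstile> ren (\<lambda>i. i div 2) Bot" by (rule deriv_ren)
    then have "insert (Imp p Bot) \<Gamma> \<turnstile> Bot"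
      unfolding \<Delta>_def image_image inv by simp
    then show False using assms deriv.Raa[of p] by blast
  qed
  have even: "free_vars (ren f q) \<subseteq> range f" for f q
  proof (induction q arbitrary: f)
    case (Univ q)
    have "i \<in> range f" if "Suc i \<in> range (case_nat 0 (\<lambda>i. Suc (f i)))" for i
      using that by (auto split: nat.splits)
    then show ?case using Univ[of "case_nat 0 (\<lambda>i. Suc (f i))"] by auto
  qed auto
  have fresh: "infinite (- free_vars_set \<Delta>)"
  proof -
    have "range (\<lambda>i::nat. 2 * i + 1) \<subseteq> - free_vars_set \<Delta>"
    proof clarsimp
      fix i assume "Suc (2 * i) \<in> free_vars_set \<Delta>"
      then obtain q where "Suc (2 * i) \<in> free_vars (ren ?f q)"
        unfolding free_vars_set_def \<Delta>_def by blast
      then have "Suc (2 * i) \<in> range ?f" using even by blast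
      then show False by (metis even_Suc even_mult_iff even_numeral rangeE)
    qed
    moreover have "infinite (range (\<lambda>i::nat. 2 * i + 1))"
      by (rule range_inj_infinite) (simp add: inj_def)
    ultimately show ?thesis using infinite_super by blast
  qed
  let ?H = "henkin \<Delta>"
  note H = henkin_Imp[OF consistent fresh] henkin_Univ[OF consistent fresh] henkin_Bot[OF consistent fresh]
  let ?E = "\<lambda>i j. Mem i j \<in> ?H" let ?Q = "\<lambda>i j. Eq i j \<in> ?H"
  have truth: "sat ?E ?Q e q \<longleftrightarrow> ren e q \<in> ?H" for e q
  proof (induction q arbitrary: e)
    case (Univ q)
    have "inst t (ren (case_nat 0 (\<lambda>i. Suc (e i))) q) = ren (case_nat t e) q" for t
      unfolding inst_def ren_ren by (rule ren_cong) (auto split: nat.split)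
    with Univ show ?case by (simp add: H)
  qed (auto simp: H)
  have subst: "inst t q \<in> ?H" if "Eq s t \<in> ?H" "inst s q \<in> ?H" for s t q
  proof -
    have "?H \<turnstile> Eq s t" "?H \<turnstile> inst s q" using that by (simp_all add: deriv.Assm)
    then have "?H \<turnstile> inst t q" by (rule deriv.EqE)
    then show ?thesis by (rule henkin_closed[OF consistent fresh])
  qed
  have refl: "?Q i i" for i
    by (rule henkin_closed[OF consistent fresh], rule deriv.EqI)
  \<comment> \<open>In the instances of \<open>subst\<close> the index 0 marks the place that is
    rewritten, and \<open>Suc i\<close> becomes \<open>i\<close> under instantiation.\<close>
  have sym: "?Q j i" if "?Q i j" for i j
    using subst[OF that, of "Eq 0 (Suc i)"] refl by (simp add: inst_def)
  have trans: "?Q i k" if "?Q i j" "?Q j k" for i j k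
    using subst[OF that(2), of "Eq (Suc i) 0"] that(1) by (simp add: inst_def)
  have mem: "?E i' j'" if "?Q i i'" "?Q j j'" "?E i j" for i j i' j'
    using subst[OF that(1), of "Mem 0 (Suc j)"] subst[OF that(2), of "Mem (Suc i') 0"] that(3)
    by (simp add: inst_def)
  have "equivp ?Q"
  proof (rule equivpI)
    show "reflp ?Q" by (rule reflpI) (rule refl)
    show "symp ?Q" by (rule sympI) (rule sym)
    show "transp ?Q" by (rule transpI) (rule trans)
  qed
  then have "congruence ?E ?Q"
    unfolding congruence_def using mem by blast
  moreover have sub: "ren ?f ` insert (Imp p Bot) \<Gamma> \<subseteq> ?H"
    using henkin_seq.simps(1)[of \<Delta>] unfolding henkin_def \<Delta>_def by blast
  then have "\<forall>q\<in>\<Gamma>. sat ?E ?Q ?f q" unfolding truth by blast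
  moreover have "Imp (ren ?f p) Bot \<in> ?H" using sub by auto
  then have "\<not> sat ?E ?Q ?f p" unfolding truth H(1) using H(3) by blast
  ultimately show ?thesis by blast
qed

section \<open>Semantics of the named syntax\<close>

text \<open>Level \<open>i < d\<close> has the value \<open>v i\<close>; the indices pointing outside the \<open>d\<close> enclosing
  quantifiers have the values \<open>c\<close>.\<close>

definition psat where
  "psat E Q c v d P = sat E Q (\<lambda>i. if i < d then v (d - Suc i) else c (i - d)) (P d)"
  for v :: "var \<Rightarrow> 'a" and P :: pform

lemma sat_eq_psat: "sat E Q e (P 0) = psat E Q e v 0 P"
  by (simp add: psat_def)

lemma psat_mem: "x < d \<Longrightarrow> y < d \<Longrightarrow> psat E Q c v d (x \<^bold>\<in> y) = E (v x) (v y)"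
  by (simp add: psat_def pmem_def Suc_diff_Suc)

lemma psat_eq: "x < d \<Longrightarrow> y < d \<Longrightarrow> psat E Q c v d (x \<^bold>= y) = Q (v x) (v y)"
  by (simp add: psat_def peq_def Suc_diff_Suc)

lemma psat_imp: "psat E Q c v d (F \<^bold>\<longrightarrow> G) = (psat E Q c v d F \<longrightarrow> psat E Q c v d G)"
  by (simp add: psat_def pimp_def)

lemma psat_not: "psat E Q c v d (\<^bold>\<not> F) = (\<not> psat E Q c v d F)"
  by (simp add: psat_def pnot_def pimp_def)

lemma psat_disj: "psat E Q c v d (F \<^bold>\<or> G) = (psat E Q c v d F \<or> psat E Q c v d G)"
  by (auto simp: pdisj_def psat_imp psat_not)

lemma psat_conj: "psat E Q c v d (F \<^bold>\<and> G) = (psat E Q c v d F \<and> psat E Q c v d G)"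
  by (auto simp: pconj_def psat_imp psat_not)

lemma psat_iff: "psat E Q c v d (F \<^bold>\<longleftrightarrow> G) = (psat E Q c v d F = psat E Q c v d G)"
  by (auto simp: piff_def psat_imp psat_conj)

text \<open>At depth \<open>Suc d\<close> the index 0 denotes the level \<open>d\<close>, so the
  quantifier updates the assignment there.\<close>

lemma psat_all: "psat E Q c v d (\<^bold>\<forall>x. F x) = (\<forall>m. psat E Q c (v(d := m)) (Suc d) (F d))"
proof -
  have "case_nat m (\<lambda>i. if i < d then v (d - Suc i) else c (i - d)) =
      (\<lambda>i. if i < Suc d then (v(d := m)) (Suc d - Suc i) else c (i - Suc d))" for m
    by (auto simp: fun_eq_iff split: nat.split)
  then show ?thesis by (simp add: psat_def pall_def)
qed

lemma psat_ex: "psat E Q c v d (\<^bold>\<exists>x. F x) = (\<exists>m. psat E Q c (v(d := m)) (Suc d) (F d))"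
  by (auto simp: pex_def psat_not psat_all)

lemma psat_papply:
  assumes "\<And>i. i \<in> free_vars p \<Longrightarrow> xs ! i < d"
  shows "psat E Q c v d (papply p xs) = sat E Q (\<lambda>i. v (xs ! i)) p"
  unfolding psat_def papply_def sat_ren
proof (rule sat_cong)
  fix i assume "i \<in> free_vars p"
  then have "xs ! i < d" by (rule assms)
  then show "(if d - Suc (xs ! i) < d then v (d - Suc (d - Suc (xs ! i))) else c (d - Suc (xs ! i) - d)) = v (xs ! i)"
    by (simp add: Suc_diff_Suc)
qed

lemmas psat_simps = psat_mem psat_eq psat_imp psat_not psat_disj psat_conj psat_iff psat_all psat_ex

text \<open>The quantifiers of the prefix are instantiated one at a time by the values of
  \<open>v\<close> at the levels from \<open>d\<close> on.\<close>

lemma sat_Univ_funpow: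
  "sat E Q (\<lambda>i. if i < d then v (d - Suc i) else c (i - d)) ((Univ ^^ n) q) \<Longrightarrow>
   sat E Q (\<lambda>i. if i < d + n then v (d + n - Suc i) else c (i - (d + n))) q"
proof (induction n arbitrary: d)
  case (Suc n)
  have "case_nat (v d) (\<lambda>i. if i < d then v (d - Suc i) else c (i - d)) =
      (\<lambda>i. if i < Suc d then v (Suc d - Suc i) else c (i - Suc d))"
    by (auto simp: fun_eq_iff split: nat.split)
  moreover have "\<forall>x. sat E Q (case_nat x (\<lambda>i. if i < d then v (d - Suc i) else c (i - d))) ((Univ ^^ n) q)"
    using Suc.prems by simp
  from spec[OF this, of "v d"]
  have "sat E Q (case_nat (v d) (\<lambda>i. if i < d then v (d - Suc i) else c (i - d))) ((Univ ^^ n) q)" .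
  ultimately have "sat E Q (\<lambda>i. if i < Suc d then v (Suc d - Suc i) else c (i - Suc d)) ((Univ ^^ n) q)"
    by (simp only:)
  from Suc.IH[OF this] show ?case by (simp only: add_Suc add_Suc_right)
qed (simp only: funpow.simps id_apply add_0_right)

lemma psat_Univ_funpow: "sat E Q c ((Univ ^^ n) (P n)) \<Longrightarrow> psat E Q c v n P"
  using sat_Univ_funpow[of E Q 0 v c n "P n", unfolded add_0] by (simp add: psat_def)

section \<open>The axioms of ZF in a model\<close>

definition satisfies_ZF :: "('a \<Rightarrow> 'a \<Rightarrow> bool) \<Rightarrow> ('a \<Rightarrow> 'a \<Rightarrow> bool) \<Rightarrow> bool" where
  "satisfies_ZF E Q \<longleftrightarrow> (\<exists>e. \<forall>q\<in>ZF. sat E Q e q)"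

context
  fixes E Q :: "'a \<Rightarrow> 'a \<Rightarrow> bool"
  assumes ZF: "satisfies_ZF E Q"
begin

lemma sat_ZF_axiom: "P 0 \<in> ZF \<Longrightarrow> \<exists>e. \<forall>v. psat E Q e v 0 P"
  using ZF unfolding satisfies_ZF_def sat_eq_psat[symmetric] by blast

lemma sat_extensionality: "(\<And>z. E z x = E z y) \<Longrightarrow> Q x y"
  using sat_ZF_axiom[of extensionality_axiom]
  by (auto simp: ZF_def extensionality_axiom_def psat_simps)

lemma sat_foundation: "E y x \<Longrightarrow> \<exists>y. E y x \<and> (\<nexists>z. E z x \<and> E z y)"
  using sat_ZF_axiom[of foundation_axiom]
  by (auto simp: ZF_def foundation_axiom_def psat_simps)

lemma sat_pairing: "\<exists>p. \<forall>z. E z p \<longleftrightarrow> Q z a \<or> Q z b"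
  using sat_ZF_axiom[of pairing_axiom]
  by (auto simp: ZF_def pairing_axiom_def is_upair_def psat_simps)

lemma sat_union: "\<exists>U. \<forall>z. E z U \<longleftrightarrow> (\<exists>A. E A S \<and> E z A)"
  using sat_ZF_axiom[of union_axiom]
  by (auto simp: ZF_def union_axiom_def is_Union_def psat_simps)

lemma sat_power_set: "\<exists>P. \<forall>B. E B P \<longleftrightarrow> (\<forall>z. E z B \<longrightarrow> E z A)"
  using sat_ZF_axiom[of power_set_axiom]
  by (auto simp: ZF_def power_set_axiom_def psubset_eq_def psat_simps)

lemma sat_infinity:
  "\<exists>w. (\<exists>z. (\<forall>y. \<not> E y z) \<and> E z w) \<and>
       (\<forall>x. E x w \<longrightarrow> (\<exists>y. (\<forall>z. E z y \<longleftrightarrow> E z x \<or> Q z x) \<and> E y w))"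
  using sat_ZF_axiom[of infinity_axiom]
  by (auto simp: ZF_def infinity_axiom_def is_inductive_def is_empty_def is_succ_def psat_simps)

lemma free_vars_bounded: "\<exists>n. free_vars p \<subseteq> {..<Suc (Suc n)}" "\<exists>n. free_vars p \<subseteq> {..<Suc n}"
proof -
  obtain k where "\<forall>i\<in>free_vars p. i \<le> k"
    using finite_free_vars finite_nat_set_iff_bounded_le by blast
  then have "free_vars p \<subseteq> {..<Suc k}" by (auto simp: less_Suc_eq_le)
  then show "\<exists>n. free_vars p \<subseteq> {..<Suc n}" "\<exists>n. free_vars p \<subseteq> {..<Suc (Suc n)}"
    by (auto intro!: exI[of _ k] dest!: subsetD)
qed

text \<open>The parameters are read off \<open>e\<close>, of which only the first \<open>n\<close>
  entries matter because \<open>p\<close> has finitely many free variables.\<close>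

lemma sat_separation: "\<exists>B. \<forall>x. E x B \<longleftrightarrow> E x A \<and> sat E Q (case_nat x e) p"
proof -
  obtain n where n: "free_vars p \<subseteq> {..<Suc n}" using free_vars_bounded by blast
  let ?P = "\<^bold>\<forall>A. \<^bold>\<exists>B. \<^bold>\<forall>x. x \<^bold>\<in> B \<^bold>\<longleftrightarrow> x \<^bold>\<in> A \<^bold>\<and> papply p (x # [0..<n])"
  have "separation n p \<in> ZF" using n unfolding ZF_def by blast
  then obtain c where "sat E Q c ((Univ ^^ n) (?P n))"
    using ZF unfolding satisfies_ZF_def separation_def by blast
  then have *: "psat E Q c e n ?P" by (rule psat_Univ_funpow)
  \<comment> \<open>Whatever the levels \<open>n\<close> and \<open>Suc n\<close> hold, the applied
    formula sees only the parameters and the element at level \<open>Suc (Suc n)\<close>.\<close>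
  have app: "psat E Q c (e(n := A, Suc n := B, Suc (Suc n) := x)) (Suc (Suc (Suc n)))
      (papply p (Suc (Suc n) # [0..<n])) = sat E Q (case_nat x e) p" for A B x
  proof -
    have "psat E Q c (e(n := A, Suc n := B, Suc (Suc n) := x)) (Suc (Suc (Suc n)))
      (papply p (Suc (Suc n) # [0..<n])) =
      sat E Q (\<lambda>i. (e(n := A, Suc n := B, Suc (Suc n) := x)) ((Suc (Suc n) # [0..<n]) ! i)) p"
      by (rule psat_papply) (use n in \<open>auto simp: nth_Cons less_Suc_eq split: nat.splits dest!: subsetD\<close>)
    also have "\<dots> = sat E Q (case_nat x e) p"
      by (rule sat_cong) (use n in \<open>auto simp: nth_Cons split: nat.splits dest!: subsetD\<close>)
    finally show ?thesis .
  qed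
  show ?thesis using * by (auto simp: psat_simps app)
qed

lemma sat_replacement:
  assumes "\<And>x y z. E x A \<Longrightarrow> sat E Q (case_nat x (case_nat y e)) p \<Longrightarrow>
    sat E Q (case_nat x (case_nat z e)) p \<Longrightarrow> Q y z"
  shows "\<exists>B. \<forall>y. E y B \<longleftrightarrow> (\<exists>x. E x A \<and> sat E Q (case_nat x (case_nat y e)) p)"
proof -
  obtain n where n: "free_vars p \<subseteq> {..<Suc (Suc n)}" using free_vars_bounded by blast
  let ?P = "\<^bold>\<forall>A. (\<^bold>\<forall>x y z. x \<^bold>\<in> A \<^bold>\<and> papply p (x # y # [0..<n]) \<^bold>\<and> papply p (x # z # [0..<n]) \<^bold>\<longrightarrow> y \<^bold>= z)
         \<^bold>\<longrightarrow> (\<^bold>\<exists>B. \<^bold>\<forall>y. y \<^bold>\<in> B \<^bold>\<longleftrightarrow> (\<^bold>\<exists>x. x \<^bold>\<in> A \<^bold>\<and> papply p (x # y # [0..<n])))"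
  have "replacement n p \<in> ZF" using n unfolding ZF_def by blast
  then obtain c where "sat E Q c ((Univ ^^ n) (?P n))"
    using ZF unfolding satisfies_ZF_def replacement_def by blast
  then have *: "psat E Q c e n ?P" by (rule psat_Univ_funpow)
  have app: "psat E Q c v d (papply p (i # j # [0..<n])) = sat E Q (case_nat (v i) (case_nat (v j) e)) p"
    if "i < d" "j < d" "n \<le> d" "\<And>k. k < n \<Longrightarrow> v k = e k" for v d i j
  proof -
    have "psat E Q c v d (papply p (i # j # [0..<n])) = sat E Q (\<lambda>k. v ((i # j # [0..<n]) ! k)) p"
      by (rule psat_papply) (use n that in \<open>auto simp: nth_Cons less_Suc_eq split: nat.splits dest!: subsetD\<close>)
    also have "\<dots> = sat E Q (case_nat (v i) (case_nat (v j) e)) p"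
      by (rule sat_cong) (use n that in \<open>auto simp: nth_Cons split: nat.splits dest!: subsetD\<close>)
    finally show ?thesis .
  qed
  have "\<forall>A. (\<forall>x y z. E x A \<and> sat E Q (case_nat x (case_nat y e)) p \<and> sat E Q (case_nat x (case_nat z e)) p \<longrightarrow> Q y z) \<longrightarrow>
    (\<exists>B. \<forall>y. E y B \<longleftrightarrow> (\<exists>x. E x A \<and> sat E Q (case_nat x (case_nat y e)) p))"
    using * by (simp add: psat_simps app)
  then show ?thesis using assms by blast
qed

end

section \<open>Reduction to models with true equality\<close>

text \<open>A model of ZF is infinite: otherwise pairing and union yield a universal set.\<close>

lemma infinite_quotient:
  fixes q :: "'a \<Rightarrow> 'b"
  assumes ZF: "satisfies_ZF E Q" and E: "congruence E Q" and q: "\<And>x y. Q x y \<longleftrightarrow> q x = q y"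
  shows "infinite (range q)"
proof
  assume "finite (range q)"
  have E_cong: "E x y \<Longrightarrow> q x = q x' \<Longrightarrow> E x' y" for x x' y
    using E q unfolding congruence_def by blast
  have "\<exists>a. \<forall>x. q x \<in> S \<longrightarrow> E x a" if "finite S" for S
    using that
  proof (induction S)
    case (insert s S)
    then obtain a where a: "\<And>x. q x \<in> S \<Longrightarrow> E x a" by blast
    show ?case
    proof (cases "\<exists>y. q y = s")
      case True
      then obtain y where y: "q y = s" by blast
      obtain b where b: "\<And>z. E z b \<longleftrightarrow> Q z y" using sat_pairing[OF ZF, of y y] by auto
      obtain p where p: "\<And>z. E z p \<longleftrightarrow> Q z a \<or> Q z b" using sat_pairing[OF ZF, of a b] by auto
      obtain u where u: "\<And>z. E z u \<longleftrightarrow> (\<exists>A. E A p \<and> E z A)" using sat_union[OF ZF, of p] by auto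
      have "E x u" if "q x \<in> insert s S" for x
        using that a[of x] b[of x] q y u p by auto
      then show ?thesis by blast
    next
      case False
      then show ?thesis using a by (metis insertE)
    qed
  qed simp
  from this[OF \<open>finite (range q)\<close>] obtain V where "\<And>x. E x V" by auto
  then obtain R where R: "\<And>x. E x R \<longleftrightarrow> \<not> E x x"
    using sat_separation[OF ZF, of V _ "Imp (Mem 0 0) Bot"] by auto
  then show False by blast
qed

lemma sat_quotient:
  assumes E: "congruence E Q" and q: "\<And>x y. Q x y \<longleftrightarrow> q x = q y" and surj: "surj q"
  shows "sat (\<lambda>a b. \<exists>x y. q x = a \<and> q y = b \<and> E x y) (=) (\<lambda>i. q (e i)) p = sat E Q e p"
proof (induction p arbitrary: e)
  case (Mem i j)
  have "E x' y'" if "q x = q x'" "q y = q y'" "E x y" for x x' y y'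
    using E that unfolding congruence_def q by blast
  then show ?case unfolding sat.simps by blast
next
  case (Eq i j)
  show ?case using q by simp
next
  case (Univ p)
  have *: "case_nat (q x) (\<lambda>i. q (e i)) = (\<lambda>i. q (case_nat x e i))" for x
    by (auto split: nat.split)
  have "(\<forall>a. R a) \<longleftrightarrow> (\<forall>x. R (q x))" for R
    using surj by (metis surjD)
  then show ?case by (simp only: sat.simps * Univ)
qed auto

text \<open>Dividing by \<open>Q\<close> yields true equality, but the universe is then only a set
  of representatives; being infinite and countable, it is renumbered by all of
  \<open>nat\<close>.\<close>

theorem ZF_proves_if_models:
  assumes "\<And>(E :: nat \<Rightarrow> nat \<Rightarrow> bool) c v. satisfies_ZF E (=) \<Longrightarrow> psat E (=) c v 0 F"
  shows "ZF_proves F"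
proof (rule ccontr)
  assume "\<not> ZF_proves F"
  then obtain E :: "nat \<Rightarrow> nat \<Rightarrow> bool" and Q e where
    E: "congruence E Q" and ZF: "\<forall>q\<in>ZF. sat E Q e q" and F: "\<not> sat E Q e (F 0)"
    using completeness unfolding ZF_proves_def by metis
  define h where "h = (\<lambda>x. LEAST y. Q x y)"
  have equiv: "equivp Q" using E unfolding congruence_def by blast
  have h: "Q x y \<longleftrightarrow> h x = h y" for x y
  proof
    assume "Q x y"
    then have "Q x = Q y" using equiv by (metis equivp_def)
    then show "h x = h y" unfolding h_def by simp
  next
    have "Q x (h x)" for x unfolding h_def using equiv by (metis LeastI equivp_reflp)
    moreover assume "h x = h y"
    ultimately show "Q x y" using equiv by (metis equivp_def)
  qed
  have satZF: "satisfies_ZF E Q" using ZF unfolding satisfies_ZF_def by blast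
  have bij: "bij_betw (to_nat_on (range h)) (range h) UNIV"
    using infinite_quotient[OF satZF E h] by (intro to_nat_on_infinite) auto
  define q where "q = (\<lambda>x. to_nat_on (range h) (h x))"
  have "inj_on (to_nat_on (range h)) (range h)" using bij by (rule bij_betw_imp_inj_on)
  then have q: "Q x y \<longleftrightarrow> q x = q y" for x y
    unfolding h q_def by (simp add: inj_on_eq_iff)
  have surj: "surj q"
  proof (unfold surj_def, intro allI)
    fix n
    show "\<exists>x. n = q x" using bij unfolding q_def bij_betw_def by (metis UNIV_I imageE)
  qed
  let ?E = "\<lambda>a b. \<exists>x y. q x = a \<and> q y = b \<and> E x y"
  have *: "sat ?E (=) (\<lambda>i. q (e i)) p = sat E Q e p" for p
    by (rule sat_quotient[OF E q surj])
  have "satisfies_ZF ?E (=)" using ZF * unfolding satisfies_ZF_def by blast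
  then have "psat ?E (=) (\<lambda>i. q (e i)) (\<lambda>_. 0) 0 F" by (rule assms)
  then show False using F unfolding sat_eq_psat[symmetric] * by blast
qed

section \<open>Definable relations and functions over a model\<close>

locale zf_model =
  fixes E :: "'a \<Rightarrow> 'a \<Rightarrow> bool" (infix "\<epsilon>" 50)
  assumes ZF: "satisfies_ZF E (=)"
begin

text \<open>Relations and functions are represented on environments, so that definability is
  preserved by the syntax of HOL terms.  Parameters from the model are allowed.\<close>

definition trm :: "((nat \<Rightarrow> 'a) \<Rightarrow> 'a) \<Rightarrow> bool" where
  "trm t \<longleftrightarrow> (\<exists>i. t = (\<lambda>e. e i)) \<or> (\<exists>a. t = (\<lambda>e. a))"

definition dfn :: "((nat \<Rightarrow> 'a) \<Rightarrow> bool) \<Rightarrow> bool" where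
  "dfn P \<longleftrightarrow> (\<exists>p s. (\<forall>i. trm (s i)) \<and> (\<forall>e. P e = sat E (=) (\<lambda>i. s i e) p))"

definition dfnt :: "((nat \<Rightarrow> 'a) \<Rightarrow> 'a) \<Rightarrow> bool" where
  "dfnt t \<longleftrightarrow> dfn (\<lambda>e. e 0 = t (\<lambda>i. e (Suc i)))"

named_theorems dfn_intros

lemma trm_proj: "trm (\<lambda>e. e i)" and trm_const: "trm (\<lambda>e. a)"
  by (auto simp: trm_def)

lemma dfnI: "(\<And>i. trm (s i)) \<Longrightarrow> (\<And>e. P e = sat E (=) (\<lambda>i. s i e) p) \<Longrightarrow> dfn P"
  unfolding dfn_def by blast

lemma dfn_subst:
  assumes "dfn P" "\<And>i. trm (s i)"
  shows "dfn (\<lambda>e. P (\<lambda>i. s i e))"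
proof -
  obtain p r where r: "\<And>i. trm (r i)" and P: "\<And>e. P e = sat E (=) (\<lambda>i. r i e) p"
    using assms(1) unfolding dfn_def by blast
  show ?thesis
  proof (rule dfnI)
    show "trm (\<lambda>e. r i (\<lambda>j. s j e))" for i
    proof -
      consider j where "r i = (\<lambda>e. e j)" | a where "r i = (\<lambda>e. a)" using r[of i] unfolding trm_def by blast
      then show ?thesis by cases (simp_all add: assms(2) trm_const)
    qed
  qed (rule P)
qed

section \<open>Closure of definability under atoms, connectives and quantifiers\<close>

lemma dfn_mem_trm: "trm s \<Longrightarrow> trm t \<Longrightarrow> dfn (\<lambda>e. s e \<epsilon> t e)"
  by (rule dfnI[of "case_nat s (\<lambda>_. t)" _ "Mem 0 1"]) (auto split: nat.split)

lemma dfn_eq_trm: "trm s \<Longrightarrow> trm t \<Longrightarrow> dfn (\<lambda>e. s e = t e)"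
  by (rule dfnI[of "case_nat s (\<lambda>_. t)" _ "Eq 0 1"]) (auto split: nat.split)

lemma dfn_imp [dfn_intros]:
  assumes "dfn P" "dfn Q"
  shows "dfn (\<lambda>e. P e \<longrightarrow> Q e)"
proof -
  obtain p r where r: "\<And>i. trm (r i)" and P: "\<And>e. P e = sat E (=) (\<lambda>i. r i e) p"
    using assms(1) unfolding dfn_def by blast
  obtain q s where s: "\<And>i. trm (s i)" and Q: "\<And>e. Q e = sat E (=) (\<lambda>i. s i e) q"
    using assms(2) unfolding dfn_def by blast
  show ?thesis
  proof (rule dfnI)
    \<comment> \<open>The two families of terms share one index set: even indices serve
      \<open>P\<close>, odd ones serve \<open>Q\<close>.\<close>
    show "trm ((\<lambda>i. if even i then r (i div 2) else s (i div 2)) i)" for i using r s by simp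
    show "(P e \<longrightarrow> Q e) = sat E (=) (\<lambda>i. (if even i then r (i div 2) else s (i div 2)) e)
        (Imp (ren (\<lambda>i. 2 * i) p) (ren (\<lambda>i. 2 * i + 1) q))" for e
      by (simp add: sat_ren P Q)
  qed
qed

lemma dfn_const [dfn_intros]: "dfn (\<lambda>e. b)"
proof (cases b)
  case True
  then show ?thesis
    by (intro dfnI[of "\<lambda>_ e. undefined" _ "Imp Bot Bot"]) (auto intro: trm_const)
next
  case False
  then show ?thesis
    by (intro dfnI[of "\<lambda>_ e. undefined" _ "Bot"]) (auto intro: trm_const)
qed

lemma dfn_not [dfn_intros]: "dfn P \<Longrightarrow> dfn (\<lambda>e. \<not> P e)"
  using dfn_imp[OF _ dfn_const[of False]] by simp

lemma dfn_disj [dfn_intros]: "dfn P \<Longrightarrow> dfn Q \<Longrightarrow> dfn (\<lambda>e. P e \<or> Q e)"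
  using dfn_imp[OF dfn_not] by (simp add: disj_imp)

lemma dfn_conj [dfn_intros]: "dfn P \<Longrightarrow> dfn Q \<Longrightarrow> dfn (\<lambda>e. P e \<and> Q e)"
  using dfn_not[OF dfn_imp[OF _ dfn_not]] by simp

lemma dfn_iff [dfn_intros]: "dfn P \<Longrightarrow> dfn Q \<Longrightarrow> dfn (\<lambda>e. P e = Q e)"
  using dfn_conj[OF dfn_imp dfn_imp] by (simp add: iff_conv_conj_imp)

lemma dfn_all [dfn_intros]:
  assumes "dfn (\<lambda>e. Q (\<lambda>i. e (Suc i)) (e 0))"
  shows "dfn (\<lambda>e. \<forall>x. Q e x)"
proof -
  obtain p s where s: "\<And>i. trm (s i)" and Q: "\<And>e. Q (\<lambda>i. e (Suc i)) (e 0) = sat E (=) (\<lambda>i. s i e) p"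
    using assms unfolding dfn_def by blast
  \<comment> \<open>Terms that denote the quantified variable move to the bound index 0; no other
    term looks at entry 0, so \<open>undefined\<close> may stand there.\<close>
  define f where "f = (\<lambda>i. if s i = (\<lambda>e. e 0) then 0 else Suc i)"
  define r where "r = (\<lambda>i e. s i (case_nat undefined e))"
  show ?thesis
  proof (rule dfnI)
    show "trm (r i)" for i
    proof -
      consider j where "s i = (\<lambda>e. e j)" | a where "s i = (\<lambda>e. a)" using s[of i] unfolding trm_def by blast
      then show ?thesis
      proof cases
        case (1 j)
        then show ?thesis by (cases j) (simp_all add: r_def trm_proj trm_const)
      qed (simp add: r_def trm_const)
    qed
    show "(\<forall>x. Q e x) = sat E (=) (\<lambda>i. r i e) (Univ (ren f p))" for e
    proof -
      have "case_nat x (\<lambda>i. r i e) (f i) = s i (case_nat x e)" for x i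
      proof -
        consider "s i = (\<lambda>e. e 0)" | j where "s i = (\<lambda>e. e (Suc j))" "s i \<noteq> (\<lambda>e. e 0)"
          | a where "s i = (\<lambda>e. a)" "s i \<noteq> (\<lambda>e. e 0)"
          using s[of i] unfolding trm_def by (metis not0_implies_Suc)
        then show ?thesis by cases (simp_all add: f_def r_def)
      qed
      then have "sat E (=) (\<lambda>i. r i e) (Univ (ren f p)) = (\<forall>x. sat E (=) (\<lambda>i. s i (case_nat x e)) p)"
        by (simp add: sat_ren)
      also have "\<dots> = (\<forall>x. Q e x)" unfolding Q[symmetric] by simp
      finally show ?thesis by simp
    qed
  qed
qed

lemma dfn_ex [dfn_intros]: "dfn (\<lambda>e. Q (\<lambda>i. e (Suc i)) (e 0)) \<Longrightarrow> dfn (\<lambda>e. \<exists>x. Q e x)"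
  using dfn_not[OF dfn_all[OF dfn_not]] by simp

lemma dfn_ex1 [dfn_intros]:
  assumes "dfn (\<lambda>e. Q (\<lambda>i. e (Suc i)) (e 0))"
  shows "dfn (\<lambda>e. \<exists>!x. Q e x)"
proof -
  have "dfn (\<lambda>e. Q (\<lambda>i. e (Suc (Suc i))) (e 0))"
    using dfn_subst[OF assms, of "case_nat (\<lambda>e. e 0) (\<lambda>i e. e (Suc (Suc i)))"]
    by (auto simp: trm_proj split: nat.split)
  then have "dfn (\<lambda>e. \<exists>x. Q e x \<and> (\<forall>y. Q e y \<longrightarrow> y = x))"
    by (intro dfn_intros assms dfn_eq_trm trm_proj)
  then show ?thesis by (simp add: Ex1_def)
qed

lemma dfn_ball [dfn_intros]:
  "dfn (\<lambda>e. e 0 \<in> S (\<lambda>i. e (Suc i))) \<Longrightarrow> dfn (\<lambda>e. Q (\<lambda>i. e (Suc i)) (e 0)) \<Longrightarrow> dfn (\<lambda>e. \<forall>x\<in>S e. Q e x)"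
  unfolding Ball_def by (intro dfn_intros)

lemma dfn_bex [dfn_intros]:
  "dfn (\<lambda>e. e 0 \<in> S (\<lambda>i. e (Suc i))) \<Longrightarrow> dfn (\<lambda>e. Q (\<lambda>i. e (Suc i)) (e 0)) \<Longrightarrow> dfn (\<lambda>e. \<exists>x\<in>S e. Q e x)"
  unfolding Bex_def by (intro dfn_intros)

section \<open>Definable functions and their substitution into relations\<close>

lemma dfnt_trm: "trm t \<Longrightarrow> dfnt t"
proof -
  assume "trm t"
  then have "trm (\<lambda>e. t (\<lambda>i. e (Suc i)))" by (auto simp: trm_def)
  then show "dfnt t" unfolding dfnt_def by (intro dfn_eq_trm trm_proj)
qed

lemma dfnt_proj [dfn_intros]: "dfnt (\<lambda>e. e i)" and dfnt_const [dfn_intros]: "dfnt (\<lambda>e. a)"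
  by (rule dfnt_trm trm_proj trm_const)+

lemma dfnt_graph:
  assumes "dfnt t" "trm s" "\<And>i. trm (r i)"
  shows "dfn (\<lambda>e. s e = t (\<lambda>i. r i e))"
  using dfn_subst[OF assms(1)[unfolded dfnt_def], of "case_nat s r"] assms(2,3)
  by (auto split: nat.split)

lemma dfnt_subst:
  assumes "dfnt t" "\<And>i. trm (r i)"
  shows "dfnt (\<lambda>e. t (\<lambda>i. r i e))"
  unfolding dfnt_def
proof (rule dfnt_graph[OF assms(1) trm_proj])
  show "trm (\<lambda>e. r i (\<lambda>i. e (Suc i)))" for i using assms(2)[of i] by (auto simp: trm_def)
qed

text \<open>A definable function is not a term of the language, but its graph is a formula; an
  auxiliary quantifier over the value eliminates it.\<close>

lemma dfn_comp:
  assumes R: "dfn (\<lambda>e. R (\<lambda>i. e (Suc i)) (e 0))" and t: "dfnt t"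
  shows "dfn (\<lambda>e. R e (t e))"
proof -
  have "dfn (\<lambda>e. \<exists>x. x = t e \<and> R e x)"
    by (intro dfn_intros R dfnt_graph[OF t] trm_proj)
  then show ?thesis by simp
qed

lemma dfn_lift1:
  assumes R: "dfn (\<lambda>e. R (e 0))" and t: "dfnt t"
  shows "dfn (\<lambda>e. R (t e))"
  by (rule dfn_comp[where R = "\<lambda>e. R"]) (rule assms)+

lemma dfn_lift2:
  assumes R: "dfn (\<lambda>e. R (e 0) (e (Suc 0)))" and t: "dfnt t" and u: "dfnt u"
  shows "dfn (\<lambda>e. R (t e) (u e))"
proof (rule dfn_comp[where R = "\<lambda>e x. R x (u e)"])
  show "dfn (\<lambda>e. R (e 0) (u (\<lambda>i. e (Suc i))))"
  proof (rule dfn_comp[where R = "\<lambda>e y. R (e 0) y"])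
    show "dfn (\<lambda>e. R (e (Suc 0)) (e 0))"
      using dfn_subst[OF R, of "case_nat (\<lambda>e. e (Suc 0)) (\<lambda>_ e. e 0)"]
      by (auto simp: trm_proj split: nat.split)
  qed (intro dfnt_subst[OF u] trm_proj)
qed (rule t)

lemma dfn_lift3:
  assumes R: "dfn (\<lambda>e. R (e 0) (e (Suc 0)) (e (Suc (Suc 0))))" and t: "dfnt t" "dfnt u" "dfnt w"
  shows "dfn (\<lambda>e. R (t e) (u e) (w e))"
proof (rule dfn_comp[where R = "\<lambda>e x. R x (u e) (w e)"])
  show "dfn (\<lambda>e. R (e 0) (u (\<lambda>i. e (Suc i))) (w (\<lambda>i. e (Suc i))))"
  proof (rule dfn_comp[where R = "\<lambda>e y. R (e 0) y (w (\<lambda>i. e (Suc i)))"])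
    show "dfn (\<lambda>e. R (e (Suc 0)) (e 0) (w (\<lambda>i. e (Suc (Suc i)))))"
    proof (rule dfn_comp[where R = "\<lambda>e z. R (e (Suc 0)) (e 0) z"])
      show "dfn (\<lambda>e. R (e (Suc (Suc 0))) (e (Suc 0)) (e 0))"
        using dfn_subst[OF R, of "case_nat (\<lambda>e. e (Suc (Suc 0))) (case_nat (\<lambda>e. e (Suc 0)) (\<lambda>_ e. e 0))"]
        by (auto simp: trm_proj split: nat.split)
    qed (intro dfnt_subst[OF t(3)] trm_proj)
  qed (intro dfnt_subst[OF t(2)] trm_proj)
qed (rule t(1))

lemma dfn_mem [dfn_intros]: "dfnt t \<Longrightarrow> dfnt u \<Longrightarrow> dfn (\<lambda>e. t e \<epsilon> u e)"
  by (rule dfn_lift2) (intro dfn_mem_trm trm_proj)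

lemma dfn_eq [dfn_intros]: "dfnt t \<Longrightarrow> dfnt u \<Longrightarrow> dfn (\<lambda>e. t e = u e)"
  by (rule dfn_lift2) (intro dfn_eq_trm trm_proj)

lemma dfnt_lift1:
  "dfn (\<lambda>e. e 0 = f (e (Suc 0))) \<Longrightarrow> dfnt t \<Longrightarrow> dfnt (\<lambda>e. f (t e))"
  unfolding dfnt_def[of "\<lambda>e. f (t e)"]
  by (rule dfn_lift2[where R = "\<lambda>x y. x = f y"], assumption, rule dfnt_proj)
    (rule dfnt_subst, assumption, rule trm_proj)

lemma dfnt_lift2:
  "dfn (\<lambda>e. e 0 = f (e (Suc 0)) (e (Suc (Suc 0)))) \<Longrightarrow> dfnt t \<Longrightarrow> dfnt u \<Longrightarrow> dfnt (\<lambda>e. f (t e) (u e))"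
  unfolding dfnt_def[of "\<lambda>e. f (t e) (u e)"]
  by (rule dfn_lift3[where R = "\<lambda>x y z. x = f y z"], assumption, rule dfnt_proj)
    (rule dfnt_subst, assumption, rule trm_proj)+

abbreviation dfn1 :: "('a \<Rightarrow> 'a) \<Rightarrow> bool" where
  "dfn1 g \<equiv> dfnt (\<lambda>e. g (e 0))"

lemma dfn1D:
  assumes "dfn1 g" "dfnt t"
  shows "dfnt (\<lambda>e. g (t e))"
proof (rule dfnt_lift1[where f = g and t = t])
  show "dfn (\<lambda>e. e 0 = g (e (Suc 0)))" using assms(1) by (simp add: dfnt_def)
qed (rule assms)

lemma dfnt_if [dfn_intros]:
  assumes "dfn P" "dfnt t" "dfnt u"
  shows "dfnt (\<lambda>e. if P e then t e else u e)"
proof -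
  have "dfn (\<lambda>e. P (\<lambda>i. e (Suc i)))" by (intro dfn_subst[OF assms(1)] trm_proj)
  then have "dfn (\<lambda>e. P (\<lambda>i. e (Suc i)) \<and> e 0 = t (\<lambda>i. e (Suc i)) \<or> \<not> P (\<lambda>i. e (Suc i)) \<and> e 0 = u (\<lambda>i. e (Suc i)))"
    by (intro dfn_intros dfnt_subst[OF assms(2)] dfnt_subst[OF assms(3)] trm_proj)
  then show ?thesis unfolding dfnt_def by (rule back_subst[where P = dfn]) auto
qed

text \<open>Unlike \<open>The\<close>, this operator has the same value for all predicates without a unique
  witness, hence preserves definability.\<close>

definition the_elt :: "('a \<Rightarrow> bool) \<Rightarrow> 'a" where
  "the_elt P = (if \<exists>!x. P x then THE x. P x else undefined)"

lemma the_elt_eq: "P a \<Longrightarrow> (\<And>x. P x \<Longrightarrow> x = a) \<Longrightarrow> the_elt P = a"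
proof -
  assume "P a" "\<And>x. P x \<Longrightarrow> x = a"
  then have "\<exists>!x. P x" by blast
  then show "the_elt P = a" using \<open>P a\<close> the1_equality[of P a] by (simp add: the_elt_def)
qed

lemma dfnt_the_elt [dfn_intros]:
  assumes "dfn (\<lambda>e. R (\<lambda>i. e (Suc i)) (e 0))"
  shows "dfnt (\<lambda>e. the_elt (\<lambda>x. R e x))"
proof -
  have "(y = the_elt P) = ((\<exists>!x. P x) \<and> P y \<or> \<not> (\<exists>!x. P x) \<and> y = undefined)" for y P
    unfolding the_elt_def by (auto intro: theI' the1_equality[symmetric])
  moreover have "dfn (\<lambda>e. R (\<lambda>i. e (Suc (Suc i))) (e 0))"
    using dfn_subst[OF assms, of "case_nat (\<lambda>e. e 0) (\<lambda>i e. e (Suc (Suc i)))"]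
    by (auto simp: trm_proj split: nat.split)
  then have "dfn (\<lambda>e. (\<exists>!x. R (\<lambda>i. e (Suc i)) x) \<and> R (\<lambda>i. e (Suc i)) (e 0) \<or>
      \<not> (\<exists>!x. R (\<lambda>i. e (Suc i)) x) \<and> e 0 = undefined)"
    by (intro dfn_intros assms)
  ultimately show ?thesis unfolding dfnt_def by simp
qed

section \<open>Sets of the model\<close>

definition ext :: "'a \<Rightarrow> 'a set" where
  "ext a = {x. x \<epsilon> a}"

text \<open>\<open>ext\<close> and \<open>Coll\<close> are inverse to each other between the
  elements and the HOL sets that satisfy \<open>isset\<close>, so HOL's set notation can be used
  inside the model.\<close>

definition Coll :: "'a set \<Rightarrow> 'a" where
  "Coll S = the_elt (\<lambda>a. \<forall>x. x \<epsilon> a \<longleftrightarrow> x \<in> S)"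

definition isset :: "'a set \<Rightarrow> bool" where
  "isset S \<longleftrightarrow> (\<exists>a. ext a = S)"

lemma mem_ext: "x \<in> ext a \<longleftrightarrow> x \<epsilon> a"
  by (simp add: ext_def)

lemma ext_inject: "ext a = ext b \<longleftrightarrow> a = b"
  using sat_extensionality[OF ZF, of a b] unfolding ext_def by blast

lemma Coll_ext [simp]: "Coll (ext a) = a"
  unfolding Coll_def using ext_inject by (intro the_elt_eq) (auto simp: ext_def)

lemma isset_ext [simp]: "isset (ext a)"
  by (auto simp: isset_def)

lemma ext_Coll: "isset S \<Longrightarrow> ext (Coll S) = S"
  by (auto simp: isset_def)

lemma isset_cases: "isset S \<Longrightarrow> (\<And>a. S = ext a \<Longrightarrow> thesis) \<Longrightarrow> thesis"
  by (auto simp: isset_def)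

lemma Coll_inject: "isset S \<Longrightarrow> isset T \<Longrightarrow> Coll S = Coll T \<longleftrightarrow> S = T"
  using ext_Coll by metis

lemma dfn_mem_ext [dfn_intros]: "dfnt t \<Longrightarrow> dfnt u \<Longrightarrow> dfn (\<lambda>e. t e \<in> ext (u e))"
  unfolding mem_ext by (rule dfn_mem)

lemma dfn_mem_Collect [dfn_intros]: "dfn (\<lambda>e. P e (t e)) \<Longrightarrow> dfn (\<lambda>e. t e \<in> {x. P e x})"
  by simp

lemma dfn_mem_empty [dfn_intros]: "dfn (\<lambda>e. t e \<in> {})"
  by (simp add: dfn_const)

lemma dfn_mem_ops [dfn_intros]:
  "dfn (\<lambda>e. t e \<in> A e) \<Longrightarrow> dfn (\<lambda>e. t e \<in> B e) \<Longrightarrow> dfn (\<lambda>e. t e \<in> A e \<union> B e)"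
  "dfn (\<lambda>e. t e \<in> A e) \<Longrightarrow> dfn (\<lambda>e. t e \<in> B e) \<Longrightarrow> dfn (\<lambda>e. t e \<in> A e \<inter> B e)"
  "dfn (\<lambda>e. t e \<in> A e) \<Longrightarrow> dfn (\<lambda>e. t e \<in> B e) \<Longrightarrow> dfn (\<lambda>e. t e \<in> A e - B e)"
  "dfn (\<lambda>e. t e = a e) \<Longrightarrow> dfn (\<lambda>e. t e \<in> A e) \<Longrightarrow> dfn (\<lambda>e. t e \<in> insert (a e) (A e))"
  "dfn (\<lambda>e. \<exists>x\<in>A e. t e = g e x) \<Longrightarrow> dfn (\<lambda>e. t e \<in> g e ` A e)"
  "dfn (\<lambda>e. \<exists>x\<in>A e. t e \<in> F e x) \<Longrightarrow> dfn (\<lambda>e. t e \<in> (\<Union>x\<in>A e. F e x))"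
  by (simp_all add: dfn_intros image_iff)

lemma dfn_subset [dfn_intros]:
  "dfn (\<lambda>e. e 0 \<in> A (\<lambda>i. e (Suc i))) \<Longrightarrow> dfn (\<lambda>e. e 0 \<in> B (\<lambda>i. e (Suc i))) \<Longrightarrow> dfn (\<lambda>e. A e \<subseteq> B e)"
  unfolding subset_eq by (intro dfn_intros)

lemma dfn_set_eq [dfn_intros]:
  "dfn (\<lambda>e. e 0 \<in> A (\<lambda>i. e (Suc i))) \<Longrightarrow> dfn (\<lambda>e. e 0 \<in> B (\<lambda>i. e (Suc i))) \<Longrightarrow> dfn (\<lambda>e. A e = B e)"
  unfolding set_eq_iff by (intro dfn_intros)

lemma dfnt_Coll [dfn_intros]:
  assumes "dfn (\<lambda>e. e 0 \<in> S (\<lambda>i. e (Suc i)))"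
  shows "dfnt (\<lambda>e. Coll (S e))"
proof -
  have "dfn (\<lambda>e. e 0 \<in> S (\<lambda>i. e (Suc (Suc i))))"
    using dfn_subst[OF assms, of "case_nat (\<lambda>e. e 0) (\<lambda>i e. e (Suc (Suc i)))"]
    by (auto simp: trm_proj split: nat.split)
  then show ?thesis unfolding Coll_def by (intro dfn_intros)
qed

lemma dfn_isset [dfn_intros]:
  assumes "dfn (\<lambda>e. e 0 \<in> S (\<lambda>i. e (Suc i)))"
  shows "dfn (\<lambda>e. isset (S e))"
proof -
  have "dfn (\<lambda>e. e 0 \<in> S (\<lambda>i. e (Suc (Suc i))))"
    using dfn_subst[OF assms, of "case_nat (\<lambda>e. e 0) (\<lambda>i e. e (Suc (Suc i)))"]
    by (auto simp: trm_proj split: nat.split)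
  then show ?thesis unfolding isset_def by (intro dfn_intros)
qed

text \<open>Brings a definable predicate into the shape demanded by the axiom schemas: the arguments
  are the variables 0 and 1, and everything else is a fixed environment.\<close>

lemma dfn_parameters:
  assumes "dfn P"
  shows "\<exists>p e'. \<forall>x y. P (case_nat x (case_nat y (\<lambda>_. c))) = sat E (=) (case_nat x (case_nat y e')) p"
proof -
  obtain p s where s: "\<And>i. trm (s i)" and P: "\<And>e. P e = sat E (=) (\<lambda>i. s i e) p"
    using assms unfolding dfn_def by blast
  define f where "f = (\<lambda>i. if s i = (\<lambda>e. e 0) then 0 else if s i = (\<lambda>e. e 1) then 1 else Suc (Suc i))"
  define r where "r = (\<lambda>i. s i (\<lambda>_. c))"
  have "case_nat x (case_nat y r) (f i) = s i (case_nat x (case_nat y (\<lambda>_. c)))" for x y i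
  proof -
    consider "s i = (\<lambda>e. e 0)" | "s i = (\<lambda>e. e 1)" "s i \<noteq> (\<lambda>e. e 0)"
      | j where "s i = (\<lambda>e. e (Suc (Suc j)))" "s i \<noteq> (\<lambda>e. e 0)" "s i \<noteq> (\<lambda>e. e 1)"
      | a where "s i = (\<lambda>e. a)" "s i \<noteq> (\<lambda>e. e 0)" "s i \<noteq> (\<lambda>e. e 1)"
      using s[of i] unfolding trm_def by (metis One_nat_def not0_implies_Suc)
    then show ?thesis by cases (simp_all add: f_def r_def)
  qed
  then have "P (case_nat x (case_nat y (\<lambda>_. c))) = sat E (=) (case_nat x (case_nat y r)) (ren f p)" for x y
    by (simp add: P sat_ren)
  then show ?thesis by blast
qed

lemma isset_Collect:
  assumes "isset A" "dfn (\<lambda>e. P (e 0))"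
  shows "isset {x \<in> A. P x}"
proof -
  obtain a where a: "A = ext a" using assms(1) isset_cases by blast
  obtain p e' where p: "\<And>x y. P x = sat E (=) (case_nat x (case_nat y e')) p"
    using dfn_parameters[OF assms(2)] by auto
  obtain b where "\<And>x. x \<epsilon> b \<longleftrightarrow> x \<epsilon> a \<and> P x"
    using sat_separation[OF ZF, of a "case_nat a e'" p] unfolding p[of _ a] by blast
  then have "ext b = {x \<in> A. P x}" by (auto simp: a ext_def)
  then show ?thesis using isset_ext by metis
qed

lemma isset_subset: "isset A \<Longrightarrow> T \<subseteq> A \<Longrightarrow> dfn (\<lambda>e. e 0 \<in> T) \<Longrightarrow> isset T"
  using isset_Collect[of A "\<lambda>x. x \<in> T"] by (simp add: Int_absorb1 Collect_conj_eq)

lemma dfn_mem_isset: "isset S \<Longrightarrow> dfnt t \<Longrightarrow> dfn (\<lambda>e. t e \<in> S)"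
  by (auto elim!: isset_cases intro: dfn_intros)

lemma isset_insert [simp]: "isset A \<Longrightarrow> isset (insert a A)"
proof -
  assume "isset A"
  then obtain c where c: "A = ext c" using isset_cases by blast
  obtain b where b: "\<And>z. z \<epsilon> b \<longleftrightarrow> z = a" using sat_pairing[OF ZF, of a a] by auto
  obtain p where p: "\<And>z. z \<epsilon> p \<longleftrightarrow> z = c \<or> z = b" using sat_pairing[OF ZF, of c b] by auto
  obtain u where u: "\<And>z. z \<epsilon> u \<longleftrightarrow> (\<exists>A. A \<epsilon> p \<and> z \<epsilon> A)" using sat_union[OF ZF, of p] by auto
  have "ext u = insert a A" using b p u by (auto simp: ext_def c)
  then show ?thesis using isset_ext by metis
qed

lemma isset_empty [simp]: "isset {}"
  using isset_subset[of "ext undefined" "{}"] dfn_const[of False] by simp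

lemma isset_Union:
  assumes "isset S"
  shows "isset (\<Union>x\<in>S. ext x)"
proof -
  obtain a where a: "S = ext a" using assms isset_cases by blast
  obtain u where u: "\<And>z. z \<epsilon> u \<longleftrightarrow> (\<exists>A. A \<epsilon> a \<and> z \<epsilon> A)" using sat_union[OF ZF, of a] by auto
  have "ext u = (\<Union>x\<in>S. ext x)" using u by (auto simp: ext_def a)
  then show ?thesis using isset_ext by metis
qed

lemma isset_Un [simp]: "isset A \<Longrightarrow> isset B \<Longrightarrow> isset (A \<union> B)"
  using isset_Union[of "{Coll A, Coll B}"] by (simp add: ext_Coll)

lemma isset_Pow: "isset A \<Longrightarrow> isset {b. ext b \<subseteq> A}"
proof -
  assume "isset A"
  then obtain a where a: "A = ext a" using isset_cases by blast
  obtain p where "\<And>b. b \<epsilon> p \<longleftrightarrow> (\<forall>z. z \<epsilon> b \<longrightarrow> z \<epsilon> a)" using sat_power_set[OF ZF, of a] by auto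
  then have "ext p = {b. ext b \<subseteq> A}" by (auto simp: ext_def a)
  then show ?thesis using isset_ext by metis
qed

lemma isset_Int [simp]:
  assumes "isset A" "isset B"
  shows "isset (A \<inter> B)"
  by (rule isset_subset[OF assms(1)], blast)
    (intro dfn_intros dfn_mem_isset[OF assms(1)] dfn_mem_isset[OF assms(2)])

lemma isset_Diff [simp]:
  assumes "isset A" "isset B"
  shows "isset (A - B)"
  by (rule isset_subset[OF assms(1)], blast)
    (intro dfn_intros dfn_mem_isset[OF assms(1)] dfn_mem_isset[OF assms(2)])

lemma irrefl: "\<not> x \<epsilon> x"
proof
  assume "x \<epsilon> x"
  have "ext (Coll {x}) = {x}" by (simp add: ext_Coll)
  then have "y \<epsilon> Coll {x} \<longleftrightarrow> y = x" for y by (auto simp: ext_def)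
  with sat_foundation[OF ZF, of x "Coll {x}"] \<open>x \<epsilon> x\<close> show False by auto
qed

text \<open>If \<open>S = ext a\<close>, then \<open>a\<close> itself is fresh, as no set is its own
  member.\<close>

lemma ex_fresh: "isset S \<Longrightarrow> \<exists>x. x \<notin> S"
  using irrefl mem_ext isset_cases[of S] by metis

lemma isset_image:
  assumes "isset S" "dfn1 g"
  shows "isset (g ` S)"
proof -
  obtain a where a: "S = ext a" using assms isset_cases by blast
  have "dfn (\<lambda>e. e 1 = g (e 0))" by (intro dfn_intros assms)
  from dfn_parameters[OF this] obtain p e' where
    p: "\<And>x y. sat E (=) (case_nat x (case_nat y e')) p = (y = g x)" by auto
  have "\<exists>b. \<forall>y. y \<epsilon> b \<longleftrightarrow> (\<exists>x. x \<epsilon> a \<and> sat E (=) (case_nat x (case_nat y e')) p)"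
    by (rule sat_replacement[OF ZF]) (simp add: p)
  then obtain b where "\<And>y. y \<epsilon> b \<longleftrightarrow> (\<exists>x. x \<epsilon> a \<and> y = g x)" unfolding p by blast
  then have "ext b = g ` S" by (auto simp: ext_def a)
  then show ?thesis using isset_ext by metis
qed

lemma isset_UN:
  assumes "isset S" "dfn (\<lambda>e. e 0 \<in> F (e (Suc 0)))" "\<And>x. x \<in> S \<Longrightarrow> isset (F x)"
  shows "isset (\<Union>x\<in>S. F x)"
proof -
  have "isset (\<Union>y\<in>(\<lambda>x. Coll (F x)) ` S. ext y)"
    by (intro isset_Union isset_image assms dfn_intros)
  then show ?thesis using assms(3) by (simp add: ext_Coll)
qed

subsection \<open>Pairs and functions\<close>

text \<open>Needed when a definition repeats a set or relation under further quantifiers, so that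
  its environment is shifted.\<close>

lemma dfn_shift:
  assumes "dfn (\<lambda>e. R (\<lambda>i. e (Suc i)) (e 0))"
  shows "dfn (\<lambda>e. R (\<lambda>i. e (f i)) (e k))"
  using dfn_subst[OF assms, of "case_nat (\<lambda>e. e k) (\<lambda>i e. e (f i))"]
  by (auto simp: trm_proj split: nat.split)

lemma eq_Coll_iff: "isset S \<Longrightarrow> a = Coll S \<longleftrightarrow> (\<forall>x. x \<epsilon> a \<longleftrightarrow> x \<in> S)"
  by (metis (no_types) Coll_ext Coll_inject isset_ext mem_ext set_eqI)

lemma mem_Coll: "isset S \<Longrightarrow> x \<epsilon> Coll S \<longleftrightarrow> x \<in> S"
  using ext_Coll mem_ext by blast

definition pair :: "'a \<Rightarrow> 'a \<Rightarrow> 'a" where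
  "pair a b = Coll {Coll {a}, Coll {a, b}}"

lemma pair_inject [simp]: "pair a b = pair c d \<longleftrightarrow> a = c \<and> b = d"
  unfolding pair_def by (simp add: Coll_inject doubleton_eq_iff singleton_insert_inj_eq) metis

lemma dfnt_pair [dfn_intros]: "dfnt t \<Longrightarrow> dfnt u \<Longrightarrow> dfnt (\<lambda>e. pair (t e) (u e))"
proof (rule dfnt_lift2[where f = pair and t = t and u = u])
  show "dfn (\<lambda>e. e 0 = pair (e (Suc 0)) (e (Suc (Suc 0))))"
    unfolding pair_def by (intro dfn_intros)
qed

definition app :: "'a \<Rightarrow> 'a \<Rightarrow> 'a" where
  "app f x = the_elt (\<lambda>y. pair x y \<epsilon> f)"

lemma dfnt_app [dfn_intros]: "dfnt t \<Longrightarrow> dfnt u \<Longrightarrow> dfnt (\<lambda>e. app (t e) (u e))"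
proof (rule dfnt_lift2[where f = app and t = t and u = u])
  show "dfn (\<lambda>e. e 0 = app (e (Suc 0)) (e (Suc (Suc 0))))"
    unfolding app_def by (intro dfn_intros)
qed

definition lam :: "'a set \<Rightarrow> ('a \<Rightarrow> 'a) \<Rightarrow> 'a" where
  "lam S g = Coll ((\<lambda>x. pair x (g x)) ` S)"

lemma isset_lam: "isset S \<Longrightarrow> dfn1 g \<Longrightarrow> isset ((\<lambda>x. pair x (g x)) ` S)"
  by (intro isset_image dfn_intros)

lemma mem_lam: "isset S \<Longrightarrow> dfn1 g \<Longrightarrow> pair x y \<epsilon> lam S g \<longleftrightarrow> x \<in> S \<and> y = g x"
  unfolding lam_def by (auto simp: mem_Coll isset_lam)

lemma app_lam [simp]: "isset S \<Longrightarrow> dfn1 g \<Longrightarrow> x \<in> S \<Longrightarrow> app (lam S g) x = g x"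
  unfolding app_def by (rule the_elt_eq) (simp_all add: mem_lam)

text \<open>The second conjunct makes \<open>f\<close> the graph of its own application, so it
  contains nothing but pairs with first component in \<open>A\<close>.\<close>

definition isfun :: "'a \<Rightarrow> 'a \<Rightarrow> 'a \<Rightarrow> bool" where
  "isfun f A B \<longleftrightarrow> app f ` ext A \<subseteq> ext B \<and> f = lam (ext A) (app f)"

lemma dfn1_app: "dfn1 (app f)"
  by (intro dfn_intros)

lemma lam_cong: "(\<And>x. x \<in> S \<Longrightarrow> g x = h x) \<Longrightarrow> lam S g = lam S h"
  unfolding lam_def by (simp cong: image_cong)

lemma isfun_lam: "dfn1 g \<Longrightarrow> g ` ext A \<subseteq> ext B \<Longrightarrow> isfun (lam (ext A) g) A B"
  unfolding isfun_def by (auto intro!: lam_cong)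

lemma mem_isfun: "isfun f A B \<Longrightarrow> pair x y \<epsilon> f \<longleftrightarrow> x \<in> ext A \<and> y = app f x"
  unfolding isfun_def using mem_lam[OF isset_ext dfn1_app, of x y A f] by simp

lemma isfunD: "isfun f A B \<Longrightarrow> x \<in> ext A \<Longrightarrow> app f x \<in> ext B"
  unfolding isfun_def by blast

subsection \<open>Equipotence\<close>

text \<open>On sets of the model, the definable functions are those given by an element of the model,
  cf. \<open>app_lam\<close>.\<close>

definition eqpoll :: "'a set \<Rightarrow> 'a set \<Rightarrow> bool" (infix "\<approx>" 50) where
  "S \<approx> T \<longleftrightarrow> (\<exists>g. dfn1 g \<and> bij_betw g S T)"

lemma eqpollI: "dfn1 g \<Longrightarrow> bij_betw g S T \<Longrightarrow> S \<approx> T"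
  unfolding eqpoll_def by blast

lemma eqpoll_refl: "S \<approx> S"
  by (rule eqpollI[of "\<lambda>x. x"]) (auto intro: dfn_intros simp: bij_betw_def)

text \<open>The inverse is given by a unique description, so no preimages are chosen.\<close>

lemma dfn1_inverse:
  assumes "isset S" "dfn1 g" "inj_on g S"
  shows "\<exists>h. dfn1 h \<and> (\<forall>x\<in>S. h (g x) = x)"
proof (intro exI conjI ballI)
  show "dfn1 (\<lambda>y. the_elt (\<lambda>x. x \<in> S \<and> y = g x))"
    by (intro dfn_intros dfn_mem_isset[OF assms(1)] dfn1D[OF assms(2)])
  show "the_elt (\<lambda>z. z \<in> S \<and> g x = g z) = x" if "x \<in> S" for x
    using assms(3) that by (intro the_elt_eq) (auto dest: inj_onD)
qed

lemma eqpoll_sym: "isset S \<Longrightarrow> S \<approx> T \<Longrightarrow> T \<approx> S"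
proof -
  assume S: "isset S" and "S \<approx> T"
  then obtain g where g: "dfn1 g" "bij_betw g S T" unfolding eqpoll_def by blast
  then obtain h where h: "dfn1 h" "\<And>x. x \<in> S \<Longrightarrow> h (g x) = x"
    using dfn1_inverse[OF S g(1)] by (auto simp: bij_betw_def)
  then have "bij_betw h T S"
    using g(2) by (intro bij_betw_byWitness[where f' = g]) (auto simp: bij_betw_def)
  with h(1) show "T \<approx> S" by (rule eqpollI)
qed

lemma eqpoll_trans: "S \<approx> T \<Longrightarrow> T \<approx> U \<Longrightarrow> S \<approx> U"
proof -
  assume "S \<approx> T" "T \<approx> U"
  then obtain g h where gh: "dfn1 g" "bij_betw g S T" "dfn1 h" "bij_betw h T U"
    unfolding eqpoll_def by blast
  have "dfn1 (\<lambda>x. h (g x))" by (intro dfn1D[OF gh(3)] gh(1))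
  moreover have "bij_betw (\<lambda>x. h (g x)) S U" using bij_betw_trans[OF gh(2,4)] by (simp add: comp_def)
  ultimately show "S \<approx> U" by (rule eqpollI)
qed

text \<open>Replaces the external quantifier over definable functions by a quantifier over elements
  of the model, which makes \<open>\<approx>\<close> itself definable.\<close>

lemma eqpoll_iff:
  assumes "isset S"
  shows "S \<approx> T \<longleftrightarrow> (\<exists>f. bij_betw (app f) S T)"
proof
  assume "S \<approx> T"
  then obtain g where g: "dfn1 g" "bij_betw g S T" unfolding eqpoll_def by blast
  then have "bij_betw (app (lam S g)) S T"
    using assms by (subst bij_betw_cong[of S _ g]) auto
  then show "\<exists>f. bij_betw (app f) S T" by blast
qed (use eqpollI dfn1_app in blast)

lemma eqpoll_image: "dfn1 g \<Longrightarrow> inj_on g S \<Longrightarrow> S \<approx> g ` S"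
  by (rule eqpollI) (auto simp: bij_betw_def)

lemma eqpoll_disjoint_Un:
  assumes "isset S" "S \<approx> T" "S' \<approx> T'" "S \<inter> S' = {}" "T \<inter> T' = {}"
  shows "S \<union> S' \<approx> T \<union> T'"
proof -
  obtain g h where gh: "dfn1 g" "bij_betw g S T" "dfn1 h" "bij_betw h S' T'"
    using assms unfolding eqpoll_def by blast
  have "dfn1 (\<lambda>x. if x \<in> S then g x else h x)"
    by (intro dfn_intros dfn_mem_isset assms gh)
  moreover have "bij_betw (\<lambda>x. if x \<in> S then g x else h x) (S \<union> S') (T \<union> T')"
  proof (rule bij_betw_combine[OF _ _ assms(5)])
    show "bij_betw (\<lambda>x. if x \<in> S then g x else h x) S T"
      using gh(2) by (subst bij_betw_cong[of S _ g]) auto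
    show "bij_betw (\<lambda>x. if x \<in> S then g x else h x) S' T'"
      using gh(4) assms(4) by (subst bij_betw_cong[of S' _ h]) auto
  qed
  ultimately show ?thesis by (rule eqpollI)
qed

subsection \<open>Natural numbers\<close>

definition zero :: 'a where "zero = Coll {}"

definition suc :: "'a \<Rightarrow> 'a" where "suc x = Coll (insert x (ext x))"

lemma ext_zero [simp]: "ext zero = {}" and ext_suc [simp]: "ext (suc x) = insert x (ext x)"
  by (simp_all add: zero_def suc_def ext_Coll)

lemma mem_suc: "z \<epsilon> suc x \<longleftrightarrow> z = x \<or> z \<epsilon> x"
  using ext_suc[of x] by (auto simp: mem_ext[symmetric])

lemma not_mem_zero: "\<not> z \<epsilon> zero"
  using ext_zero by (simp add: mem_ext[symmetric])

lemma dfnt_suc [dfn_intros]: "dfnt t \<Longrightarrow> dfnt (\<lambda>e. suc (t e))"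
proof (rule dfnt_lift1[where f = suc and t = t])
  show "dfn (\<lambda>e. e 0 = suc (e (Suc 0)))" unfolding suc_def by (intro dfn_intros)
qed

definition inductive_elt :: "'a \<Rightarrow> bool" where
  "inductive_elt w \<longleftrightarrow> zero \<epsilon> w \<and> (\<forall>x. x \<epsilon> w \<longrightarrow> suc x \<epsilon> w)"

lemma dfn_inductive_elt: "dfn (\<lambda>e. inductive_elt (e i))"
  unfolding inductive_elt_def by (intro dfn_intros)

definition N :: "'a set" where
  "N = {x. \<forall>w. inductive_elt w \<longrightarrow> x \<epsilon> w}"

lemma ex_inductive_elt: "\<exists>w. inductive_elt w"
proof -
  obtain w where w: "\<exists>z. (\<forall>y. \<not> y \<epsilon> z) \<and> z \<epsilon> w"
    "\<forall>x. x \<epsilon> w \<longrightarrow> (\<exists>y. (\<forall>z. z \<epsilon> y \<longleftrightarrow> z \<epsilon> x \<or> z = x) \<and> y \<epsilon> w)"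
    using sat_infinity[OF ZF] by blast
  have "z = zero" if "\<forall>y. \<not> y \<epsilon> z" for z using that by (simp add: zero_def eq_Coll_iff)
  moreover have "y = suc x" if "\<forall>z. z \<epsilon> y \<longleftrightarrow> z \<epsilon> x \<or> z = x" for x y
    using that by (auto simp: suc_def eq_Coll_iff mem_ext)
  ultimately have "inductive_elt w" using w unfolding inductive_elt_def by metis
  then show ?thesis by blast
qed

lemma isset_N [simp]: "isset N"
proof -
  obtain w where w: "inductive_elt w" using ex_inductive_elt by blast
  show ?thesis
  proof (rule isset_subset[of "ext w"])
    show "N \<subseteq> ext w" using w by (auto simp: N_def mem_ext)
    show "dfn (\<lambda>e. e 0 \<in> N)" unfolding N_def by (intro dfn_intros dfn_inductive_elt)
  qed simp
qed

lemma dfn_mem_N [dfn_intros]: "dfnt t \<Longrightarrow> dfn (\<lambda>e. t e \<in> N)"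
  by (rule dfn_mem_isset[OF isset_N])

lemma zero_N [simp]: "zero \<in> N" and suc_N [simp]: "n \<in> N \<Longrightarrow> suc n \<in> N"
  by (auto simp: N_def inductive_elt_def)

text \<open>\<open>N\<close> may have nonstandard elements, so induction is confined to definable
  predicates: these carve out an inductive set of the model.\<close>

lemma N_induct [consumes 1, case_names dfn zero suc]:
  assumes "n \<in> N" "dfn (\<lambda>e. P (e 0))" "P zero" "\<And>n. n \<in> N \<Longrightarrow> P n \<Longrightarrow> P (suc n)"
  shows "P n"
proof -
  have isset: "isset {n \<in> N. P n}" by (rule isset_Collect[OF isset_N assms(2)])
  have "inductive_elt (Coll {n \<in> N. P n})"
    using assms(3,4) by (auto simp: inductive_elt_def mem_Coll[OF isset])
  then have "n \<epsilon> Coll {n \<in> N. P n}" using assms(1) unfolding N_def by blast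
  then show ?thesis by (simp add: mem_Coll[OF isset])
qed

lemma N_subset: "n \<in> N \<Longrightarrow> ext n \<subseteq> N"
  by (induction n rule: N_induct) (intro dfn_intros, auto)

lemma N_mem: "n \<in> N \<Longrightarrow> x \<epsilon> n \<Longrightarrow> x \<in> N"
  using N_subset by (auto simp: mem_ext[symmetric])

lemma N_trans: "n \<in> N \<Longrightarrow> y \<epsilon> n \<Longrightarrow> x \<epsilon> y \<Longrightarrow> x \<epsilon> n"
proof -
  have "n \<in> N \<Longrightarrow> \<forall>x y. y \<epsilon> n \<longrightarrow> x \<epsilon> y \<longrightarrow> x \<epsilon> n"
    by (induction n rule: N_induct) (intro dfn_intros, auto simp: mem_suc not_mem_zero)
  then show "n \<in> N \<Longrightarrow> y \<epsilon> n \<Longrightarrow> x \<epsilon> y \<Longrightarrow> x \<epsilon> n" by blast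
qed

lemma suc_mem_suc: "n \<in> N \<Longrightarrow> m \<epsilon> n \<Longrightarrow> suc m \<epsilon> suc n"
proof -
  have "n \<in> N \<Longrightarrow> \<forall>m. m \<epsilon> n \<longrightarrow> suc m \<epsilon> suc n"
    by (induction n rule: N_induct) (intro dfn_intros, auto simp: mem_suc not_mem_zero)
  then show "n \<in> N \<Longrightarrow> m \<epsilon> n \<Longrightarrow> suc m \<epsilon> suc n" by blast
qed

lemma zero_mem_suc: "n \<in> N \<Longrightarrow> zero \<epsilon> suc n"
  by (induction n rule: N_induct) (intro dfn_intros, auto simp: mem_suc)

lemma N_linear: "m \<in> N \<Longrightarrow> n \<in> N \<Longrightarrow> m \<epsilon> n \<or> m = n \<or> n \<epsilon> m"
proof -
  have "n \<in> N \<Longrightarrow> \<forall>m\<in>N. m \<epsilon> n \<or> m = n \<or> n \<epsilon> m"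
  proof (induction n rule: N_induct)
    case zero
    have "m \<in> N \<Longrightarrow> m = zero \<or> zero \<epsilon> m" for m
      by (induction m rule: N_induct) (intro dfn_intros, auto simp: mem_suc)
    then show ?case by blast
  next
    case (suc n)
    then show ?case using suc_mem_suc by (auto simp: mem_suc)
  qed (intro dfn_intros)
  then show "m \<in> N \<Longrightarrow> n \<in> N \<Longrightarrow> m \<epsilon> n \<or> m = n \<or> n \<epsilon> m" by blast
qed

lemma N_asym: "m \<in> N \<Longrightarrow> m \<epsilon> n \<Longrightarrow> \<not> n \<epsilon> m"
  using N_trans irrefl by blast

lemma suc_inject: "m \<in> N \<Longrightarrow> n \<in> N \<Longrightarrow> suc m = suc n \<Longrightarrow> m = n"
  using N_asym by (metis mem_suc)

lemma suc_not_zero: "suc n \<noteq> zero"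
  using not_mem_zero mem_suc by metis

text \<open>Foundation, applied to the set of all such numbers, provides a minimal one.\<close>

lemma N_least:
  assumes "n \<in> N" "P n" "dfn (\<lambda>e. P (e 0))"
  shows "\<exists>n\<in>N. P n \<and> (\<forall>m. m \<epsilon> n \<longrightarrow> \<not> P m)"
proof -
  have isset: "isset {n \<in> N. P n}" by (rule isset_Collect[OF isset_N assms(3)])
  obtain y where "y \<in> N" "P y" "\<nexists>z. (z \<in> N \<and> P z) \<and> z \<epsilon> y"
    using sat_foundation[OF ZF, of n "Coll {n \<in> N. P n}"] assms(1,2) by (auto simp: mem_Coll[OF isset])
  then show ?thesis using N_mem by blast
qed

lemma N_cases: "n \<in> N \<Longrightarrow> n = zero \<or> (\<exists>m\<in>N. n = suc m)"
  by (induction n rule: N_induct) (intro dfn_intros, auto)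

subsection \<open>Finite sets\<close>

definition Fin :: "'a set \<Rightarrow> bool" where
  "Fin S \<longleftrightarrow> isset S \<and> (\<exists>n\<in>N. S \<approx> ext n)"

lemma dfn_inj_on [dfn_intros]:
  assumes "dfn (\<lambda>e. e 0 \<in> S (\<lambda>i. e (Suc i)))" "dfnt (\<lambda>e. g (\<lambda>i. e (Suc i)) (e 0))"
  shows "dfn (\<lambda>e. inj_on (g e) (S e))"
proof -
  have g: "dfnt (\<lambda>e. g (\<lambda>i. e (f i)) (e k))" for f k
    using dfnt_subst[OF assms(2), of "case_nat (\<lambda>e. e k) (\<lambda>i e. e (f i))"]
    by (auto simp: trm_proj split: nat.split)
  show ?thesis unfolding inj_on_def
    by (intro dfn_intros g assms(1) dfn_shift[where R = "\<lambda>e x. x \<in> S e", OF assms(1)])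
qed

lemma dfn_Fin [dfn_intros]:
  assumes "dfn (\<lambda>e. e 0 \<in> S (\<lambda>i. e (Suc i)))"
  shows "dfn (\<lambda>e. Fin (S e))"
proof -
  note S = assms dfn_shift[where R = "\<lambda>e x. x \<in> S e", OF assms]
  have "Fin S \<longleftrightarrow> isset S \<and> (\<exists>n\<in>N. \<exists>f. inj_on (app f) S \<and> app f ` S = ext n)" for S
    by (simp add: Fin_def bij_betw_def eqpoll_iff cong: conj_cong)
  then show ?thesis by (simp only:) (intro dfn_intros S)
qed

lemma Fin_isset: "Fin S \<Longrightarrow> isset S"
  by (simp add: Fin_def)

lemma Fin_empty [simp]: "Fin {}"
  unfolding Fin_def using eqpoll_refl[of "{}"] zero_N ext_zero by (auto intro: bexI[of _ zero])

lemma Fin_N: "n \<in> N \<Longrightarrow> Fin (ext n)"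
  unfolding Fin_def using eqpoll_refl by auto

lemma eqpoll_singleton: "{x} \<approx> {y}"
  by (rule eqpollI[of "\<lambda>_. y"]) (auto intro: dfn_intros)

lemma eqpoll_insert: "isset S \<Longrightarrow> S \<approx> T \<Longrightarrow> x \<notin> S \<Longrightarrow> y \<notin> T \<Longrightarrow> insert x S \<approx> insert y T"
  using eqpoll_disjoint_Un[of S T "{x}" "{y}"] eqpoll_singleton by simp

lemma not_mem_ext_self: "x \<notin> ext x"
  using irrefl by (simp add: mem_ext)

lemma Fin_insert [simp]: "Fin S \<Longrightarrow> Fin (insert x S)"
proof (cases "x \<in> S")
  case False
  assume "Fin S"
  then obtain n where n: "isset S" "n \<in> N" "S \<approx> ext n" unfolding Fin_def by blast
  then have "insert x S \<approx> ext (suc n)"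
    using False not_mem_ext_self by (simp add: eqpoll_insert)
  then show "Fin (insert x S)"
    unfolding Fin_def using n by (intro conjI bexI[of _ "suc n"]) simp_all
qed (simp add: insert_absorb)

text \<open>A finite set of the model may be infinite in HOL, as its size may be nonstandard. The
  induction is on the size, for all sets \<open>s\<close> and bijections \<open>f\<close> at once,
  which keeps the predicate definable.\<close>

lemma Fin_induct [consumes 1, case_names dfn empty insert]:
  assumes "Fin S" and dfn: "dfn (\<lambda>e. P (ext (e 0)))" and empty: "P {}"
    and insert: "\<And>x S. Fin S \<Longrightarrow> x \<notin> S \<Longrightarrow> P S \<Longrightarrow> P (insert x S)"
  shows "P S"
proof -
  have "n \<in> N \<Longrightarrow> \<forall>s f. bij_betw (app f) (ext s) (ext n) \<longrightarrow> P (ext s)" for n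
  proof (induction n rule: N_induct)
    case dfn
    show ?case unfolding bij_betw_def
      by (intro dfn_intros dfn_lift1[where R = "\<lambda>s. P (ext s)", OF assms(2)])
  next
    case zero
    show ?case using empty by (auto simp: bij_betw_def)
  next
    case (suc n)
    show ?case
    proof (intro allI impI)
      fix s f assume f: "bij_betw (app f) (ext s) (ext (suc n))"
      then obtain x where x: "x \<in> ext s" "app f x = n" unfolding bij_betw_def by (metis ext_suc imageE insertI1)
      have isset: "isset (ext s - {x})" by simp
      have "bij_betw (app f) (ext s - {x}) (ext (suc n) - {n})"
        using f x bij_betw_DiffI[OF f, of "{x}" "{n}"] by (auto simp: bij_betw_def)
      then have b: "bij_betw (app f) (ext s - {x}) (ext n)"
        using not_mem_ext_self[of n] by simp
      then have "P (ext s - {x})"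
        using suc(2) ext_Coll[OF isset] by metis
      moreover have "Fin (ext s - {x})"
        unfolding Fin_def using b suc(1) dfn1_app eqpollI by fastforce
      ultimately have "P (insert x (ext s - {x}))" by (intro insert) auto
      then show "P (ext s)" using x(1) by (simp add: insert_absorb)
    qed
  qed
  moreover obtain n where "isset S" "n \<in> N" "S \<approx> ext n" using assms(1) unfolding Fin_def by blast
  ultimately show ?thesis by (metis eqpoll_iff ext_Coll)
qed

lemma Fin_subset: "Fin S \<Longrightarrow> isset T \<Longrightarrow> T \<subseteq> S \<Longrightarrow> Fin T"
proof -
  \<comment> \<open>Quantifying over elements \<open>t\<close> instead of HOL sets keeps the
    induction predicate definable.\<close>
  have "Fin S \<Longrightarrow> \<forall>t. ext t \<subseteq> S \<longrightarrow> Fin (ext t)"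
  proof (induction S rule: Fin_induct)
    case (insert x S)
    show ?case
    proof (intro allI impI)
      fix t assume t: "ext t \<subseteq> insert x S"
      have "ext (Coll (ext t - {x})) \<subseteq> S" using t by (auto simp: ext_Coll)
      with insert have "Fin (ext (Coll (ext t - {x})))" by blast
      then have "Fin (ext t - {x})" by (simp add: ext_Coll)
      then show "Fin (ext t)" using Fin_insert[of "ext t - {x}" x] by (cases "x \<in> ext t") (auto simp: insert_absorb)
    qed
  qed (intro dfn_intros, auto)
  then show "Fin S \<Longrightarrow> isset T \<Longrightarrow> T \<subseteq> S \<Longrightarrow> Fin T" by (auto elim: isset_cases)
qed

lemma Fin_Un [simp]:
  assumes "Fin S" "Fin T"
  shows "Fin (S \<union> T)"
  using assms(1)
proof (induction S rule: Fin_induct)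
  case dfn
  show ?case by (intro dfn_intros dfn_mem_isset[OF Fin_isset[OF assms(2)]])
qed (simp_all add: assms)

lemma Fin_image:
  assumes "Fin S" "dfn1 g"
  shows "Fin (g ` S)"
  using assms(1)
proof (induction S rule: Fin_induct)
  case dfn
  show ?case by (intro dfn_intros dfn1D[OF assms(2)])
qed simp_all

lemma Fin_UN:
  assumes "Fin S" and F: "dfn (\<lambda>e. e 0 \<in> F (e (Suc 0)))" and "\<And>x. x \<in> S \<Longrightarrow> Fin (F x)"
  shows "Fin (\<Union>x\<in>S. F x)"
proof -
  have F': "dfn (\<lambda>e. e i \<in> F (e j))" for i j
    using dfn_lift2[where R = "\<lambda>x y. x \<in> F y", OF F dfnt_proj dfnt_proj] .
  have "(\<forall>x\<in>S. Fin (F x)) \<longrightarrow> Fin (\<Union>x\<in>S. F x)"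
    using assms(1) by (induction S rule: Fin_induct) (intro dfn_intros F', auto)
  then show ?thesis using assms(3) by blast
qed

lemma Fin_Pow: "Fin S \<Longrightarrow> Fin {t. ext t \<subseteq> S}"
proof (induction S rule: Fin_induct)
  case empty
  have "{t. ext t \<subseteq> {}} = {zero}" using ext_inject[of _ zero] by auto
  then show ?case by simp
next
  case (insert x S)
  let ?f = "\<lambda>t. Coll (insert x (ext t))"
  have "t \<in> ?f ` {t. ext t \<subseteq> S}" if "ext t \<subseteq> insert x S" "\<not> ext t \<subseteq> S" for t
  proof
    show "Coll (ext t - {x}) \<in> {t. ext t \<subseteq> S}" using that by (auto simp: ext_Coll)
    have "x \<in> ext t" using that by blast
    then show "t = ?f (Coll (ext t - {x}))" by (simp add: ext_Coll insert_absorb)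
  qed
  then have "{t. ext t \<subseteq> insert x S} = {t. ext t \<subseteq> S} \<union> ?f ` {t. ext t \<subseteq> S}"
    by (auto simp: ext_Coll)
  moreover have "dfn1 ?f" by (intro dfn_intros)
  ultimately show ?case using insert Fin_image by auto
qed (intro dfn_intros)

lemma Fin_inj_onto:
  assumes "Fin S" "dfn1 g" "inj_on g S" "g ` S \<subseteq> S"
  shows "g ` S = S"
proof -
  have "Fin S \<Longrightarrow> \<forall>f. inj_on (app f) S \<longrightarrow> app f ` S \<subseteq> S \<longrightarrow> app f ` S = S"
  proof (induction S rule: Fin_induct)
    case (insert x S)
    show ?case
    proof (intro allI impI)
      \<comment> \<open>\<open>?h\<close> bypasses \<open>x\<close>: an element that
        \<open>?g\<close> sends to \<open>x\<close> is sent on to \<open>?g x\<close>. So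
        \<open>?h\<close> maps \<open>S\<close> injectively into \<open>S\<close>, and the induction
        hypothesis applies to its graph.\<close>
      fix f let ?g = "app f" let ?h = "\<lambda>y. if ?g y = x then ?g x else ?g y"
      assume inj: "inj_on ?g (insert x S)" and into: "?g ` insert x S \<subseteq> insert x S"
      have "dfn1 ?h" by (intro dfn_intros)
      then have h: "app (lam S ?h) y = ?h y" if "y \<in> S" for y
        using that insert(1) by (simp add: Fin_isset)
      have "inj_on ?h S"
        using inj insert(2) unfolding inj_on_def by (metis insertI1 insertI2)
      moreover have "?h y \<in> S" if "y \<in> S" for y
        using inj into insert(2) that by (auto simp: inj_on_def)
      then have "?h ` S \<subseteq> S" by blast
      ultimately have "?h ` S = S"
        using spec[OF insert(3), of "lam S ?h"] h by (simp cong: inj_on_cong image_cong)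
      moreover have "z \<in> ?g ` insert x S" if z: "z \<in> ?h ` S" for z
      proof -
        obtain y where y: "y \<in> S" "z = ?h y" using z by blast
        then show ?thesis by (cases "?g y = x") auto
      qed
      moreover have "x \<in> ?g ` insert x S"
      proof (cases "?g x = x")
        case True
        then show ?thesis by force
      next
        case False
        then have "?g x \<in> ?h ` S" using into \<open>?h ` S = S\<close> by blast
        then obtain y where y: "y \<in> S" "?g x = ?h y" by blast
        have "?g y \<noteq> ?g x" using inj y(1) insert(2) unfolding inj_on_def by blast
        then have "?g y = x" using y(2) by (metis (full_types))
        then show ?thesis using y(1) by blast
      qed
      ultimately show "?g ` insert x S = insert x S" using into by blast
    qed
  qed (intro dfn_intros, auto)
  from spec[OF this[OF assms(1)], of "lam S g"]
  have "inj_on (app (lam S g)) S \<Longrightarrow> app (lam S g) ` S \<subseteq> S \<Longrightarrow> app (lam S g) ` S = S" by blast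
  moreover have "app (lam S g) x = g x" if "x \<in> S" for x using that assms by (simp add: Fin_isset)
  then have "inj_on (app (lam S g)) S = inj_on g S" "app (lam S g) ` S = g ` S"
    by (auto cong: inj_on_cong image_cong)
  ultimately show ?thesis using assms by simp
qed

text \<open>The smaller of two different numbers is a proper subset of the larger one, so a
  bijection would contradict \<open>Fin_inj_onto\<close>.\<close>

lemma eqpoll_N_unique:
  assumes "m \<in> N" "n \<in> N" "ext m \<approx> ext n"
  shows "m = n"
proof -
  have False if m: "m \<in> N" and eq: "ext m \<approx> ext n" and n: "n \<epsilon> m" for m n
  proof -
    obtain g where g: "dfn1 g" "bij_betw g (ext m) (ext n)" using eq unfolding eqpoll_def by blast
    have "ext n \<subseteq> ext m" using N_trans[OF m n] by (auto simp: mem_ext)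
    then have "ext n = ext m" using Fin_inj_onto[OF Fin_N[OF m] g(1)] g(2) by (auto simp: bij_betw_def)
    then have "n = m" by (simp add: ext_inject)
    then show False using n irrefl by simp
  qed
  then show ?thesis using N_linear assms eqpoll_sym isset_ext by metis
qed

subsection \<open>Dedekind-infinite sets\<close>

definition Dinf :: "'a set \<Rightarrow> bool" where
  "Dinf S \<longleftrightarrow> (\<exists>g. dfn1 g \<and> inj_on g S \<and> g ` S \<subset> S)"

lemma Dinf_mono:
  assumes "isset S" "Dinf S" "S \<subseteq> A"
  shows "Dinf A"
proof -
  obtain g where g: "dfn1 g" "inj_on g S" "g ` S \<subset> S" using assms(2) unfolding Dinf_def by blast
  let ?h = "\<lambda>x. if x \<in> S then g x else x"
  have "dfn1 ?h" by (intro dfn_intros dfn_mem_isset assms(1) g(1))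
  moreover have "inj_on ?h A"
  proof (rule inj_onI)
    fix x y assume eq: "?h x = ?h y"
    have "?h z \<in> S \<longleftrightarrow> z \<in> S" for z using g(3) by auto
    from this[of x] this[of y] have "x \<in> S \<longleftrightarrow> y \<in> S" unfolding eq by blast
    with eq show "x = y" by (cases "x \<in> S") (simp_all add: inj_on_eq_iff[OF g(2)])
  qed
  moreover have "?h ` A \<subset> A"
  proof -
    obtain s where "s \<in> S" "s \<notin> g ` S" using g(3) by blast
    then have "s \<in> A" "s \<notin> ?h ` A" using assms(3) by auto
    moreover have "?h ` A \<subseteq> A" using g(3) assms(3) by auto
    ultimately show ?thesis by blast
  qed
  ultimately show ?thesis unfolding Dinf_def by (intro exI[of _ ?h] conjI)
qed

text \<open>In a linear order with finite initial segments and without a greatest element, the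
  successor function witnesses Dedekind-infinity.\<close>

lemma Dinf_linear_order:
  assumes S: "isset S" and L: "dfn (\<lambda>e. L (e 0) (e (Suc 0)))"
    and irr: "\<And>s. \<not> L s s" and tr: "\<And>r s t. r \<in> S \<Longrightarrow> s \<in> S \<Longrightarrow> t \<in> S \<Longrightarrow> L r s \<Longrightarrow> L s t \<Longrightarrow> L r t"
    and total: "\<And>s t. s \<in> S \<Longrightarrow> t \<in> S \<Longrightarrow> s = t \<or> L s t \<or> L t s"
    and fin: "\<And>s. s \<in> S \<Longrightarrow> Fin {t \<in> S. L t s}" and inf: "\<not> Fin S"
  shows "Dinf S"
proof -
  note L' = dfn_lift2[where R = L, OF L]
  note S' = dfn_mem_isset[OF S]
  have Fin_least: "\<exists>m\<in>C. \<forall>c\<in>C. c \<noteq> m \<longrightarrow> L m c" if "Fin C" "C \<subseteq> S" "C \<noteq> {}" for C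
  proof -
    have "C \<subseteq> S \<longrightarrow> C \<noteq> {} \<longrightarrow> (\<exists>m\<in>C. \<forall>c\<in>C. c \<noteq> m \<longrightarrow> L m c)" using \<open>Fin C\<close>
    proof (induction C rule: Fin_induct)
      case dfn
      show ?case by (intro dfn_intros L' S')
    next
      case (insert x C)
      show ?case
      proof (intro impI)
        assume sub: "insert x C \<subseteq> S"
        show "\<exists>m\<in>insert x C. \<forall>c\<in>insert x C. c \<noteq> m \<longrightarrow> L m c"
        proof (cases "C = {}")
          case False
          then obtain m where m: "m \<in> C" "\<And>c. c \<in> C \<Longrightarrow> c \<noteq> m \<Longrightarrow> L m c" using insert(3) sub by auto
          show ?thesis
          proof (cases "L m x")
            case True
            then show ?thesis using m by blast
          next
            case False
            then have "L x m" using total[of x m] sub m(1) insert(2) by blast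
            then have "\<forall>c\<in>C. L x c" using m tr sub by (metis insert_subset subsetD)
            then show ?thesis by blast
          qed
        qed simp
      qed
    qed simp
    then show ?thesis using that by blast
  qed
  \<comment> \<open>\<open>C\<close> may be infinite, but only finitely many elements lie below one
    of its members \<open>c\<close>. The least of these, or \<open>c\<close> itself if there are
    none, is least in \<open>C\<close>.\<close>
  have least: "\<exists>m\<in>C. \<forall>c\<in>C. c \<noteq> m \<longrightarrow> L m c" if sub: "C \<subseteq> S" and C: "dfn (\<lambda>e. e 0 \<in> C)" and "C \<noteq> {}" for C
  proof -
    obtain c where c: "c \<in> C" using \<open>C \<noteq> {}\<close> by blast
    let ?D = "{t \<in> C. L t c}"
    have "isset ?D" by (rule isset_subset[OF S]) (use sub in blast, intro dfn_intros C L')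
    then have "Fin ?D" using sub c fin[of c] Fin_subset[of "{t \<in> S. L t c}" ?D] by blast
    show ?thesis
    proof (cases "?D = {}")
      case True
      then show ?thesis using c total sub by blast
    next
      case False
      then obtain m where m: "m \<in> ?D" "\<forall>d\<in>?D. d \<noteq> m \<longrightarrow> L m d"
        using Fin_least[OF \<open>Fin ?D\<close>] sub by blast
      have "L m d" if "d \<in> C" "d \<noteq> m" for d
      proof (cases "L d c")
        case False
        then have "d = c \<or> L c d" using total that c sub by blast
        then show ?thesis using m tr c that sub by (metis (no_types, lifting) mem_Collect_eq subsetD)
      qed (use m that in blast)
      then show ?thesis using m by blast
    qed
  qed
  define next_elt where "next_elt = (\<lambda>s. the_elt (\<lambda>t. t \<in> S \<and> L s t \<and> (\<forall>r\<in>S. L s r \<longrightarrow> r \<noteq> t \<longrightarrow> L t r)))"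
  have dfn: "dfn1 next_elt" unfolding next_elt_def by (intro dfn_intros S' L')
  have next_elt: "next_elt s \<in> S \<and> L s (next_elt s) \<and> (\<forall>r\<in>S. L s r \<longrightarrow> r \<noteq> next_elt s \<longrightarrow> L (next_elt s) r)"
    if s: "s \<in> S" for s
  proof -
    have "{t \<in> S. L s t} \<noteq> {}"
    proof
      assume "{t \<in> S. L s t} = {}"
      then have "S = insert s {t \<in> S. L t s}" using s total by blast
      then show False using Fin_insert[OF fin[OF s]] inf by metis
    qed
    moreover have "dfn (\<lambda>e. e 0 \<in> {t \<in> S. L s t})" by (intro dfn_intros S' L')
    ultimately obtain m where m: "m \<in> S" "L s m" "\<forall>r\<in>S. L s r \<longrightarrow> r \<noteq> m \<longrightarrow> L m r"
      using least[of "{t \<in> S. L s t}"] by auto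
    have "next_elt s = m"
      unfolding next_elt_def
    proof (rule the_elt_eq)
      fix t assume t: "t \<in> S \<and> L s t \<and> (\<forall>r\<in>S. L s r \<longrightarrow> r \<noteq> t \<longrightarrow> L t r)"
      then have "t \<noteq> m \<Longrightarrow> L t m" "t \<noteq> m \<Longrightarrow> L m t" using m by auto
      then show "t = m" using tr[of t m t] irr[of t] t m(1) by blast
    qed (use m in blast)
    then show ?thesis using m by simp
  qed
  have mono: "L (next_elt s) (next_elt t)" if "s \<in> S" "t \<in> S" "L s t" for s t
    using next_elt[of s] next_elt[of t] that tr[of "next_elt s" t "next_elt t"] by metis
  have "inj_on next_elt S"
    using mono total irr unfolding inj_on_def by metis
  moreover have "next_elt ` S \<subset> S"
  proof -
    have "S \<noteq> {}" using inf by auto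
    then obtain m where m: "m \<in> S" "\<forall>c\<in>S. c \<noteq> m \<longrightarrow> L m c"
      using least[of S] dfn_mem_isset[OF S dfnt_proj] by blast
    then have "m \<notin> next_elt ` S"
      using next_elt tr[of m _ m] irr by (metis imageE)
    then show ?thesis using m(1) next_elt by blast
  qed
  ultimately show ?thesis unfolding Dinf_def using dfn by blast
qed

section \<open>Least natural numbers and unions of finite layers\<close>

definition least_N :: "('a \<Rightarrow> bool) \<Rightarrow> 'a" where
  "least_N P = the_elt (\<lambda>n. n \<in> N \<and> P n \<and> (\<forall>m. m \<epsilon> n \<longrightarrow> \<not> P m))"

lemma least_N:
  assumes "dfn (\<lambda>e. P (e 0))" "n \<in> N" "P n"
  shows "least_N P \<in> N" "P (least_N P)" "n = least_N P \<or> least_N P \<epsilon> n"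
proof -
  obtain k where k: "k \<in> N \<and> P k \<and> (\<forall>m. m \<epsilon> k \<longrightarrow> \<not> P m)"
    using N_least[OF assms(2,3,1)] by blast
  then have "least_N P = k"
    unfolding least_N_def by (intro the_elt_eq) (use N_linear in blast)+
  then show "least_N P \<in> N" "P (least_N P)" "n = least_N P \<or> least_N P \<epsilon> n"
    using k assms N_linear by blast+
qed

lemma dfnt_least_N [dfn_intros]:
  assumes "dfn (\<lambda>e. P (\<lambda>i. e (Suc i)) (e 0))"
  shows "dfnt (\<lambda>e. least_N (P e))"
  unfolding least_N_def
  by (intro dfn_intros assms dfn_shift[where R = P, OF assms])

text \<open>The elements are ordered by the first layer \<open>w n\<close> containing them and then by \<open>M\<close>.\<close>

lemma Dinf_layers:
  assumes w: "dfn (\<lambda>e. e 0 \<in> w (e (Suc 0)))" and fin: "\<And>n. n \<in> N \<Longrightarrow> Fin (w n)"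
    and M: "dfn (\<lambda>e. M (e 0) (e (Suc 0)))" and irr: "\<And>s. \<not> M s s"
    and tr: "\<And>r s t. M r s \<Longrightarrow> M s t \<Longrightarrow> M r t"
    and total: "\<And>n s t. n \<in> N \<Longrightarrow> s \<in> w n \<Longrightarrow> t \<in> w n \<Longrightarrow> s = t \<or> M s t \<or> M t s"
    and inf: "\<not> Fin (\<Union>n\<in>N. w n)"
  shows "Dinf (\<Union>n\<in>N. w n)"
proof -
  let ?S = "\<Union>n\<in>N. w n"
  note w' = dfn_lift2[where R = "\<lambda>x n. x \<in> w n", OF w]
  note M' = dfn_lift2[where R = M, OF M]
  define idx where "idx = (\<lambda>s. least_N (\<lambda>n. s \<in> w n))"
  have idx: "idx s \<in> N" "s \<in> w (idx s)" if "s \<in> ?S" for s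
  proof -
    obtain n where "n \<in> N" "s \<in> w n" using \<open>s \<in> ?S\<close> by blast
    moreover have "dfn (\<lambda>e. s \<in> w (e 0))" by (intro w' dfn_intros)
    ultimately show "idx s \<in> N" "s \<in> w (idx s)"
      unfolding idx_def using least_N[of "\<lambda>n. s \<in> w n" n] by blast+
  qed
  have dfn_idx: "dfn1 idx" unfolding idx_def by (intro dfn_intros w')
  have S: "isset ?S" using fin Fin_isset by (intro isset_UN w isset_N) blast
  show ?thesis
  proof (rule Dinf_linear_order[of _ "\<lambda>s t. idx s \<epsilon> idx t \<or> idx s = idx t \<and> M s t"])
    show "isset ?S" by (rule S)
    show "dfn (\<lambda>e. idx (e 0) \<epsilon> idx (e (Suc 0)) \<or> idx (e 0) = idx (e (Suc 0)) \<and> M (e 0) (e (Suc 0)))"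
      by (intro dfn_intros M' dfn1D[OF dfn_idx])
    show "\<not> (idx s \<epsilon> idx s \<or> idx s = idx s \<and> M s s)" for s using irr irrefl by blast
    show "idx r \<epsilon> idx t \<or> idx r = idx t \<and> M r t" if "r \<in> ?S" "s \<in> ?S" "t \<in> ?S"
      "idx r \<epsilon> idx s \<or> idx r = idx s \<and> M r s" "idx s \<epsilon> idx t \<or> idx s = idx t \<and> M s t" for r s t
      using that(4,5) N_trans[OF idx(1)[OF that(3)]] tr by metis
    show "s = t \<or> (idx s \<epsilon> idx t \<or> idx s = idx t \<and> M s t) \<or> (idx t \<epsilon> idx s \<or> idx t = idx s \<and> M t s)"
      if "s \<in> ?S" "t \<in> ?S" for s t
      using N_linear[OF idx(1)[OF that(1)] idx(1)[OF that(2)]] total[OF idx(1)[OF that(1)] idx(2)[OF that(1)], of t]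
        idx(2)[OF that(2)] by metis
    \<comment> \<open>Everything before \<open>s\<close> lies in the layers up to and including its
      own; hence \<open>suc (idx s)\<close>, a natural number being the set of the smaller
      ones.\<close>
    show "Fin {t \<in> ?S. idx t \<epsilon> idx s \<or> idx t = idx s \<and> M t s}" if s: "s \<in> ?S" for s
    proof (rule Fin_subset)
      show "Fin (\<Union>n\<in>ext (suc (idx s)). w n)"
        using idx(1)[OF s] N_subset[of "suc (idx s)"] fin
        by (intro Fin_UN w Fin_N) auto
      show "isset {t \<in> ?S. idx t \<epsilon> idx s \<or> idx t = idx s \<and> M t s}"
        by (intro isset_Collect S dfn_intros M' dfn1D[OF dfn_idx])
      show "{t \<in> ?S. idx t \<epsilon> idx s \<or> idx t = idx s \<and> M t s} \<subseteq> (\<Union>n\<in>ext (suc (idx s)). w n)"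
        using idx(2) by (fastforce simp: mem_ext)
    qed
  qed (rule inf)
qed

text \<open>Each layer is a singleton, on which the empty relation is a linear order.\<close>

lemma Dinf_range: "dfn1 u \<Longrightarrow> \<not> Fin (u ` N) \<Longrightarrow> Dinf (u ` N)"
proof -
  assume u: "dfn1 u" and inf: "\<not> Fin (u ` N)"
  have "Dinf (\<Union>n\<in>N. {u n})"
  proof (rule Dinf_layers[of _ "\<lambda>_ _. False"])
    show "dfn (\<lambda>e. e 0 \<in> {u (e (Suc 0))})" by (intro dfn_intros dfn1D[OF u])
  qed (use inf in \<open>simp_all add: UNION_singleton_eq_range dfn_const\<close>)
  then show ?thesis by (simp add: UNION_singleton_eq_range)
qed

text \<open>\<open>attempt n f\<close> constrains only the values of \<open>f\<close> at the numbers
  up to \<open>n\<close>, not its domain. Attempts exist by induction and agree up to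
  \<open>n\<close>, so the value at \<open>n\<close> has a unique description.\<close>

lemma N_recursion:
  assumes "dfn1 h"
  shows "\<exists>u. dfn1 u \<and> u zero = a \<and> (\<forall>n\<in>N. u (suc n) = h (u n))"
proof -
  define attempt where "attempt = (\<lambda>n f. app f zero = a \<and> (\<forall>m. m \<epsilon> n \<longrightarrow> app f (suc m) = h (app f m)))"
  have dfn_attempt: "dfn (\<lambda>e. attempt (e i) (e j))" for i j
    unfolding attempt_def by (intro dfn_intros dfn1D[OF assms])
  define u where "u = (\<lambda>n. the_elt (\<lambda>x. \<exists>f. attempt n f \<and> x = app f n))"
  have dfn_u: "dfn1 u" unfolding u_def by (intro dfn_intros dfn_attempt)
  have ex: "\<exists>f. attempt n f" if "n \<in> N" for n
    using that
  proof (induction n rule: N_induct)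
    case zero
    have "app (lam {zero} (\<lambda>_. a)) zero = a" by (rule app_lam) (auto intro: dfn_intros)
    then show ?case unfolding attempt_def using not_mem_zero by blast
  next
    case (suc n)
    then obtain f where f: "attempt n f" by blast
    \<comment> \<open>The attempt for \<open>n\<close> is prolonged by one value and restricted to
      the numbers up to \<open>suc n\<close>, so that it becomes an element of the model.\<close>
    let ?g = "\<lambda>m. if m = suc n then h (app f n) else app f m"
    define f' where "f' = lam (ext (suc (suc n))) ?g"
    have "dfn1 ?g" by (intro dfn_intros)
    then have f': "app f' m = ?g m" if "m \<epsilon> suc (suc n)" for m
      using that unfolding f'_def by (intro app_lam isset_ext) (simp_all only: mem_ext)
    have "app f' (suc m) = h (app f' m)" if m: "m \<epsilon> suc n" for m
    proof -
      have "m \<in> N" using m suc(1) N_mem by (metis suc_N)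
      have ne: "m \<noteq> suc n" using m irrefl by blast
      have "suc m \<epsilon> suc (suc n)" using suc_mem_suc[OF _ m] suc(1) by simp
      moreover have "m \<epsilon> suc (suc n)" using m by (simp add: mem_suc)
      ultimately have *: "app f' (suc m) = ?g (suc m)" "app f' m = app f m" using f' ne by auto
      show ?thesis
      proof (cases "m = n")
        case False
        then have "m \<epsilon> n" using m by (simp add: mem_suc)
        moreover have "suc m \<noteq> suc n" using suc_inject \<open>m \<in> N\<close> suc(1) False by blast
        ultimately show ?thesis using * f by (simp add: attempt_def)
      qed (use * in simp)
    qed
    moreover have "app f' zero = a"
      using f'[of zero] zero_mem_suc[of "suc n"] suc(1) suc_not_zero[of n] f by (simp add: attempt_def)
    ultimately show ?case unfolding attempt_def by blast
  qed (intro dfn_intros dfn_attempt)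
  have uniq: "app f n = app g n" if n: "n \<in> N" and "attempt n f" "attempt n g" for n f g
  proof -
    have "m \<in> N \<Longrightarrow> m \<epsilon> suc n \<longrightarrow> app f m = app g m" for m
    proof (induction m rule: N_induct)
      case (suc m)
      have "m \<epsilon> n" if "suc m \<epsilon> suc n"
        using that suc(1) n N_linear[of m n] by (metis N_asym mem_suc suc_N suc_mem_suc)
      then show ?case using that suc(2) unfolding attempt_def by (simp add: mem_suc)
    qed (intro dfn_intros, use that in \<open>simp add: attempt_def\<close>)
    then show ?thesis using n by (simp add: mem_suc)
  qed
  have u: "u n = app f n" if "n \<in> N" "attempt n f" for n f
    unfolding u_def by (intro the_elt_eq) (metis that, metis that uniq)
  have "u zero = a"
    using ex[of zero] u[of zero] by (auto simp: attempt_def)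
  moreover have "u (suc n) = h (u n)" if n: "n \<in> N" for n
  proof -
    obtain f where f: "attempt (suc n) f" using ex[OF suc_N[OF n]] by blast
    then have "attempt n f" unfolding attempt_def by (simp add: mem_suc)
    then show ?thesis using u[OF n] u[OF suc_N[OF n] f] f by (simp add: attempt_def mem_suc)
  qed
  ultimately show ?thesis using dfn_u by blast
qed

section \<open>Sequences of finite subsets and Dedekind-infinity\<close>

definition FinPow :: "'a set \<Rightarrow> 'a set" where
  "FinPow X = {t. ext t \<subseteq> X \<and> Fin (ext t)}"

lemma isset_FinPow: "isset X \<Longrightarrow> isset (FinPow X)"
  by (rule isset_subset[OF isset_Pow]) (auto simp: FinPow_def intro!: dfn_intros dfn_mem_isset)

text \<open>If the range of \<open>u\<close> were finite, so would be the union of its members; an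
  infinite range is Dedekind-infinite, its elements being ordered by their first index.\<close>

lemma Dinf_FinPow_if_sequence:
  assumes "dfn1 u" "\<And>n. n \<in> N \<Longrightarrow> u n \<in> FinPow X" "\<not> Fin (\<Union>n\<in>N. ext (u n))"
  shows "Dinf (FinPow X)"
proof (rule Dinf_mono)
  have "Fin (\<Union>x\<in>u ` N. ext x)" if "Fin (u ` N)"
    using that assms(2) by (intro Fin_UN dfn_intros) (auto simp: FinPow_def)
  then show "Dinf (u ` N)" using assms(3) Dinf_range[OF assms(1)] by auto
  show "isset (u ` N)" using assms(1) by (intro isset_image) auto
  show "u ` N \<subseteq> FinPow X" using assms(2) by blast
qed

text \<open>The injection \<open>h\<close> is iterated from a point \<open>a\<close> that it misses.
  If the union were finite, the iterates would form a finite set of subsets of it, which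
  \<open>h\<close> would map onto itself, thus hitting \<open>a\<close>.\<close>

lemma sequence_if_Dinf_FinPow:
  assumes "isset X" "Dinf (FinPow X)"
  shows "\<exists>u. dfn1 u \<and> (\<forall>n\<in>N. u n \<in> FinPow X) \<and> \<not> Fin (\<Union>n\<in>N. ext (u n))"
proof -
  obtain h where h: "dfn1 h" "inj_on h (FinPow X)" "h ` FinPow X \<subset> FinPow X"
    using assms(2) unfolding Dinf_def by blast
  then obtain a where a: "a \<in> FinPow X" "a \<notin> h ` FinPow X" by blast
  obtain u where u: "dfn1 u" "u zero = a" "\<And>n. n \<in> N \<Longrightarrow> u (suc n) = h (u n)"
    using N_recursion[OF h(1)] by blast
  have in_image: "u n \<in> FinPow X" if "n \<in> N" for n
    using that
  proof (induction n rule: N_induct)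
    case dfn
    show ?case by (rule dfn_mem_isset[OF isset_FinPow[OF assms(1)] u(1)])
  qed (use u(2,3) a h(3) in auto)
  have into: "h ` u ` N \<subseteq> u ` N"
  proof clarify
    fix n assume "n \<in> N"
    then show "h (u n) \<in> u ` N" using u(3)[symmetric] by simp
  qed
  have "\<not> Fin (\<Union>n\<in>N. ext (u n))"
  proof
    let ?U = "\<Union>n\<in>N. ext (u n)"
    assume "Fin ?U"
    moreover have "u ` N \<subseteq> {t. ext t \<subseteq> ?U}" by blast
    moreover have "isset (u ` N)" using u(1) by (intro isset_image) auto
    ultimately have "Fin (u ` N)" using Fin_subset[OF Fin_Pow] by blast
    moreover have "inj_on h (u ` N)" using h(2) in_image by (auto intro: inj_on_subset)
    ultimately have "h ` u ` N = u ` N" using Fin_inj_onto[OF _ h(1)] into by blast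
    moreover have "a \<in> u ` N" using u(2) zero_N by blast
    ultimately show False using a(2) in_image by blast
  qed
  then show ?thesis using u(1) in_image by blast
qed

subsection \<open>Translation of the formulas about sets and functions\<close>

abbreviation sem :: "(nat \<Rightarrow> 'a) \<Rightarrow> (var \<Rightarrow> 'a) \<Rightarrow> nat \<Rightarrow> pform \<Rightarrow> bool" where
  "sem \<equiv> psat E (=)"

text \<open>Conditions such as \<open>p < d\<close> say that a variable is bound by one of the
  \<open>d\<close> enclosing quantifiers; under them the simplifier can evaluate the updated
  assignments.\<close>

lemma sem_is_upair: "p < d \<Longrightarrow> a < d \<Longrightarrow> b < d \<Longrightarrow> sem c v d (is_upair p a b) \<longleftrightarrow> v p = Coll {v a, v b}"
  by (simp add: is_upair_def psat_simps eq_Coll_iff)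

lemma sem_is_pair: "p < d \<Longrightarrow> a < d \<Longrightarrow> b < d \<Longrightarrow> sem c v d (is_pair p a b) \<longleftrightarrow> v p = pair (v a) (v b)"
  by (simp add: is_pair_def psat_simps sem_is_upair pair_def eq_Coll_iff[of "{_, _}"])

lemma sem_pair_in: "a < d \<Longrightarrow> b < d \<Longrightarrow> f < d \<Longrightarrow> sem c v d (pair_in a b f) \<longleftrightarrow> pair (v a) (v b) \<epsilon> v f"
  by (simp add: pair_in_def psat_simps sem_is_pair)

lemma sem_subset: "A < d \<Longrightarrow> B < d \<Longrightarrow> sem c v d (A \<^bold>\<subseteq> B) \<longleftrightarrow> ext (v A) \<subseteq> ext (v B)"
  by (auto simp add: psubset_eq_def psat_simps mem_ext)

lemma sem_is_empty: "x < d \<Longrightarrow> sem c v d (is_empty x) \<longleftrightarrow> v x = zero"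
  by (simp add: is_empty_def psat_simps zero_def eq_Coll_iff)

lemma sem_is_succ: "x < d \<Longrightarrow> y < d \<Longrightarrow> sem c v d (is_succ y x) \<longleftrightarrow> v y = suc (v x)"
  by (auto simp add: is_succ_def psat_simps suc_def eq_Coll_iff mem_ext)

lemma sem_is_inductive: "w < d \<Longrightarrow> sem c v d (is_inductive w) \<longleftrightarrow> inductive_elt (v w)"
  by (simp add: is_inductive_def psat_simps sem_is_empty sem_is_succ inductive_elt_def)

lemma sem_is_omega: "w < d \<Longrightarrow> sem c v d (is_omega w) \<longleftrightarrow> ext (v w) = N"
proof -
  assume w: "w < d"
  have "inductive_elt (Coll N)" by (simp add: inductive_elt_def mem_Coll)
  moreover have "inductive_elt u \<Longrightarrow> N \<subseteq> ext u" for u by (auto simp: N_def mem_ext)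
  moreover have "inductive_elt u" if "ext u = N" for u
    using \<open>inductive_elt (Coll N)\<close> that by (metis Coll_ext)
  ultimately have "inductive_elt u \<and> (\<forall>v. inductive_elt v \<longrightarrow> ext u \<subseteq> ext v) \<longleftrightarrow> ext u = N" for u
    using ext_Coll[OF isset_N] by blast
  then show ?thesis using w by (simp add: is_omega_def psat_simps sem_is_inductive sem_subset)
qed

lemma sem_is_nat: "n < d \<Longrightarrow> sem c v d (is_nat n) \<longleftrightarrow> v n \<in> N"
proof -
  have "(\<exists>w. ext w = N \<and> x \<epsilon> w) \<longleftrightarrow> x \<in> N" for x
    using ext_Coll[OF isset_N] mem_ext by metis
  then show "n < d \<Longrightarrow> sem c v d (is_nat n) \<longleftrightarrow> v n \<in> N"
    by (simp add: is_nat_def psat_simps sem_is_omega)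
qed

definition Times :: "'a set \<Rightarrow> 'a set \<Rightarrow> 'a set" where
  "Times A B = {pair a b | a b. a \<in> A \<and> b \<in> B}"

lemma sem_is_Times: "P < d \<Longrightarrow> A < d \<Longrightarrow> B < d \<Longrightarrow>
    sem c v d (is_Times P A B) \<longleftrightarrow> ext (v P) = Times (ext (v A)) (ext (v B))"
  by (simp add: is_Times_def psat_simps sem_is_pair Times_def ext_def set_eq_iff) blast

lemma sem_is_Un: "C < d \<Longrightarrow> A < d \<Longrightarrow> B < d \<Longrightarrow> sem c v d (is_Un C A B) \<longleftrightarrow> ext (v C) = ext (v A) \<union> ext (v B)"
  by (auto simp add: is_Un_def psat_simps ext_def)

lemma sem_is_Int: "C < d \<Longrightarrow> A < d \<Longrightarrow> B < d \<Longrightarrow> sem c v d (is_Int C A B) \<longleftrightarrow> ext (v C) = ext (v A) \<inter> ext (v B)"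
  by (auto simp add: is_Int_def psat_simps ext_def)

lemma sem_is_Diff: "C < d \<Longrightarrow> A < d \<Longrightarrow> B < d \<Longrightarrow> sem c v d (is_Diff C A B) \<longleftrightarrow> ext (v C) = ext (v A) - ext (v B)"
  by (auto simp add: is_Diff_def psat_simps ext_def)

lemma sem_is_Union: "U < d \<Longrightarrow> S < d \<Longrightarrow> sem c v d (is_Union U S) \<longleftrightarrow> ext (v U) = (\<Union>A\<in>ext (v S). ext A)"
  by (auto simp add: is_Union_def psat_simps ext_def)

lemma sem_disjoint: "A < d \<Longrightarrow> B < d \<Longrightarrow> sem c v d (disjoint A B) \<longleftrightarrow> ext (v A) \<inter> ext (v B) = {}"
  by (auto simp add: disjoint_def psat_simps ext_def)

text \<open>Connects functions given by application with functions as sets of pairs, which is how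
  the formulas describe them.\<close>

lemma isfun_iff:
  "isfun f A B \<longleftrightarrow> (\<forall>p. p \<epsilon> f \<longrightarrow> (\<exists>a b. a \<in> ext A \<and> b \<in> ext B \<and> p = pair a b)) \<and>
     (\<forall>a\<in>ext A. \<exists>b. pair a b \<epsilon> f) \<and> (\<forall>a b c. pair a b \<epsilon> f \<and> pair a c \<epsilon> f \<longrightarrow> b = c)"
    (is "_ \<longleftrightarrow> ?P \<and> ?Q \<and> ?R")
proof (rule iffI)
  assume f: "isfun f A B"
  then have "f = Coll ((\<lambda>x. pair x (app f x)) ` ext A)" unfolding isfun_def lam_def by (rule conjunct2)
  from arg_cong[OF this, of ext] have ext_f: "ext f = (\<lambda>x. pair x (app f x)) ` ext A"
    by (simp only: ext_Coll[OF isset_lam[OF isset_ext dfn1_app]])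
  have ?P
  proof (intro allI impI)
    fix p assume "p \<epsilon> f"
    then obtain a where "a \<in> ext A" "p = pair a (app f a)" using ext_f mem_ext by blast
    then show "\<exists>a b. a \<in> ext A \<and> b \<in> ext B \<and> p = pair a b" using isfunD[OF f] by blast
  qed
  moreover have ?Q ?R by (simp_all add: mem_isfun[OF f])
  ultimately show "?P \<and> ?Q \<and> ?R" by (intro conjI)
next
  assume PQR: "?P \<and> ?Q \<and> ?R"
  have app: "app f a = b" if "pair a b \<epsilon> f" for a b
    unfolding app_def
  proof (rule the_elt_eq)
    show "x = b" if "pair a x \<epsilon> f" for x using PQR \<open>pair a b \<epsilon> f\<close> that by blast
  qed (rule that)
  have P: "\<exists>a\<in>ext A. \<exists>b\<in>ext B. p = pair a b" if "p \<epsilon> f" for p using PQR that by blast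
  have Q: "pair a (app f a) \<epsilon> f" if "a \<in> ext A" for a
  proof -
    obtain b where "pair a b \<epsilon> f" using PQR \<open>a \<in> ext A\<close> by blast
    then show ?thesis using app by simp
  qed
  have into: "app f a \<in> ext B" if "a \<in> ext A" for a
  proof -
    obtain a' b where "b \<in> ext B" "pair a (app f a) = pair a' b" using P[OF Q[OF \<open>a \<in> ext A\<close>]] by blast
    then show ?thesis by auto
  qed
  have "x \<epsilon> f \<longleftrightarrow> x \<in> (\<lambda>x. pair x (app f x)) ` ext A" for x
  proof (rule iffI)
    assume x: "x \<epsilon> f"
    then obtain a b where "a \<in> ext A" "x = pair a b" using P by blast
    moreover have "app f a = b" using app x \<open>x = pair a b\<close> by simp
    ultimately show "x \<in> (\<lambda>x. pair x (app f x)) ` ext A" by blast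
  next
    assume "x \<in> (\<lambda>x. pair x (app f x)) ` ext A"
    then show "x \<epsilon> f" using Q by blast
  qed
  then have "f = lam (ext A) (app f)"
    unfolding lam_def eq_Coll_iff[OF isset_lam[OF isset_ext dfn1_app]] by blast
  then show "isfun f A B" unfolding isfun_def using into by blast
qed

lemma sem_is_function: "f < d \<Longrightarrow> A < d \<Longrightarrow> B < d \<Longrightarrow> sem c v d (is_function f A B) \<longleftrightarrow> isfun (v f) (v A) (v B)"
  by (simp add: is_function_def psat_simps sem_is_pair sem_pair_in isfun_iff mem_ext Ball_def)

lemma sem_is_bijection: "f < d \<Longrightarrow> A < d \<Longrightarrow> B < d \<Longrightarrow>
    sem c v d (is_bijection f A B) \<longleftrightarrow> isfun (v f) (v A) (v B) \<and> bij_betw (app (v f)) (ext (v A)) (ext (v B))"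
proof -
  have "isfun f A B \<Longrightarrow> (\<forall>a b c. pair a c \<epsilon> f \<and> pair b c \<epsilon> f \<longrightarrow> a = b) \<and> (\<forall>b. b \<epsilon> B \<longrightarrow> (\<exists>a. pair a b \<epsilon> f))
      \<longleftrightarrow> bij_betw (app f) (ext A) (ext B)" for f A B
  proof -
    assume f: "isfun f A B"
    show ?thesis
      unfolding bij_betw_def inj_on_def mem_isfun[OF f] using isfunD[OF f] mem_ext[of _ B] by blast
  qed
  then show "f < d \<Longrightarrow> A < d \<Longrightarrow> B < d \<Longrightarrow> ?thesis"
    by (simp add: is_bijection_def psat_simps sem_is_function sem_pair_in) blast
qed

lemma eqpoll_ext_iff: "ext A \<approx> ext B \<longleftrightarrow> (\<exists>f. isfun f A B \<and> bij_betw (app f) (ext A) (ext B))"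
proof
  assume "ext A \<approx> ext B"
  then obtain g where g: "dfn1 g" "bij_betw g (ext A) (ext B)" unfolding eqpoll_def by blast
  then have "isfun (lam (ext A) g) A B" by (intro isfun_lam) (auto simp: bij_betw_def)
  moreover have "bij_betw (app (lam (ext A) g)) (ext A) (ext B)"
    using g by (subst bij_betw_cong[of _ _ g]) auto
  ultimately show "\<exists>f. isfun f A B \<and> bij_betw (app f) (ext A) (ext B)" by blast
next
  assume "\<exists>f. isfun f A B \<and> bij_betw (app f) (ext A) (ext B)"
  then show "ext A \<approx> ext B" using eqpollI[OF dfn1_app] by blast
qed

lemma sem_equipotent: "A < d \<Longrightarrow> B < d \<Longrightarrow> sem c v d (equipotent A B) \<longleftrightarrow> ext (v A) \<approx> ext (v B)"
  by (simp add: equipotent_def psat_simps sem_is_bijection eqpoll_ext_iff)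

lemma sem_is_finite: "A < d \<Longrightarrow> sem c v d (is_finite A) \<longleftrightarrow> Fin (ext (v A))"
  by (auto simp add: is_finite_def psat_simps sem_is_nat sem_equipotent Fin_def)

lemma sem_Dedekind_infinite: "A < d \<Longrightarrow> sem c v d (Dedekind_infinite A) \<longleftrightarrow> Dinf (ext (v A))"
proof -
  have "(\<exists>B. ext B \<subseteq> ext A \<and> B \<noteq> A \<and> ext A \<approx> ext B) \<longleftrightarrow> Dinf (ext A)" for A
  proof
    assume "\<exists>B. ext B \<subseteq> ext A \<and> B \<noteq> A \<and> ext A \<approx> ext B"
    then obtain B g where "ext B \<subset> ext A" "dfn1 g" "bij_betw g (ext A) (ext B)"
      unfolding eqpoll_def using ext_inject by blast
    then show "Dinf (ext A)" unfolding Dinf_def bij_betw_def by blast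
  next
    assume "Dinf (ext A)"
    then obtain g where g: "dfn1 g" "inj_on g (ext A)" "g ` ext A \<subset> ext A" unfolding Dinf_def by blast
    then have "ext (Coll (g ` ext A)) = g ` ext A" by (intro ext_Coll isset_image) auto
    with g show "\<exists>B. ext B \<subseteq> ext A \<and> B \<noteq> A \<and> ext A \<approx> ext B"
      using eqpoll_image[OF g(1,2)] by (intro exI[of _ "Coll (g ` ext A)"]) auto
  qed
  then show "A < d \<Longrightarrow> ?thesis"
    by (simp add: Dedekind_infinite_def psat_simps sem_subset sem_equipotent)
qed

lemma sem_is_Fin: "F < d \<Longrightarrow> X < d \<Longrightarrow> sem c v d (is_Fin F X) \<longleftrightarrow> ext (v F) = FinPow (ext (v X))"
  by (auto simp add: is_Fin_def psat_simps sem_subset sem_is_finite FinPow_def set_eq_iff mem_ext)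

lemma sem_quasi_Dedekind_infinite:
  "X < d \<Longrightarrow> sem c v d (quasi_Dedekind_infinite X) \<longleftrightarrow> Dinf (FinPow (ext (v X)))"
proof -
  have "(\<exists>F. ext F = FinPow (ext X) \<and> Dinf (ext F)) \<longleftrightarrow> Dinf (FinPow (ext X))" for X
    using ext_Coll[OF isset_FinPow[OF isset_ext]] by metis
  then show "X < d \<Longrightarrow> ?thesis"
    by (simp add: quasi_Dedekind_infinite_def psat_simps sem_is_Fin sem_Dedekind_infinite)
qed

lemma sem_IQDI: "sem c v d IQDI \<longleftrightarrow> (\<forall>X. \<not> Fin (ext X) \<longrightarrow> Dinf (FinPow (ext X)))"
  by (simp add: IQDI_def psat_simps sem_is_finite sem_quasi_Dedekind_infinite)

subsection \<open>Arithmetic\<close>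

lemma mem_Times [simp]: "pair a b \<in> Times A B \<longleftrightarrow> a \<in> A \<and> b \<in> B"
  by (auto simp: Times_def)

lemma isset_Times [simp]:
  assumes "isset A" "isset B"
  shows "isset (Times A B)"
proof -
  have "isset (\<Union>a\<in>A. (\<lambda>b. pair a b) ` B)"
    by (intro isset_UN assms isset_image dfn_intros dfn_mem_isset)
  moreover have "(\<Union>a\<in>A. (\<lambda>b. pair a b) ` B) = Times A B" by (auto simp: Times_def)
  ultimately show ?thesis by simp
qed

lemma dfn_mem_Times [dfn_intros]:
  assumes "dfnt t" "dfn (\<lambda>e. e 0 \<in> A (\<lambda>i. e (Suc i)))" "dfn (\<lambda>e. e 0 \<in> B (\<lambda>i. e (Suc i)))"
  shows "dfn (\<lambda>e. t e \<in> Times (A e) (B e))"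
  unfolding Times_def
  by (intro dfn_intros dfnt_subst[OF assms(1)] trm_proj
      dfn_shift[where R = "\<lambda>e x. x \<in> A e", OF assms(2)] dfn_shift[where R = "\<lambda>e x. x \<in> B e", OF assms(3)])

lemma dfn_eqpoll_ext [dfn_intros]:
  assumes "dfnt t" "dfn (\<lambda>e. e 0 \<in> T (\<lambda>i. e (Suc i)))"
  shows "dfn (\<lambda>e. ext (t e) \<approx> T e)"
  unfolding eqpoll_iff[OF isset_ext] bij_betw_def
  by (intro dfn_intros dfnt_subst[OF assms(1)] trm_proj dfn_shift[where R = "\<lambda>e x. x \<in> T e", OF assms(2)])

definition isplus :: "'a \<Rightarrow> 'a \<Rightarrow> 'a \<Rightarrow> bool" where
  "isplus k m n \<longleftrightarrow> k \<in> N \<and> (\<exists>A B. ext A \<approx> ext m \<and> ext B \<approx> ext n \<and> ext A \<inter> ext B = {} \<and>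
     ext k \<approx> ext A \<union> ext B)"

definition istimes :: "'a \<Rightarrow> 'a \<Rightarrow> 'a \<Rightarrow> bool" where
  "istimes k m n \<longleftrightarrow> k \<in> N \<and> ext k \<approx> Times (ext m) (ext n)"

lemma sem_is_plus: "k < d \<Longrightarrow> m < d \<Longrightarrow> n < d \<Longrightarrow> sem c v d (is_plus k m n) \<longleftrightarrow> isplus (v k) (v m) (v n)"
proof -
  have "(\<exists>C. ext C = ext A \<union> ext B \<and> P (ext C)) \<longleftrightarrow> P (ext A \<union> ext B)" for P A B
    using ext_Coll[of "ext A \<union> ext B"] by (metis isset_Un isset_ext)
  then show "k < d \<Longrightarrow> m < d \<Longrightarrow> n < d \<Longrightarrow> ?thesis"
    by (simp add: is_plus_def psat_simps sem_is_nat sem_equipotent sem_disjoint sem_is_Un isplus_def)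
qed

lemma sem_is_times: "k < d \<Longrightarrow> m < d \<Longrightarrow> n < d \<Longrightarrow> sem c v d (is_times k m n) \<longleftrightarrow> istimes (v k) (v m) (v n)"
proof -
  have "(\<exists>C. ext C = Times (ext A) (ext B) \<and> P (ext C)) \<longleftrightarrow> P (Times (ext A) (ext B))" for P A B
    using ext_Coll[of "Times (ext A) (ext B)"] by (metis isset_Times isset_ext)
  then show "k < d \<Longrightarrow> m < d \<Longrightarrow> n < d \<Longrightarrow> ?thesis"
    by (simp add: is_times_def psat_simps sem_is_nat sem_equipotent sem_is_Times istimes_def)
qed

text \<open>Arguments outside \<open>N\<close> are read as zero, so that the algebraic laws hold without side
  conditions.\<close>

definition nn :: "'a \<Rightarrow> 'a" where "nn x = (if x \<in> N then x else zero)"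

definition add :: "'a \<Rightarrow> 'a \<Rightarrow> 'a" (infixl "\<oplus>" 65) where
  "m \<oplus> n = the_elt (\<lambda>k. isplus k (nn m) (nn n))"

definition mul :: "'a \<Rightarrow> 'a \<Rightarrow> 'a" (infixl "\<otimes>" 70) where
  "m \<otimes> n = the_elt (\<lambda>k. istimes k (nn m) (nn n))"

definition lt :: "'a \<Rightarrow> 'a \<Rightarrow> bool" (infix "\<prec>" 50) where
  "m \<prec> n \<longleftrightarrow> nn m \<epsilon> nn n"

lemma nn_N [simp]: "nn x \<in> N" and nn_id [simp]: "x \<in> N \<Longrightarrow> nn x = x"
  by (auto simp: nn_def)

lemma nn_add [simp]: "nn m \<oplus> n = m \<oplus> n" "m \<oplus> nn n = m \<oplus> n"
  and nn_mul [simp]: "nn m \<otimes> n = m \<otimes> n" "m \<otimes> nn n = m \<otimes> n"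
  and nn_lt [simp]: "nn m \<prec> n \<longleftrightarrow> m \<prec> n" "m \<prec> nn n \<longleftrightarrow> m \<prec> n"
  by (simp_all add: add_def mul_def lt_def)

lemma dfnt_nn [dfn_intros]: "dfnt t \<Longrightarrow> dfnt (\<lambda>e. nn (t e))"
  unfolding nn_def by (intro dfn_intros)

lemma dfnt_add [dfn_intros]: "dfnt t \<Longrightarrow> dfnt u \<Longrightarrow> dfnt (\<lambda>e. t e \<oplus> u e)"
proof (rule dfnt_lift2[where f = add and t = t and u = u])
  show "dfn (\<lambda>e. e 0 = e (Suc 0) \<oplus> e (Suc (Suc 0)))"
    unfolding add_def isplus_def by (intro dfn_intros)
qed

lemma dfnt_mul [dfn_intros]: "dfnt t \<Longrightarrow> dfnt u \<Longrightarrow> dfnt (\<lambda>e. t e \<otimes> u e)"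
proof (rule dfnt_lift2[where f = mul and t = t and u = u])
  show "dfn (\<lambda>e. e 0 = e (Suc 0) \<otimes> e (Suc (Suc 0)))"
    unfolding mul_def istimes_def by (intro dfn_intros)
qed

lemma isplus_zero: "m \<in> N \<Longrightarrow> isplus m m zero"
proof -
  have "ext m \<approx> ext m \<and> ext zero \<approx> ext zero \<and> ext m \<inter> ext zero = {} \<and> ext m \<approx> ext m \<union> ext zero"
    by (simp add: eqpoll_refl)
  then show "m \<in> N \<Longrightarrow> isplus m m zero" unfolding isplus_def by blast
qed

lemma isplus_suc:
  assumes "isplus k m n"
  shows "isplus (suc k) m (suc n)"
proof -
  obtain A B where AB: "k \<in> N" "ext A \<approx> ext m" "ext B \<approx> ext n" "ext A \<inter> ext B = {}" "ext k \<approx> ext A \<union> ext B"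
    using assms unfolding isplus_def by blast
  obtain x where x: "x \<notin> ext A \<union> ext B" using ex_fresh[of "ext A \<union> ext B"] by auto
  have "ext (Coll (insert x (ext B))) \<approx> ext (suc n)"
    using eqpoll_insert[OF isset_ext AB(3)] x not_mem_ext_self by (simp add: ext_Coll)
  moreover have "ext (suc k) \<approx> ext A \<union> ext (Coll (insert x (ext B)))"
    using eqpoll_insert[OF isset_ext AB(5) not_mem_ext_self x] by (simp add: ext_Coll)
  moreover have "ext A \<inter> ext (Coll (insert x (ext B))) = {}" using AB(4) x by (auto simp: ext_Coll)
  ultimately have "\<exists>B'. ext A \<approx> ext m \<and> ext B' \<approx> ext (suc n) \<and> ext A \<inter> ext B' = {} \<and> ext (suc k) \<approx> ext A \<union> ext B'"
    using AB(2) by (intro exI[of _ "Coll (insert x (ext B))"] conjI)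
  then show ?thesis unfolding isplus_def using suc_N[OF AB(1)] by blast
qed

text \<open>The union of disjoint copies of the summands has the same size whichever copies are
  taken, and equipotent natural numbers are equal.\<close>

lemma isplus_unique:
  assumes "isplus k m n" "isplus k' m n"
  shows "k = k'"
proof -
  obtain A B where AB: "k \<in> N" "ext A \<approx> ext m" "ext B \<approx> ext n" "ext A \<inter> ext B = {}" "ext k \<approx> ext A \<union> ext B"
    using assms unfolding isplus_def by blast
  obtain A' B' where AB': "k' \<in> N" "ext A' \<approx> ext m" "ext B' \<approx> ext n" "ext A' \<inter> ext B' = {}" "ext k' \<approx> ext A' \<union> ext B'"
    using assms unfolding isplus_def by blast
  have "ext A \<approx> ext A'" "ext B \<approx> ext B'" using AB AB' eqpoll_sym eqpoll_trans isset_ext by blast+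
  then have "ext A \<union> ext B \<approx> ext A' \<union> ext B'"
    using AB(4) AB'(4) by (intro eqpoll_disjoint_Un) auto
  then have "ext k \<approx> ext k'" using AB(5) AB'(5) eqpoll_sym eqpoll_trans isset_ext by blast
  then show ?thesis using eqpoll_N_unique AB(1) AB'(1) by blast
qed

lemma isplus_add:
  assumes "m \<in> N" "n \<in> N"
  shows "isplus k m n \<longleftrightarrow> k = m \<oplus> n"
proof -
  have "\<exists>k. isplus k m n"
    using assms(2)
  proof (induction n rule: N_induct)
    case dfn
    show ?case unfolding isplus_def by (intro dfn_intros)
  next
    case zero
    show ?case using assms(1) isplus_zero by blast
  next
    case (suc n)
    then show ?case using assms(1) isplus_suc by blast
  qed
  then obtain k' where k': "isplus k' m n" by blast
  then have "m \<oplus> n = k'" unfolding add_def using assms isplus_unique by (intro the_elt_eq) auto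
  then show ?thesis using k' isplus_unique by blast
qed

lemma add_N [simp]: "m \<oplus> n \<in> N"
  using isplus_add[of "nn m" "nn n" "m \<oplus> n"] by (simp add: isplus_def)

lemma add_zero: "m \<in> N \<Longrightarrow> m \<oplus> zero = m"
  using isplus_add[OF _ zero_N, of m m] isplus_zero[of m] by simp

lemma add_suc: "m \<in> N \<Longrightarrow> n \<in> N \<Longrightarrow> m \<oplus> suc n = suc (m \<oplus> n)"
  using isplus_add[of m n "m \<oplus> n"] isplus_add[of m "suc n" "suc (m \<oplus> n)"] isplus_suc[of "m \<oplus> n" m n]
  by simp

lemma istimes_zero: "istimes zero m zero"
  unfolding istimes_def using eqpoll_refl[of "{}"] by (simp add: Times_def)

lemma istimes_suc:
  assumes "istimes k m n" "m \<in> N"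
  shows "istimes (k \<oplus> m) m (suc n)"
proof -
  have k: "k \<in> N" "ext k \<approx> Times (ext m) (ext n)" using assms(1) unfolding istimes_def by auto
  let ?B = "(\<lambda>x. pair x n) ` ext m"
  have dfn: "dfn1 (\<lambda>x. pair x n)" by (intro dfn_intros)
  then have "ext m \<approx> ?B" by (rule eqpoll_image) (simp add: inj_on_def)
  obtain A B where AB: "ext A \<approx> ext k" "ext B \<approx> ext m" "ext A \<inter> ext B = {}" "ext (k \<oplus> m) \<approx> ext A \<union> ext B"
    using isplus_add[OF k(1) assms(2), of "k \<oplus> m"] unfolding isplus_def by blast
  have "Times (ext m) (ext n) \<inter> ?B = {}" using not_mem_ext_self[of n] by (auto simp: Times_def)
  then have "ext A \<union> ext B \<approx> Times (ext m) (ext n) \<union> ?B"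
    by (rule eqpoll_disjoint_Un[OF isset_ext eqpoll_trans[OF AB(1) k(2)]
          eqpoll_trans[OF AB(2) \<open>ext m \<approx> ?B\<close>] AB(3)])
  moreover have "Times (ext m) (ext n) \<union> ?B = Times (ext m) (ext (suc n))" by (auto simp: Times_def)
  ultimately have "ext (k \<oplus> m) \<approx> Times (ext m) (ext (suc n))" using eqpoll_trans[OF AB(4)] by simp
  then show ?thesis unfolding istimes_def by simp
qed

lemma istimes_mul:
  assumes "m \<in> N" "n \<in> N"
  shows "istimes k m n \<longleftrightarrow> k = m \<otimes> n"
proof -
  have unique: "k = k'" if "istimes k m n" "istimes k' m n" for k k'
    using that eqpoll_N_unique[of k k'] eqpoll_trans[OF _ eqpoll_sym[OF isset_ext], of "ext k" _ k']
    unfolding istimes_def by blast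
  have "\<exists>k. istimes k m n"
    using assms(2)
  proof (induction n rule: N_induct)
    case dfn
    show ?case unfolding istimes_def by (intro dfn_intros)
  next
    case zero
    show ?case using assms(1) istimes_zero by blast
  next
    case (suc n)
    then show ?case using assms(1) istimes_suc by blast
  qed
  then obtain k' where k': "istimes k' m n" by blast
  then have "m \<otimes> n = k'" unfolding mul_def using assms unique by (intro the_elt_eq) auto
  then show ?thesis using k' unique by blast
qed

lemma mul_N [simp]: "m \<otimes> n \<in> N"
  using istimes_mul[of "nn m" "nn n" "m \<otimes> n"] by (simp add: istimes_def)

lemma mul_zero: "m \<in> N \<Longrightarrow> m \<otimes> zero = zero"
  using istimes_mul[OF _ zero_N, of m zero] istimes_zero[of m] by simp

lemma mul_suc: "m \<in> N \<Longrightarrow> n \<in> N \<Longrightarrow> m \<otimes> suc n = m \<otimes> n \<oplus> m"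
  using istimes_mul[of m n "m \<otimes> n"] istimes_mul[of m "suc n" "m \<otimes> n \<oplus> m"] istimes_suc[of "m \<otimes> n" m n]
  by simp

section \<open>Laws of addition and multiplication\<close>

lemma add_zero_left: "m \<in> N \<Longrightarrow> zero \<oplus> m = m"
  by (induction m rule: N_induct) (intro dfn_intros, simp_all add: add_zero add_suc)

lemma add_suc_left: "n \<in> N \<Longrightarrow> m \<in> N \<Longrightarrow> suc m \<oplus> n = suc (m \<oplus> n)"
  by (induction n rule: N_induct) (intro dfn_intros, simp_all add: add_zero add_suc)

lemma add_commute: "m \<oplus> n = n \<oplus> m"
proof -
  have "n \<in> N \<Longrightarrow> m \<in> N \<Longrightarrow> m \<oplus> n = n \<oplus> m" for m n
    by (induction n rule: N_induct) (intro dfn_intros, simp_all add: add_zero add_suc add_zero_left add_suc_left)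
  from this[of "nn n" "nn m"] show ?thesis by simp
qed

lemma add_assoc: "(k \<oplus> m) \<oplus> n = k \<oplus> (m \<oplus> n)"
proof -
  have "n \<in> N \<Longrightarrow> k \<in> N \<Longrightarrow> m \<in> N \<Longrightarrow> (k \<oplus> m) \<oplus> n = k \<oplus> (m \<oplus> n)" for k m n
    by (induction n rule: N_induct) (intro dfn_intros, simp_all add: add_zero add_suc)
  from this[of "nn n" "nn k" "nn m"] show ?thesis by simp
qed

lemma add_left_commute: "k \<oplus> (m \<oplus> n) = m \<oplus> (k \<oplus> n)"
  unfolding add_assoc[symmetric] add_commute[of k m] by (rule refl)

lemma mul_zero_left: "m \<in> N \<Longrightarrow> zero \<otimes> m = zero"
  by (induction m rule: N_induct) (intro dfn_intros, simp_all add: mul_zero mul_suc add_zero)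

lemma mul_suc_left: "n \<in> N \<Longrightarrow> m \<in> N \<Longrightarrow> suc m \<otimes> n = m \<otimes> n \<oplus> n"
proof (induction n rule: N_induct)
  case (suc n)
  then show ?case by (simp add: mul_suc add_suc) (simp add: add_assoc add_commute[of n])
qed (intro dfn_intros, simp_all add: mul_zero add_zero)

lemma mul_commute: "m \<otimes> n = n \<otimes> m"
proof -
  have "n \<in> N \<Longrightarrow> m \<in> N \<Longrightarrow> m \<otimes> n = n \<otimes> m" for m n
    by (induction n rule: N_induct) (intro dfn_intros, simp_all add: mul_zero mul_suc mul_zero_left mul_suc_left)
  from this[of "nn n" "nn m"] show ?thesis by simp
qed

lemma mul_add: "k \<otimes> (m \<oplus> n) = k \<otimes> m \<oplus> k \<otimes> n"
proof -
  have "n \<in> N \<Longrightarrow> k \<in> N \<Longrightarrow> m \<in> N \<Longrightarrow> k \<otimes> (m \<oplus> n) = k \<otimes> m \<oplus> k \<otimes> n" for k m n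
    by (induction n rule: N_induct) (intro dfn_intros, simp_all add: add_zero add_suc mul_zero mul_suc add_assoc)
  from this[of "nn n" "nn k" "nn m"] show ?thesis by simp
qed

lemma mul_add_left: "(m \<oplus> n) \<otimes> k = m \<otimes> k \<oplus> n \<otimes> k"
  by (simp add: mul_commute[of _ k] mul_add)

lemma mul_assoc: "(k \<otimes> m) \<otimes> n = k \<otimes> (m \<otimes> n)"
proof -
  have "n \<in> N \<Longrightarrow> k \<in> N \<Longrightarrow> m \<in> N \<Longrightarrow> (k \<otimes> m) \<otimes> n = k \<otimes> (m \<otimes> n)" for k m n
    by (induction n rule: N_induct) (intro dfn_intros, simp_all add: mul_zero mul_suc mul_add)
  from this[of "nn n" "nn k" "nn m"] show ?thesis by simp
qed

lemma mul_left_commute: "k \<otimes> (m \<otimes> n) = m \<otimes> (k \<otimes> n)"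
  unfolding mul_assoc[symmetric] mul_commute[of k m] by (rule refl)

lemmas arith_simps = mul_add mul_add_left add_assoc add_commute add_left_commute
  mul_assoc mul_commute mul_left_commute

section \<open>The order of the natural numbers\<close>

lemma lt_irrefl: "\<not> m \<prec> m"
  by (simp add: lt_def irrefl)

lemma lt_trans: "k \<prec> m \<Longrightarrow> m \<prec> n \<Longrightarrow> k \<prec> n"
  unfolding lt_def using N_trans[OF nn_N] by blast

lemma lt_linear: "m \<in> N \<Longrightarrow> n \<in> N \<Longrightarrow> m \<prec> n \<or> m = n \<or> n \<prec> m"
  using N_linear by (simp add: lt_def)

lemma suc_mem_suc_iff: "m \<in> N \<Longrightarrow> n \<in> N \<Longrightarrow> suc m \<epsilon> suc n \<longleftrightarrow> m \<epsilon> n"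
  using suc_mem_suc[of m n] suc_mem_suc[of n m] N_linear[of m n] N_asym[of "suc m" "suc n"] irrefl[of "suc m"]
  by (metis suc_mem_suc suc_N)

lemma lt_add_cancel: "m \<oplus> k \<prec> n \<oplus> k \<longleftrightarrow> m \<prec> n"
proof -
  have "k \<in> N \<Longrightarrow> m \<in> N \<Longrightarrow> n \<in> N \<Longrightarrow> m \<oplus> k \<epsilon> n \<oplus> k \<longleftrightarrow> m \<epsilon> n" for k m n
    by (induction k rule: N_induct) (intro dfn_intros, simp_all add: add_zero add_suc suc_mem_suc_iff)
  from this[of "nn k" "nn m" "nn n"] show ?thesis by (simp add: lt_def)
qed

lemma lt_add_mono: "k \<prec> m \<Longrightarrow> k' \<prec> m' \<Longrightarrow> k \<oplus> k' \<prec> m \<oplus> m'"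
  using lt_trans[of "k \<oplus> k'" "m \<oplus> k'" "m \<oplus> m'"] lt_add_cancel[of k k' m] lt_add_cancel[of k' m m']
  by (simp add: add_commute)

lemma lt_mul_mono:
  assumes "m \<prec> n" "k \<in> N" "k \<noteq> zero"
  shows "m \<otimes> k \<prec> n \<otimes> k"
proof -
  \<comment> \<open>The factor runs through the successors, which leaves out zero.\<close>
  have "j \<in> N \<Longrightarrow> nn m \<otimes> suc j \<prec> nn n \<otimes> suc j" for j
  proof (induction j rule: N_induct)
    case dfn
    show ?case unfolding lt_def by (intro dfn_intros)
  next
    case zero
    have "nn x \<otimes> suc zero = nn x" for x
      by (simp only: mul_suc[OF nn_N zero_N] mul_zero[OF nn_N] add_zero_left[OF nn_N])
    then show ?case using assms(1) by (simp only: nn_lt)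
  next
    case (suc j)
    have "nn m \<prec> nn n" using assms(1) by simp
    then have "nn m \<otimes> suc j \<oplus> nn m \<prec> nn n \<otimes> suc j \<oplus> nn n" by (rule lt_add_mono[OF suc(2)])
    then show ?case using suc(1) by (simp only: mul_suc[of _ "suc j"] nn_N suc_N)
  qed
  moreover obtain j where "j \<in> N" "k = suc j" using N_cases assms by blast
  ultimately show ?thesis by simp
qed

lemma lt_mul_cancel:
  assumes k: "k \<in> N" "k \<noteq> zero"
  shows "m \<otimes> k \<prec> n \<otimes> k \<longleftrightarrow> m \<prec> n"
proof (rule iffI)
  assume "m \<prec> n"
  then show "m \<otimes> k \<prec> n \<otimes> k" by (rule lt_mul_mono[OF _ k])
next
  assume less: "m \<otimes> k \<prec> n \<otimes> k"
  have "\<not> n \<prec> m"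
  proof (rule notI)
    assume "n \<prec> m"
    then have "n \<otimes> k \<prec> m \<otimes> k" by (rule lt_mul_mono[OF _ k])
    then have "n \<otimes> k \<prec> n \<otimes> k" using less by (rule lt_trans)
    then show False by (rule notE[OF lt_irrefl])
  qed
  moreover have "nn m \<noteq> nn n"
  proof (rule notI)
    assume "nn m = nn n"
    then have "m \<otimes> k = n \<otimes> k" unfolding mul_def by (simp only:)
    then show False using less lt_irrefl by simp
  qed
  ultimately show "m \<prec> n" using N_linear[OF nn_N nn_N, of m n] unfolding lt_def by blast
qed

subsection \<open>Fractions\<close>

definition one :: 'a where "one = suc zero"

lemma one_N [simp]: "one \<in> N" and one_not_zero: "one \<noteq> zero"
  by (simp_all add: one_def suc_not_zero)

lemma mul_one: "m \<in> N \<Longrightarrow> m \<otimes> one = m"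
  by (simp add: one_def mul_suc mul_zero add_zero_left)

lemma mul_not_zero: "m \<in> N \<Longrightarrow> n \<in> N \<Longrightarrow> m \<noteq> zero \<Longrightarrow> n \<noteq> zero \<Longrightarrow> m \<otimes> n \<noteq> zero"
  using N_cases[of m] N_cases[of n] suc_not_zero by (auto simp: mul_suc add_suc)

lemma add_not_zero: "m \<in> N \<Longrightarrow> n \<in> N \<Longrightarrow> n \<noteq> zero \<Longrightarrow> m \<oplus> n \<noteq> zero"
  using N_cases[of n] suc_not_zero by (auto simp: add_suc)

lemma zero_lt: "n \<in> N \<Longrightarrow> n \<noteq> zero \<Longrightarrow> zero \<prec> n"
  using lt_linear[of zero n] not_mem_zero by (auto simp: lt_def)

definition frac :: "'a \<Rightarrow> 'a \<Rightarrow> 'a \<Rightarrow> 'a" where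
  "frac a b c = pair (pair a b) c"

definition Rat :: "'a set" where
  "Rat = {frac a b c | a b c. a \<in> N \<and> b \<in> N \<and> c \<in> N \<and> c \<noteq> zero}"

definition rless :: "'a \<Rightarrow> 'a \<Rightarrow> bool" where
  "rless p q \<longleftrightarrow> (\<exists>a b c a' b' c'. a \<in> N \<and> b \<in> N \<and> c \<in> N \<and> c \<noteq> zero \<and> p = frac a b c \<and>
     a' \<in> N \<and> b' \<in> N \<and> c' \<in> N \<and> c' \<noteq> zero \<and> q = frac a' b' c' \<and>
     a \<otimes> c' \<oplus> b' \<otimes> c \<prec> a' \<otimes> c \<oplus> b \<otimes> c')"

lemma frac_inject [simp]: "frac a b c = frac a' b' c' \<longleftrightarrow> a = a' \<and> b = b' \<and> c = c'"
  by (auto simp: frac_def)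

lemma dfnt_frac [dfn_intros]: "dfnt t \<Longrightarrow> dfnt u \<Longrightarrow> dfnt w \<Longrightarrow> dfnt (\<lambda>e. frac (t e) (u e) (w e))"
  unfolding frac_def by (intro dfn_intros)

lemma Rat_cases: "q \<in> Rat \<Longrightarrow>
    (\<And>a b c. q = frac a b c \<Longrightarrow> a \<in> N \<Longrightarrow> b \<in> N \<Longrightarrow> c \<in> N \<Longrightarrow> c \<noteq> zero \<Longrightarrow> thesis) \<Longrightarrow> thesis"
  by (auto simp: Rat_def)

lemma frac_Rat: "a \<in> N \<Longrightarrow> b \<in> N \<Longrightarrow> c \<in> N \<Longrightarrow> c \<noteq> zero \<Longrightarrow> frac a b c \<in> Rat"
  by (auto simp: Rat_def)

lemma rless_frac:
  assumes "a \<in> N" "b \<in> N" "c \<in> N" "c \<noteq> zero" "a' \<in> N" "b' \<in> N" "c' \<in> N" "c' \<noteq> zero"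
  shows "rless (frac a b c) (frac a' b' c') \<longleftrightarrow> a \<otimes> c' \<oplus> b' \<otimes> c \<prec> a' \<otimes> c \<oplus> b \<otimes> c'"
  unfolding rless_def using assms by simp

lemma rless_Rat: "rless p q \<Longrightarrow> p \<in> Rat \<and> q \<in> Rat"
  unfolding rless_def Rat_def by blast

lemma dfn_rless [dfn_intros]: "dfnt t \<Longrightarrow> dfnt u \<Longrightarrow> dfn (\<lambda>e. rless (t e) (u e))"
proof (rule dfn_lift2[where R = rless and t = t and u = u])
  show "dfn (\<lambda>e. rless (e 0) (e (Suc 0)))" unfolding rless_def lt_def by (intro dfn_intros)
qed

lemma isset_Rat [simp]: "isset Rat"
proof (rule isset_subset)
  show "isset (Times (Times N N) N)" by simp
  show "Rat \<subseteq> Times (Times N N) N" by (auto simp: Rat_def frac_def)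
  show "dfn (\<lambda>e. e 0 \<in> Rat)" unfolding Rat_def by (intro dfn_intros)
qed

lemma rless_irrefl: "\<not> rless p p"
proof
  assume "rless p p"
  then obtain a b c where "a \<otimes> c \<oplus> b \<otimes> c \<prec> a \<otimes> c \<oplus> b \<otimes> c" unfolding rless_def by auto
  then show False using lt_irrefl by blast
qed

lemma lt_cotrans:
  assumes "x \<prec> z"
  shows "x \<prec> y \<or> y \<prec> z"
proof (rule disjCI)
  assume "\<not> y \<prec> z"
  then consider "nn y = nn z" | "z \<prec> y" using N_linear[OF nn_N nn_N, of y z] unfolding lt_def by blast
  then show "x \<prec> y"
  proof cases
    case 1
    then show ?thesis using assms by (simp only: lt_def)
  next
    case 2
    with assms show ?thesis by (rule lt_trans)
  qed
qed

lemma not_lt_add_mono: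
  assumes "\<not> m \<prec> k" "\<not> m' \<prec> k'"
  shows "\<not> m \<oplus> m' \<prec> k \<oplus> k'"
  using lt_cotrans[of "m \<oplus> m'" "k \<oplus> k'" "k \<oplus> m'"] lt_add_cancel[of m m' k] lt_add_cancel[of m' k k'] assms
  by (simp add: add_commute[of k]) blast

text \<open>Cotransitivity stands in for linearity, which fails for fractions because different ones
  may represent the same rational number. The two negated inequalities, multiplied by
  \<open>c2\<close> and \<open>c\<close> and added, contradict \<open>less\<close> multiplied by
  \<open>c1\<close>.\<close>

lemma rless_cotrans:
  assumes "rless p s" "q \<in> Rat"
  shows "rless p q \<or> rless q s"
proof (rule ccontr)
  assume not: "\<not> (rless p q \<or> rless q s)"
  obtain a b c a2 b2 c2 where p: "a \<in> N" "b \<in> N" "c \<in> N" "c \<noteq> zero" "p = frac a b c"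
    and s: "a2 \<in> N" "b2 \<in> N" "c2 \<in> N" "c2 \<noteq> zero" "s = frac a2 b2 c2"
    and less: "a \<otimes> c2 \<oplus> b2 \<otimes> c \<prec> a2 \<otimes> c \<oplus> b \<otimes> c2"
    using assms(1) unfolding rless_def by blast
  obtain a1 b1 c1 where q: "q = frac a1 b1 c1" "a1 \<in> N" "b1 \<in> N" "c1 \<in> N" "c1 \<noteq> zero"
    using assms(2) by (rule Rat_cases)
  have "\<not> a \<otimes> c1 \<oplus> b1 \<otimes> c \<prec> a1 \<otimes> c \<oplus> b \<otimes> c1" "\<not> a1 \<otimes> c2 \<oplus> b2 \<otimes> c1 \<prec> a2 \<otimes> c1 \<oplus> b1 \<otimes> c2"
    using not p q s by (simp_all add: rless_frac)
  then have "\<not> (a \<otimes> c1 \<oplus> b1 \<otimes> c) \<otimes> c2 \<oplus> (a1 \<otimes> c2 \<oplus> b2 \<otimes> c1) \<otimes> c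
      \<prec> (a1 \<otimes> c \<oplus> b \<otimes> c1) \<otimes> c2 \<oplus> (a2 \<otimes> c1 \<oplus> b1 \<otimes> c2) \<otimes> c"
    using p(3,4) s(3,4) by (intro not_lt_add_mono) (simp_all add: lt_mul_cancel)
  moreover have "(a \<otimes> c1 \<oplus> b1 \<otimes> c) \<otimes> c2 \<oplus> (a1 \<otimes> c2 \<oplus> b2 \<otimes> c1) \<otimes> c =
      (a \<otimes> c2 \<oplus> b2 \<otimes> c) \<otimes> c1 \<oplus> (b1 \<otimes> (c \<otimes> c2) \<oplus> a1 \<otimes> (c \<otimes> c2))"
    by (simp add: arith_simps)
  moreover have "(a1 \<otimes> c \<oplus> b \<otimes> c1) \<otimes> c2 \<oplus> (a2 \<otimes> c1 \<oplus> b1 \<otimes> c2) \<otimes> c =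
      (a2 \<otimes> c \<oplus> b \<otimes> c2) \<otimes> c1 \<oplus> (b1 \<otimes> (c \<otimes> c2) \<oplus> a1 \<otimes> (c \<otimes> c2))"
    by (simp add: arith_simps)
  ultimately show False using less q(4,5) by (simp add: lt_add_cancel lt_mul_cancel)
qed

text \<open>By cotransitivity of the second inequality only \<open>rless q p\<close> has to be
  excluded, which is asymmetry.\<close>

lemma rless_trans:
  assumes "rless p q" "rless q s"
  shows "rless p s"
proof -
  have "\<not> rless q p"
    unfolding rless_def
  proof clarify
    fix a b c a' b' c'
    assume "a \<in> N" "b \<in> N" "c \<in> N" "c \<noteq> zero" "a' \<in> N" "b' \<in> N" "c' \<in> N" "c' \<noteq> zero"
      and pq: "q = frac a b c" "p = frac a' b' c'" and less: "a \<otimes> c' \<oplus> b' \<otimes> c \<prec> a' \<otimes> c \<oplus> b \<otimes> c'"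
    then have "a' \<otimes> c \<oplus> b \<otimes> c' \<prec> a \<otimes> c' \<oplus> b' \<otimes> c" using assms(1) by (simp add: rless_frac)
    then show False using less lt_trans lt_irrefl by blast
  qed
  then show ?thesis using rless_cotrans[OF assms(2), of p] rless_Rat[OF assms(1)] by blast
qed

lemma rless_dense:
  assumes "rless p q"
  shows "\<exists>s. rless p s \<and> rless s q"
proof -
  obtain a b c a' b' c' where p: "a \<in> N" "b \<in> N" "c \<in> N" "c \<noteq> zero" "p = frac a b c"
    and q: "a' \<in> N" "b' \<in> N" "c' \<in> N" "c' \<noteq> zero" "q = frac a' b' c'"
    and less: "a \<otimes> c' \<oplus> b' \<otimes> c \<prec> a' \<otimes> c \<oplus> b \<otimes> c'"
    using assms unfolding rless_def by blast
  \<comment> \<open>The mediant: numerators and denominators are added.\<close>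
  let ?s = "frac (a \<oplus> a') (b \<oplus> b') (c \<oplus> c')"
  have nz: "c \<oplus> c' \<noteq> zero" using p q by (simp add: add_not_zero)
  have "a \<otimes> (c \<oplus> c') \<oplus> (b \<oplus> b') \<otimes> c = (a \<otimes> c' \<oplus> b' \<otimes> c) \<oplus> (a \<otimes> c \<oplus> b \<otimes> c)"
    "(a \<oplus> a') \<otimes> c \<oplus> b \<otimes> (c \<oplus> c') = (a' \<otimes> c \<oplus> b \<otimes> c') \<oplus> (a \<otimes> c \<oplus> b \<otimes> c)"
    by (simp_all add: arith_simps)
  then have "rless p ?s" using p nz less by (simp add: rless_frac lt_add_cancel)
  moreover have "(a \<oplus> a') \<otimes> c' \<oplus> b' \<otimes> (c \<oplus> c') = (a \<otimes> c' \<oplus> b' \<otimes> c) \<oplus> (a' \<otimes> c' \<oplus> b' \<otimes> c')"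
    "a' \<otimes> (c \<oplus> c') \<oplus> (b \<oplus> b') \<otimes> c' = (a' \<otimes> c \<oplus> b \<otimes> c') \<oplus> (a' \<otimes> c' \<oplus> b' \<otimes> c')"
    by (simp_all add: arith_simps)
  then have "rless ?s q" using q nz less by (simp add: rless_frac lt_add_cancel)
  ultimately show ?thesis by blast
qed

lemma lt_add_self: "n \<in> N \<Longrightarrow> n \<noteq> zero \<Longrightarrow> m \<prec> m \<oplus> n"
  using lt_add_cancel[of zero m n] zero_lt[of n] add_zero_left[of "nn m"] by (simp add: add_commute)

lemma rless_unbounded:
  assumes "q \<in> Rat"
  shows "\<exists>s. rless q s" "\<exists>s. rless s q"
proof -
  obtain a b c where q: "q = frac a b c" "a \<in> N" "b \<in> N" "c \<in> N" "c \<noteq> zero" using assms by (rule Rat_cases)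
  have cc: "c \<otimes> c \<noteq> zero" using q by (simp add: mul_not_zero)
  \<comment> \<open>The witnesses represent \<open>q + 1\<close> and, further below,
    \<open>q - 1\<close>.\<close>
  have "(a \<oplus> c) \<otimes> c \<oplus> b \<otimes> c = (a \<otimes> c \<oplus> b \<otimes> c) \<oplus> c \<otimes> c" by (simp add: arith_simps)
  then have "rless q (frac (a \<oplus> c) b c)" using q cc by (simp add: rless_frac lt_add_self)
  then show "\<exists>s. rless q s" by blast
  have "a \<otimes> c \<oplus> (b \<oplus> c) \<otimes> c = (a \<otimes> c \<oplus> b \<otimes> c) \<oplus> c \<otimes> c" by (simp add: arith_simps)
  then have "rless (frac a (b \<oplus> c) c) q" using q cc by (simp add: rless_frac lt_add_self)
  then show "\<exists>s. rless s q" by blast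
qed

subsection \<open>Real numbers\<close>

definition cut :: "'a set \<Rightarrow> bool" where
  "cut r \<longleftrightarrow> r \<subseteq> Rat \<and> r \<noteq> {} \<and> (\<exists>q. q \<in> Rat \<and> q \<notin> r) \<and> (\<forall>p q. q \<in> r \<longrightarrow> rless p q \<longrightarrow> p \<in> r) \<and>
     (\<forall>q\<in>r. \<exists>p\<in>r. rless q p)"

definition down :: "'a \<Rightarrow> 'a set" where
  "down q = {p. rless p q}"

lemma isset_down [simp]: "isset (down q)"
  by (rule isset_subset[OF isset_Rat]) (auto simp: down_def dest: rless_Rat intro!: dfn_intros)

lemma cut_down:
  assumes "q \<in> Rat"
  shows "cut (down q)"
  unfolding cut_def
proof (intro conjI)
  show "\<exists>p. p \<in> Rat \<and> p \<notin> down q" using assms rless_irrefl by (auto simp: down_def)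
  show "down q \<noteq> {}" using rless_unbounded(2)[OF assms] by (auto simp: down_def)
  show "\<forall>p\<in>down q. \<exists>s\<in>down q. rless p s" using rless_dense by (auto simp: down_def)
  show "\<forall>p s. s \<in> down q \<longrightarrow> rless p s \<longrightarrow> p \<in> down q" using rless_trans by (auto simp: down_def)
qed (auto simp: down_def dest: rless_Rat)

lemma cut_below: "cut r \<Longrightarrow> q \<in> Rat \<Longrightarrow> q \<notin> r \<Longrightarrow> p \<in> r \<Longrightarrow> \<not> rless q p"
  unfolding cut_def by blast

lemma cut_linear:
  assumes "cut r" "cut s"
  shows "r \<subseteq> s \<or> s \<subseteq> r"
proof (rule ccontr)
  assume "\<not> (r \<subseteq> s \<or> s \<subseteq> r)"
  then obtain p q where pq: "q \<in> r" "q \<notin> s" "p \<in> s" "p \<notin> r" by blast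
  \<comment> \<open>The fractions \<open>p\<close> and \<open>q\<close> may be incomparable; the
    strict inequality between \<open>q\<close> and \<open>q'\<close> makes cotransitivity
    applicable.\<close>
  then obtain q' where q': "q' \<in> r" "rless q q'" using assms unfolding cut_def by blast
  have "p \<in> Rat" "q \<in> Rat" using pq assms unfolding cut_def by blast+
  then show False
    using rless_cotrans[OF q'(2), of p] cut_below[OF assms(1) _ pq(4) q'(1)] cut_below[OF assms(2) _ pq(2,3)] by blast
qed

lemma cut_smaller: "cut r \<Longrightarrow> \<exists>q\<in>Rat. down q \<subset> r"
proof -
  assume r: "cut r"
  then obtain q where q: "q \<in> r" unfolding cut_def by blast
  then have "down q \<subseteq> r" "q \<in> Rat" using r unfolding cut_def down_def by blast+
  moreover have "q \<notin> down q" using rless_irrefl by (simp add: down_def)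
  ultimately show "\<exists>q\<in>Rat. down q \<subset> r" using q by blast
qed

lemma cut_greater: "cut r \<Longrightarrow> \<exists>q\<in>Rat. r \<subset> down q"
proof -
  assume r: "cut r"
  then obtain q where q: "q \<in> Rat" "q \<notin> r" unfolding cut_def by blast
  \<comment> \<open>\<open>down q\<close> may be equal to the cut, so a larger fraction is
    taken.\<close>
  obtain s where s: "rless q s" using rless_unbounded(1)[OF q(1)] by blast
  have "p \<in> down s" if "p \<in> r" for p
    using rless_cotrans[OF s, of p] cut_below[OF r q that] that r unfolding cut_def down_def by blast
  moreover have "q \<in> down s" using s by (simp add: down_def)
  ultimately show "\<exists>q\<in>Rat. r \<subset> down q" using q(2) rless_Rat[OF s] by blast
qed

definition Reals :: "'a set" where
  "Reals = {r. cut (ext r)}"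

lemma isset_Reals [simp]: "isset Reals"
proof (rule isset_subset)
  show "isset {r. ext r \<subseteq> Rat}" by (rule isset_Pow) simp
  show "Reals \<subseteq> {r. ext r \<subseteq> Rat}" by (auto simp: Reals_def cut_def)
  show "dfn (\<lambda>e. e 0 \<in> Reals)"
    unfolding Reals_def cut_def by (intro dfn_intros dfn_mem_isset isset_Rat)
qed

definition rzero :: 'a where
  "rzero = Coll (down (frac zero zero one))"

lemma rzero_Reals: "rzero \<in> Reals"
  by (simp add: rzero_def Reals_def ext_Coll cut_down frac_Rat one_not_zero)

text \<open>Provides the second value of the two-valued continuous functions that belong to clopen
  sets.\<close>

lemma ex_Reals_not_rzero: "\<exists>r\<in>Reals. r \<noteq> rzero"
proof -
  have "cut (ext rzero)" using rzero_Reals by (simp add: Reals_def)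
  then obtain q where "q \<in> Rat" "down q \<noteq> ext rzero" using cut_greater by blast
  moreover have "ext (Coll (down q)) = down q" by (simp add: ext_Coll)
  ultimately have "Coll (down q) \<in> Reals" "ext (Coll (down q)) \<noteq> ext rzero"
    by (simp_all add: Reals_def cut_down)
  then show ?thesis by metis
qed

definition ropen :: "'a set \<Rightarrow> bool" where
  "ropen V \<longleftrightarrow> (\<forall>r\<in>V. r \<in> Reals \<and> (\<exists>a\<in>Reals. \<exists>b\<in>Reals. ext a \<subset> ext r \<and> ext r \<subset> ext b \<and>
     (\<forall>s\<in>Reals. ext a \<subset> ext s \<longrightarrow> ext s \<subset> ext b \<longrightarrow> s \<in> V)))"

lemma ropen_not_rzero: "ropen (Reals - {rzero})"
  unfolding ropen_def
proof (intro ballI conjI)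
  fix r assume r: "r \<in> Reals - {rzero}"
  then show "r \<in> Reals" by blast
  have cuts: "cut (ext r)" "cut (ext rzero)" using r rzero_Reals by (auto simp: Reals_def)
  have ne: "ext r \<noteq> ext rzero" using r by (simp add: ext_inject)
  obtain p q where pq: "p \<in> Rat" "down p \<subset> ext r" "q \<in> Rat" "ext r \<subset> down q"
    using cut_smaller[OF cuts(1)] cut_greater[OF cuts(1)] by blast
  then have pq': "Coll (down p) \<in> Reals" "Coll (down q) \<in> Reals" "ext (Coll (down p)) = down p" "ext (Coll (down q)) = down q"
    by (simp_all add: Reals_def ext_Coll cut_down)
  have *: "s \<in> Reals - {rzero}" if "s \<in> Reals" "ext s \<subset> ext rzero \<or> ext rzero \<subset> ext s" for s
    using that by blast
  \<comment> \<open>An open interval around \<open>r\<close> with zero as an end point avoids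
    zero.\<close>
  consider "ext r \<subset> ext rzero" | "ext rzero \<subset> ext r" using cut_linear[OF cuts] ne by blast
  then show "\<exists>a\<in>Reals. \<exists>b\<in>Reals. ext a \<subset> ext r \<and> ext r \<subset> ext b \<and>
     (\<forall>s\<in>Reals. ext a \<subset> ext s \<longrightarrow> ext s \<subset> ext b \<longrightarrow> s \<in> Reals - {rzero})"
  proof cases
    case 1
    then have "ext (Coll (down p)) \<subset> ext r \<and> ext r \<subset> ext rzero \<and>
      (\<forall>s\<in>Reals. ext (Coll (down p)) \<subset> ext s \<longrightarrow> ext s \<subset> ext rzero \<longrightarrow> s \<in> Reals - {rzero})"
      using pq(2) * by (simp add: pq'(3))
    then show ?thesis using pq'(1) rzero_Reals by blast
  next
    case 2
    then have "ext rzero \<subset> ext r \<and> ext r \<subset> ext (Coll (down q)) \<and>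
      (\<forall>s\<in>Reals. ext rzero \<subset> ext s \<longrightarrow> ext s \<subset> ext (Coll (down q)) \<longrightarrow> s \<in> Reals - {rzero})"
      using pq(4) * by (simp add: pq'(4))
    then show ?thesis using pq'(2) rzero_Reals by blast
  qed
qed

subsection \<open>Translation of the formulas about real numbers\<close>

lemma sem_is_frac: "q < d \<Longrightarrow> a < d \<Longrightarrow> b < d \<Longrightarrow> k < d \<Longrightarrow>
    sem c v d (is_frac q a b k) \<longleftrightarrow> v a \<in> N \<and> v b \<in> N \<and> v k \<in> N \<and> v k \<noteq> zero \<and> v q = frac (v a) (v b) (v k)"
  by (simp add: is_frac_def psat_simps sem_is_nat sem_is_empty sem_is_pair frac_def)

lemma sem_is_rat: "q < d \<Longrightarrow> sem c v d (is_rat q) \<longleftrightarrow> v q \<in> Rat"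
  by (auto simp add: is_rat_def psat_simps sem_is_frac Rat_def)

lemma ex_times_plus:
  assumes "a \<in> N" "b \<in> N" "c \<in> N" "a' \<in> N" "b' \<in> N" "c' \<in> N"
  shows "(\<exists>s t u v m n. istimes s a c' \<and> istimes t b' c \<and> isplus m s t \<and> istimes u a' c \<and> istimes v b c' \<and>
     isplus n u v \<and> m \<epsilon> n) \<longleftrightarrow> a \<otimes> c' \<oplus> b' \<otimes> c \<prec> a' \<otimes> c \<oplus> b \<otimes> c'"
proof -
  have "?thesis \<longleftrightarrow> (\<exists>s t u v m n. s = a \<otimes> c' \<and> t = b' \<otimes> c \<and> isplus m s t \<and> u = a' \<otimes> c \<and> v = b \<otimes> c' \<and>
     isplus n u v \<and> m \<epsilon> n) = (a \<otimes> c' \<oplus> b' \<otimes> c \<epsilon> a' \<otimes> c \<oplus> b \<otimes> c')"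
    by (simp only: istimes_mul assms lt_def nn_id add_N)
  also have "\<dots>" by (simp add: isplus_add)
  finally show ?thesis by simp
qed

lemma sem_frac_less: "p < d \<Longrightarrow> q < d \<Longrightarrow> sem c v d (frac_less p q) \<longleftrightarrow> rless (v p) (v q)"
proof -
  have *: "rless p q \<longleftrightarrow> (\<exists>a b c a' b' c'. (a \<in> N \<and> b \<in> N \<and> c \<in> N \<and> c \<noteq> zero \<and> p = frac a b c) \<and>
     (a' \<in> N \<and> b' \<in> N \<and> c' \<in> N \<and> c' \<noteq> zero \<and> q = frac a' b' c') \<and>
     (\<exists>s t u v m n. istimes s a c' \<and> istimes t b' c \<and> isplus m s t \<and> istimes u a' c \<and> istimes v b c' \<and>
     isplus n u v \<and> m \<epsilon> n))" for p q
    unfolding rless_def by (intro ex_cong1) (simp only: conj_assoc ex_times_plus cong: conj_cong)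
  show "p < d \<Longrightarrow> q < d \<Longrightarrow> ?thesis"
    unfolding * by (simp add: frac_less_def psat_simps sem_is_frac sem_is_times sem_is_plus)
qed

lemma sem_is_real: "r < d \<Longrightarrow> sem c v d (is_real r) \<longleftrightarrow> v r \<in> Reals"
proof -
  have *: "cut (ext r) \<longleftrightarrow> (\<forall>q. q \<epsilon> r \<longrightarrow> q \<in> Rat) \<and> (\<exists>q. q \<epsilon> r) \<and> (\<exists>q. q \<in> Rat \<and> \<not> q \<epsilon> r) \<and>
      (\<forall>p q. q \<epsilon> r \<and> rless p q \<longrightarrow> p \<epsilon> r) \<and> (\<forall>q. q \<epsilon> r \<longrightarrow> (\<exists>p. p \<epsilon> r \<and> rless q p))" for r
    by (simp only: cut_def mem_ext[symmetric] subset_eq Ball_def Bex_def ex_in_conv[symmetric] imp_conjL)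
  show "r < d \<Longrightarrow> ?thesis"
    unfolding Reals_def mem_Collect_eq * by (simp add: is_real_def psat_simps sem_is_rat sem_frac_less)
qed

lemma sem_is_Reals: "R < d \<Longrightarrow> sem c v d (is_Reals R) \<longleftrightarrow> ext (v R) = Reals"
  by (simp add: is_Reals_def psat_simps sem_is_real set_eq_iff mem_ext)

lemma sem_real_less: "r < d \<Longrightarrow> s < d \<Longrightarrow> sem c v d (real_less r s) \<longleftrightarrow> ext (v r) \<subset> ext (v s)"
  by (auto simp add: real_less_def psat_simps sem_subset ext_inject[symmetric])

text \<open>Zero is represented by \<open>(0 - 0) / 1\<close>, and comparing
  \<open>(a - b) / c\<close> with it by cross-multiplication reduces to comparing \<open>a\<close>
  with \<open>b\<close>.\<close>

lemma sem_is_real_zero: "r < d \<Longrightarrow> sem c v d (is_real_zero r) \<longleftrightarrow> v r = rzero"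
proof -
  have "p \<in> down (frac zero zero one) \<longleftrightarrow> (\<exists>a b c. (a \<in> N \<and> b \<in> N \<and> c \<in> N \<and> c \<noteq> zero \<and> p = frac a b c) \<and> a \<epsilon> b)" for p
    unfolding down_def rless_def
    by (auto simp: mul_one mul_zero_left add_zero add_zero_left one_not_zero lt_def)
  then show "r < d \<Longrightarrow> ?thesis"
    unfolding rzero_def eq_Coll_iff[OF isset_down]
    by (simp add: is_real_zero_def psat_simps sem_is_frac)
qed

lemma sem_real_open: "V < d \<Longrightarrow> sem c v d (real_open V) \<longleftrightarrow> ropen (ext (v V))"
  unfolding ropen_def Ball_def Bex_def mem_ext
  by (simp add: real_open_def psat_simps sem_is_real sem_real_less imp_conjL)

lemma sem_IDI_Reals: "sem c v d IDI_Reals \<longleftrightarrow> (\<forall>A. ext A \<subseteq> Reals \<longrightarrow> \<not> Fin (ext A) \<longrightarrow> Dinf (ext A))"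
proof -
  have "(\<forall>R A. ext R = Reals \<and> ext A \<subseteq> ext R \<and> P A \<longrightarrow> Q A) \<longleftrightarrow> (\<forall>A. ext A \<subseteq> Reals \<longrightarrow> P A \<longrightarrow> Q A)" for P Q
    using ext_Coll[OF isset_Reals] by metis
  then show ?thesis
    by (simp add: IDI_Reals_def psat_simps sem_is_Reals sem_subset sem_is_finite sem_Dedekind_infinite)
qed

section \<open>Topological spaces in a model\<close>

text \<open>This and the following predicates keep the shape of the formulas, nested existential
  quantifiers included, so that the translations hold by simplification.\<close>

definition is_top :: "'a \<Rightarrow> 'a \<Rightarrow> bool" where
  "is_top X T \<longleftrightarrow> (\<forall>U. U \<epsilon> T \<longrightarrow> ext U \<subseteq> ext X) \<and> zero \<epsilon> T \<and> X \<epsilon> T \<and>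
     (\<forall>U V W. U \<epsilon> T \<and> V \<epsilon> T \<and> ext W = ext U \<inter> ext V \<longrightarrow> W \<epsilon> T) \<and>
     (\<forall>S U. ext S \<subseteq> ext T \<and> ext U = (\<Union>A\<in>ext S. ext A) \<longrightarrow> U \<epsilon> T)"

definition t1 :: "'a \<Rightarrow> 'a \<Rightarrow> bool" where
  "t1 X T \<longleftrightarrow> (\<forall>x y. x \<epsilon> X \<and> y \<epsilon> X \<and> x \<noteq> y \<longrightarrow> (\<exists>U. U \<epsilon> T \<and> x \<epsilon> U \<and> \<not> y \<epsilon> U))"

definition Gdelta :: "'a \<Rightarrow> 'a \<Rightarrow> 'a \<Rightarrow> bool" where
  "Gdelta X T G \<longleftrightarrow> (\<exists>w. ext w = N \<and> (\<exists>u. isfun u w T \<and>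
     (\<forall>x. x \<epsilon> G \<longleftrightarrow> x \<epsilon> X \<and> (\<forall>n U. pair n U \<epsilon> u \<longrightarrow> x \<epsilon> U))))"

definition Pspace :: "'a \<Rightarrow> 'a \<Rightarrow> bool" where
  "Pspace X T \<longleftrightarrow> (\<forall>G. Gdelta X T G \<longrightarrow> G \<epsilon> T)"

definition cont :: "'a \<Rightarrow> 'a \<Rightarrow> 'a \<Rightarrow> bool" where
  "cont X T f \<longleftrightarrow> (\<exists>R. ext R = Reals \<and> isfun f X R \<and>
     (\<forall>V W. ropen (ext V) \<and> (\<forall>x. x \<epsilon> W \<longleftrightarrow> x \<epsilon> X \<and> (\<exists>r. r \<epsilon> V \<and> pair x r \<epsilon> f)) \<longrightarrow> W \<epsilon> T))"

definition zset :: "'a \<Rightarrow> 'a \<Rightarrow> 'a \<Rightarrow> bool" where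
  "zset X T Z \<longleftrightarrow> (\<exists>f. cont X T f \<and> (\<forall>x. x \<epsilon> Z \<longleftrightarrow> x \<epsilon> X \<and> pair x rzero \<epsilon> f))"

definition cozset :: "'a \<Rightarrow> 'a \<Rightarrow> 'a \<Rightarrow> bool" where
  "cozset X T C \<longleftrightarrow> (\<exists>Z. zset X T Z \<and> ext C = ext X - ext Z)"

definition creg :: "'a \<Rightarrow> 'a \<Rightarrow> bool" where
  "creg X T \<longleftrightarrow> (\<forall>C. cozset X T C \<longrightarrow> C \<epsilon> T) \<and>
     (\<forall>U x. U \<epsilon> T \<and> x \<epsilon> U \<longrightarrow> (\<exists>C. cozset X T C \<and> x \<epsilon> C \<and> ext C \<subseteq> ext U))"

definition clop :: "'a \<Rightarrow> 'a \<Rightarrow> 'a \<Rightarrow> bool" where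
  "clop X T U \<longleftrightarrow> U \<epsilon> T \<and> (\<exists>V. ext V = ext X - ext U \<and> V \<epsilon> T)"

definition szd :: "'a \<Rightarrow> 'a \<Rightarrow> bool" where
  "szd X T \<longleftrightarrow> creg X T \<and> (\<forall>Z Z'. zset X T Z \<and> zset X T Z' \<and> ext Z \<inter> ext Z' = {} \<longrightarrow>
     (\<exists>U. clop X T U \<and> (\<exists>D. ext D = ext X - ext Z' \<and> ext Z \<subseteq> ext U \<and> ext U \<subseteq> ext D)))"

definition cpt :: "'a \<Rightarrow> 'a \<Rightarrow> bool" where
  "cpt T K \<longleftrightarrow> (\<forall>S. ext S \<subseteq> ext T \<and> (\<forall>x. x \<epsilon> K \<longrightarrow> (\<exists>U. U \<epsilon> S \<and> x \<epsilon> U)) \<longrightarrow>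
     (\<exists>F. ext F \<subseteq> ext S \<and> Fin (ext F) \<and> (\<forall>x. x \<epsilon> K \<longrightarrow> (\<exists>U. U \<epsilon> F \<and> x \<epsilon> U))))"

definition lcpt :: "'a \<Rightarrow> 'a \<Rightarrow> bool" where
  "lcpt X T \<longleftrightarrow> (\<forall>x. x \<epsilon> X \<longrightarrow> (\<exists>U. U \<epsilon> T \<and> x \<epsilon> U \<and> (\<exists>K. ext U \<subseteq> ext K \<and> ext K \<subseteq> ext X \<and> cpt T K)))"

definition discr :: "'a \<Rightarrow> 'a \<Rightarrow> bool" where
  "discr X T \<longleftrightarrow> (\<forall>A. ext A \<subseteq> ext X \<longrightarrow> A \<epsilon> T)"

definition lpc :: "'a \<Rightarrow> 'a \<Rightarrow> bool" where
  "lpc X T \<longleftrightarrow> (\<forall>A. ext A \<subseteq> ext X \<and> \<not> Fin (ext A) \<longrightarrow>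
     (\<exists>x. x \<epsilon> X \<and> (\<forall>U. U \<epsilon> T \<and> x \<epsilon> U \<longrightarrow> (\<exists>y. y \<epsilon> U \<and> y \<epsilon> A \<and> y \<noteq> x))))"

section \<open>Translation of the topological formulas\<close>

lemma sem_is_topology: "X < d \<Longrightarrow> T < d \<Longrightarrow> sem c v d (is_topology X T) \<longleftrightarrow> is_top (v X) (v T)"
  by (simp add: is_topology_def psat_simps sem_subset sem_is_empty sem_is_Int sem_is_Union is_top_def)

lemma sem_T1_space: "X < d \<Longrightarrow> T < d \<Longrightarrow> sem c v d (T1_space X T) \<longleftrightarrow> t1 (v X) (v T)"
  by (simp add: T1_space_def psat_simps t1_def)

lemma sem_G_delta: "X < d \<Longrightarrow> T < d \<Longrightarrow> G < d \<Longrightarrow> sem c v d (G_delta X T G) \<longleftrightarrow> Gdelta (v X) (v T) (v G)"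
  by (simp add: G_delta_def psat_simps sem_is_omega sem_is_function sem_pair_in Gdelta_def)

lemma sem_P_space: "X < d \<Longrightarrow> T < d \<Longrightarrow> sem c v d (P_space X T) \<longleftrightarrow> Pspace (v X) (v T)"
  by (simp add: P_space_def psat_simps sem_G_delta Pspace_def)

lemma sem_continuous_real: "X < d \<Longrightarrow> T < d \<Longrightarrow> f < d \<Longrightarrow> sem c v d (continuous_real X T f) \<longleftrightarrow> cont (v X) (v T) (v f)"
  by (simp add: continuous_real_def psat_simps sem_is_Reals sem_is_function sem_real_open sem_pair_in cont_def)

lemma sem_zero_set: "X < d \<Longrightarrow> T < d \<Longrightarrow> Z < d \<Longrightarrow> sem c v d (zero_set X T Z) \<longleftrightarrow> zset (v X) (v T) (v Z)"
  by (simp add: zero_set_def psat_simps sem_continuous_real sem_is_real_zero sem_pair_in zset_def)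

lemma sem_cozero_set: "X < d \<Longrightarrow> T < d \<Longrightarrow> C < d \<Longrightarrow> sem c v d (cozero_set X T C) \<longleftrightarrow> cozset (v X) (v T) (v C)"
  by (simp add: cozero_set_def psat_simps sem_zero_set sem_is_Diff cozset_def)

lemma sem_completely_regular: "X < d \<Longrightarrow> T < d \<Longrightarrow> sem c v d (completely_regular X T) \<longleftrightarrow> creg (v X) (v T)"
  by (simp add: completely_regular_def is_base_def psat_simps sem_cozero_set sem_subset creg_def)

lemma sem_clopen: "X < d \<Longrightarrow> T < d \<Longrightarrow> U < d \<Longrightarrow> sem c v d (clopen X T U) \<longleftrightarrow> clop (v X) (v T) (v U)"
  by (simp add: clopen_def psat_simps sem_is_Diff clop_def)

lemma sem_strongly_zero_dimensional:
  "X < d \<Longrightarrow> T < d \<Longrightarrow> sem c v d (strongly_zero_dimensional X T) \<longleftrightarrow> szd (v X) (v T)"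
  by (simp add: strongly_zero_dimensional_def psat_simps sem_completely_regular sem_zero_set sem_disjoint
      sem_clopen sem_is_Diff sem_subset szd_def)

lemma sem_compact_subset: "T < d \<Longrightarrow> K < d \<Longrightarrow> sem c v d (compact_subset T K) \<longleftrightarrow> cpt (v T) (v K)"
  by (simp add: compact_subset_def covers_def psat_simps sem_subset sem_is_finite cpt_def)

lemma sem_locally_compact_space:
  "X < d \<Longrightarrow> T < d \<Longrightarrow> sem c v d (locally_compact_space X T) \<longleftrightarrow> lcpt (v X) (v T)"
  by (simp add: locally_compact_space_def psat_simps sem_subset sem_compact_subset lcpt_def)

lemma sem_discrete_space: "X < d \<Longrightarrow> T < d \<Longrightarrow> sem c v d (discrete_space X T) \<longleftrightarrow> discr (v X) (v T)"
  by (simp add: discrete_space_def psat_simps sem_subset discr_def)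

lemma sem_limit_point_compact: "X < d \<Longrightarrow> T < d \<Longrightarrow> sem c v d (limit_point_compact X T) \<longleftrightarrow> lpc (v X) (v T)"
  by (simp add: limit_point_compact_def accumulation_point_def psat_simps sem_subset sem_is_finite lpc_def)

lemma mem_if_ext: "ext V = A \<Longrightarrow> x \<epsilon> V \<longleftrightarrow> x \<in> A"
  using mem_ext by blast

text \<open>The domain \<open>w\<close> and the graph of \<open>u\<close> disappear:
  \<open>N\<close> is a set of the model, and the application of any element can be restricted to a
  function on it.\<close>

lemma Gdelta_iff: "Gdelta X T G \<longleftrightarrow> (\<exists>u. app u ` N \<subseteq> ext T \<and> ext G = {x \<in> ext X. \<forall>n\<in>N. x \<epsilon> app u n})"
proof
  assume "Gdelta X T G"
  then obtain w u where w: "ext w = N" and u: "isfun u w T"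
    and G: "\<And>x. x \<epsilon> G \<longleftrightarrow> x \<epsilon> X \<and> (\<forall>n U. pair n U \<epsilon> u \<longrightarrow> x \<epsilon> U)"
    unfolding Gdelta_def by blast
  have "app u ` N \<subseteq> ext T" using isfunD[OF u] w by blast
  moreover have "ext G = {x \<in> ext X. \<forall>n\<in>N. x \<epsilon> app u n}"
    by (auto simp: set_eq_iff mem_ext G mem_isfun[OF u, unfolded w])
  ultimately show "\<exists>u. app u ` N \<subseteq> ext T \<and> ext G = {x \<in> ext X. \<forall>n\<in>N. x \<epsilon> app u n}" by blast
next
  assume "\<exists>u. app u ` N \<subseteq> ext T \<and> ext G = {x \<in> ext X. \<forall>n\<in>N. x \<epsilon> app u n}"
  then obtain u where u: "app u ` N \<subseteq> ext T" and G: "ext G = {x \<in> ext X. \<forall>n\<in>N. x \<epsilon> app u n}" by blast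
  let ?u = "lam (ext (Coll N)) (app u)"
  have w: "ext (Coll N) = N" by (simp add: ext_Coll)
  have f: "isfun ?u (Coll N) T" using u w by (intro isfun_lam dfn1_app) simp
  have app: "app ?u n = app u n" if "n \<in> N" for n using that dfn1_app w by (intro app_lam) simp_all
  have mem: "pair n U \<epsilon> ?u \<longleftrightarrow> n \<in> N \<and> U = app u n" for n U
    using mem_isfun[OF f, of n U] app w by auto
  have "x \<epsilon> G \<longleftrightarrow> x \<epsilon> X \<and> (\<forall>n U. pair n U \<epsilon> ?u \<longrightarrow> x \<epsilon> U)" for x
    unfolding mem using G by (auto simp: set_eq_iff mem_ext)
  then show "Gdelta X T G" unfolding Gdelta_def using w f by blast
qed

lemma GdeltaI:
  assumes "dfn1 g" "g ` N \<subseteq> ext T" "ext G = {x \<in> ext X. \<forall>n\<in>N. x \<epsilon> g n}"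
  shows "Gdelta X T G"
proof -
  have "app (lam N g) n = g n" if "n \<in> N" for n using that assms(1) by (intro app_lam) simp_all
  then show ?thesis
    unfolding Gdelta_iff using assms(2,3) by (intro exI[of _ "lam N g"]) (simp cong: image_cong)
qed

text \<open>The complement is the preimage of the open set \<open>Reals - {rzero}\<close>.\<close>

lemma zset_closed:
  assumes "zset X T Z" "ext C = ext X - ext Z"
  shows "C \<epsilon> T"
proof -
  obtain f R where R: "ext R = Reals" "isfun f X R"
    and f: "\<And>V W. ropen (ext V) \<and> (\<forall>x. x \<epsilon> W \<longleftrightarrow> x \<epsilon> X \<and> (\<exists>r. r \<epsilon> V \<and> pair x r \<epsilon> f)) \<longrightarrow> W \<epsilon> T"
    and Z: "\<And>x. x \<epsilon> Z \<longleftrightarrow> x \<epsilon> X \<and> pair x rzero \<epsilon> f"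
    using assms(1) unfolding zset_def cont_def by blast
  let ?V = "Coll (Reals - {rzero})"
  have V: "ext ?V = Reals - {rzero}" by (simp add: ext_Coll)
  have memV: "r \<epsilon> ?V \<longleftrightarrow> r \<in> Reals \<and> r \<noteq> rzero" for r by (simp add: mem_Coll)
  have memf: "pair x r \<epsilon> f \<longleftrightarrow> x \<epsilon> X \<and> r = app f x" for x r
    using mem_isfun[OF R(2), of x r] by (simp only: mem_ext)
  have "x \<epsilon> C \<longleftrightarrow> x \<epsilon> X \<and> \<not> x \<epsilon> Z" for x
    using assms(2) by (simp add: set_eq_iff mem_ext)
  moreover have "app f x \<in> Reals" if "x \<epsilon> X" for x
    using isfunD[OF R(2)] that R(1) by (simp add: mem_ext[symmetric])
  ultimately have "x \<epsilon> C \<longleftrightarrow> x \<epsilon> X \<and> (\<exists>r. r \<epsilon> ?V \<and> pair x r \<epsilon> f)" for x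
    unfolding Z memV memf by (cases "x \<epsilon> X") auto
  then show ?thesis using f[of ?V C] V ropen_not_rzero by simp
qed

text \<open>\<open>D\<close> is the zero-set of a function that is constant on \<open>C\<close> and
  on \<open>D\<close>; its only preimages are the empty set, \<open>X\<close>, \<open>C\<close> and
  \<open>D\<close>.\<close>

lemma zset_clopen:
  assumes T: "is_top X T" and C: "C \<epsilon> T" "D \<epsilon> T" "ext D = ext X - ext C"
  shows "zset X T D"
proof -
  obtain r where r: "r \<in> Reals" "r \<noteq> rzero" using ex_Reals_not_rzero by blast
  let ?g = "\<lambda>x. if x \<epsilon> C then r else rzero"
  let ?f = "lam (ext X) ?g"
  have dfn: "dfn1 ?g" by (intro dfn_intros)
  have R: "ext (Coll Reals) = Reals" by (simp add: ext_Coll)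
  have f: "isfun ?f X (Coll Reals)" using r(1) rzero_Reals R by (intro isfun_lam dfn) auto
  have mem: "pair x y \<epsilon> ?f \<longleftrightarrow> x \<in> ext X \<and> y = ?g x" for x y
    by (rule mem_lam[OF isset_ext dfn])
  have "W \<epsilon> T" if W: "\<forall>x. x \<epsilon> W \<longleftrightarrow> x \<epsilon> X \<and> (\<exists>r. r \<epsilon> V \<and> pair x r \<epsilon> ?f)" for V W
  proof -
    have "ext C \<subseteq> ext X" using T C(1) unfolding is_top_def by blast
    have "ext W = {x \<in> ext X. ?g x \<epsilon> V}"
      using W unfolding mem by (auto simp: set_eq_iff mem_ext)
    then have "ext W = ext zero \<or> ext W = ext X \<or> ext W = ext C \<or> ext W = ext D"
      using C(3) \<open>ext C \<subseteq> ext X\<close> by (cases "r \<epsilon> V"; cases "rzero \<epsilon> V") (auto simp: mem_ext[symmetric])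
    then have "W = zero \<or> W = X \<or> W = C \<or> W = D" by (simp only: ext_inject)
    then show ?thesis using T C unfolding is_top_def by blast
  qed
  then have "cont X T ?f" unfolding cont_def using R f by blast
  moreover have "x \<epsilon> D \<longleftrightarrow> x \<epsilon> X \<and> \<not> x \<epsilon> C" for x
    using C(3) by (simp add: set_eq_iff mem_ext)
  then have "x \<epsilon> D \<longleftrightarrow> x \<epsilon> X \<and> pair x rzero \<epsilon> ?f" for x
    using r(2) by (simp add: mem mem_ext)
  ultimately show ?thesis unfolding zset_def by blast
qed

subsection \<open>Spaces with at most one non-isolated point\<close>

text \<open>The points other than \<open>x0\<close> are isolated and \<open>F\<close> is the neighbourhood filter of \<open>x0\<close>.\<close>

definition point_top :: "'a \<Rightarrow> 'a \<Rightarrow> ('a \<Rightarrow> bool) \<Rightarrow> 'a" where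
  "point_top X x0 F = Coll {U. ext U \<subseteq> ext X \<and> (x0 \<epsilon> U \<longrightarrow> F U)}"

text \<open>\<open>point_top\<close> consults \<open>F\<close> only for sets containing
  \<open>x0\<close>, so the members of \<open>F\<close> may as well be punctured neighbourhoods. The
  last clause makes every point other than \<open>x0\<close> closed, which yields both the
  separation axiom and clopen singletons.\<close>

definition nbhd_filter :: "'a \<Rightarrow> 'a \<Rightarrow> ('a \<Rightarrow> bool) \<Rightarrow> bool" where
  "nbhd_filter X x0 F \<longleftrightarrow> dfn (\<lambda>e. F (e 0)) \<and> x0 \<epsilon> X \<and> F X \<and>
     (\<forall>U V. F U \<longrightarrow> ext U \<subseteq> ext V \<longrightarrow> ext V \<subseteq> ext X \<longrightarrow> F V) \<and>
     (\<forall>U V W. F U \<longrightarrow> F V \<longrightarrow> ext W = ext U \<inter> ext V \<longrightarrow> F W) \<and>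
     (\<forall>y V. y \<epsilon> X \<longrightarrow> y \<noteq> x0 \<longrightarrow> ext V = ext X - {y} \<longrightarrow> F V)"

context
  fixes X x0 F
  assumes filter: "nbhd_filter X x0 F"
begin

lemma
  shows F: "dfn (\<lambda>e. F (e 0))" and x0: "x0 \<epsilon> X" and FX: "F X"
    and F_mono: "F U \<Longrightarrow> ext U \<subseteq> ext V \<Longrightarrow> ext V \<subseteq> ext X \<Longrightarrow> F V"
    and F_Int: "F U \<Longrightarrow> F V \<Longrightarrow> ext W = ext U \<inter> ext V \<Longrightarrow> F W"
    and F_Diff: "y \<epsilon> X \<Longrightarrow> y \<noteq> x0 \<Longrightarrow> ext V = ext X - {y} \<Longrightarrow> F V"
  using filter unfolding nbhd_filter_def by blast+

abbreviation (input) "T0 \<equiv> point_top X x0 F"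

lemma mem_point_top: "U \<epsilon> T0 \<longleftrightarrow> ext U \<subseteq> ext X \<and> (x0 \<epsilon> U \<longrightarrow> F U)"
proof -
  have "isset {U. ext U \<subseteq> ext X \<and> (x0 \<epsilon> U \<longrightarrow> F U)}"
    by (rule isset_subset[OF isset_Pow[OF isset_ext[of X]]], blast)
      (intro dfn_intros dfn_lift1[where R = F, OF F])
  then show ?thesis unfolding point_top_def by (simp add: mem_Coll)
qed

lemma is_top_point_top: "is_top X T0"
  unfolding is_top_def
proof (intro conjI allI impI)
  show "zero \<epsilon> T0" by (simp add: mem_point_top not_mem_zero)
  show "X \<epsilon> T0" by (simp add: mem_point_top FX)
  show "W \<epsilon> T0" if "U \<epsilon> T0 \<and> V \<epsilon> T0 \<and> ext W = ext U \<inter> ext V" for U V W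
  proof -
    have "x0 \<epsilon> W \<longleftrightarrow> x0 \<epsilon> U \<and> x0 \<epsilon> V" "ext W \<subseteq> ext U"
      using that by (simp_all add: mem_if_ext[of W "ext U \<inter> ext V"] mem_ext)
    then show ?thesis using that F_Int[of U V W] by (simp add: mem_point_top) blast
  qed
  show "U \<epsilon> T0" if "ext S \<subseteq> ext T0 \<and> ext U = (\<Union>A\<in>ext S. ext A)" for S U
  proof -
    have S: "ext A \<subseteq> ext X \<and> (x0 \<epsilon> A \<longrightarrow> F A)" if "A \<in> ext S" for A
      using \<open>ext S \<subseteq> ext T0 \<and> _\<close> that mem_point_top mem_ext by blast
    then have sub: "ext U \<subseteq> ext X" using that by blast
    moreover have "F U" if "x0 \<epsilon> U"
    proof -
      have "x0 \<in> ext U" using that by (simp add: mem_ext)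
      then obtain A where A: "A \<in> ext S" "x0 \<in> ext A" "ext A \<subseteq> ext U"
        using \<open>ext S \<subseteq> ext T0 \<and> _\<close> by blast
      then have "F A" using S by (simp add: mem_ext)
      then show ?thesis using A(3) sub by (rule F_mono)
    qed
    ultimately show ?thesis by (simp add: mem_point_top)
  qed
qed (use mem_point_top in blast)

lemma t1_point_top: "t1 X T0"
  unfolding t1_def
proof (intro allI impI)
  fix x y assume xy: "x \<epsilon> X \<and> y \<epsilon> X \<and> x \<noteq> y"
  let ?U = "Coll (ext X - {y})"
  have U: "ext ?U = ext X - {y}" by (simp add: ext_Coll)
  have "?U \<epsilon> T0 \<or> x \<noteq> x0"
    using F_Diff[OF _ _ U] xy by (auto simp: mem_point_top U)
  moreover have "x \<epsilon> ?U" "\<not> y \<epsilon> ?U" using xy by (simp_all add: mem_if_ext[OF U] mem_ext)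
  moreover have "Coll {x} \<epsilon> T0" "x \<epsilon> Coll {x}" "\<not> y \<epsilon> Coll {x}" if "x \<noteq> x0"
    using xy that by (auto simp: mem_point_top ext_Coll mem_Coll mem_ext)
  ultimately show "\<exists>U. U \<epsilon> T0 \<and> x \<epsilon> U \<and> \<not> y \<epsilon> U" by blast
qed

lemma point_top_complement:
  assumes "x0 \<epsilon> U" "ext V = ext X - ext U"
  shows "V \<epsilon> T0"
  using assms by (simp add: mem_point_top mem_if_ext[OF assms(2)] mem_ext)

text \<open>Every open set containing \<open>x0\<close> is clopen, and so is every singleton other
  than \<open>{x0}\<close>; clopen sets are cozero-sets.\<close>

lemma creg_point_top: "creg X T0"
  unfolding creg_def
proof (intro conjI allI impI)
  show "C \<epsilon> T0" if "cozset X T0 C" for C using that zset_closed unfolding cozset_def by blast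
  fix U x assume U: "U \<epsilon> T0 \<and> x \<epsilon> U"
  then have sub: "ext U \<subseteq> ext X" using mem_point_top by blast
  have coz: "cozset X T0 C" if "C \<epsilon> T0" "Coll (ext X - ext C) \<epsilon> T0" for C
  proof -
    have "ext C \<subseteq> ext X" using that mem_point_top by blast
    have D: "ext (Coll (ext X - ext C)) = ext X - ext C" by (simp add: ext_Coll)
    have "zset X T0 (Coll (ext X - ext C))" by (rule zset_clopen[OF is_top_point_top that D])
    then show ?thesis unfolding cozset_def D using \<open>ext C \<subseteq> ext X\<close> by (intro exI[of _ "Coll (ext X - ext C)"]) (auto simp: D)
  qed
  show "\<exists>C. cozset X T0 C \<and> x \<epsilon> C \<and> ext C \<subseteq> ext U"
  proof (cases "x = x0")
    case True
    then have "Coll (ext X - ext U) \<epsilon> T0" using U by (intro point_top_complement) (auto simp: ext_Coll)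
    then show ?thesis using U coz by blast
  next
    case False
    have "x \<in> ext U" using U by (simp add: mem_ext)
    then have x: "x \<epsilon> X" using sub by (auto simp: mem_ext)
    have D: "ext (Coll (ext X - {x})) = ext X - {x}" and x': "ext (Coll {x}) = {x}" by (simp_all add: ext_Coll)
    have "Coll {x} \<epsilon> T0" using x False by (auto simp: mem_point_top x' mem_ext mem_Coll)
    moreover have "Coll (ext X - ext (Coll {x})) \<epsilon> T0"
      unfolding x' mem_point_top D using F_Diff[OF x False D] by blast
    ultimately have "cozset X T0 (Coll {x})" by (rule coz)
    moreover have "x \<epsilon> Coll {x}" "ext (Coll {x}) \<subseteq> ext U" using x' U by (auto simp: mem_ext mem_Coll)
    ultimately show ?thesis by blast
  qed
qed

text \<open>Disjoint zero-sets cannot both contain \<open>x0\<close>, and one that misses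
  \<open>x0\<close> is clopen: closed as a zero-set, and open because all its points are
  isolated.\<close>

lemma szd_point_top: "szd X T0"
  unfolding szd_def
proof (intro conjI allI impI creg_point_top)
  fix Z Z' assume Z: "zset X T0 Z \<and> zset X T0 Z' \<and> ext Z \<inter> ext Z' = {}"
  have clop: "clop X T0 W" if "zset X T0 W" "\<not> x0 \<epsilon> W" for W
  proof -
    have "ext W \<subseteq> ext X" using \<open>zset X T0 W\<close> unfolding zset_def by (auto simp: mem_ext)
    then have "W \<epsilon> T0" using that by (simp add: mem_point_top)
    moreover have "ext (Coll (ext X - ext W)) = ext X - ext W" by (simp add: ext_Coll)
    moreover have "Coll (ext X - ext W) \<epsilon> T0" by (rule zset_closed[OF that(1)]) (simp add: ext_Coll)
    ultimately show ?thesis unfolding clop_def by blast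
  qed
  have sub: "ext Z \<subseteq> ext X" "ext Z' \<subseteq> ext X" using Z unfolding zset_def by (auto simp: mem_ext)
  let ?D = "Coll (ext X - ext Z')"
  have D: "ext ?D = ext X - ext Z'" by (simp add: ext_Coll)
  show "\<exists>U. clop X T0 U \<and> (\<exists>D. ext D = ext X - ext Z' \<and> ext Z \<subseteq> ext U \<and> ext U \<subseteq> ext D)"
  proof (cases "x0 \<epsilon> Z")
    case False
    have "ext Z \<subseteq> ext ?D" using Z sub D by blast
    then show ?thesis using clop False Z D by blast
  next
    case True
    then have "\<not> x0 \<epsilon> Z'" using Z mem_ext by blast
    then have "clop X T0 Z'" using clop Z by blast
    then have "clop X T0 ?D"
      unfolding clop_def using D sub(2) zset_closed[of X T0 Z' ?D] Z by (auto intro!: exI[of _ Z'])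
    moreover have "ext Z \<subseteq> ext ?D" using Z sub D by blast
    ultimately show ?thesis using D by blast
  qed
qed

end

subsection \<open>The one-point compactification of a discrete space\<close>

text \<open>One space refutes all three sentences: it is compact and hence locally compact,
  \<open>x0\<close> is an accumulation point of every infinite subset, and \<open>{x0}\<close> is
  not open because \<open>X\<close> is infinite.\<close>

lemma ex_space_if_quasi_Dedekind_finite:
  assumes inf: "\<not> Fin (ext X)" and qDf: "\<not> Dinf (FinPow (ext X))"
  shows "\<exists>T. is_top X T \<and> creg X T \<and> t1 X T \<and> Pspace X T \<and> cpt T X \<and> lpc X T \<and> \<not> discr X T"
proof -
  have "ext X \<noteq> {}" using inf by auto
  then obtain x0 where x0: "x0 \<epsilon> X" by (auto simp: mem_ext)
  let ?F = "\<lambda>U. Fin (ext X - ext U)" let ?T = "point_top X x0 ?F"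
  have dfn: "dfn (\<lambda>e. ?F (e 0))" by (intro dfn_intros)
  have FX: "?F X" by simp
  have F_mono: "?F V" if "?F U" "ext U \<subseteq> ext V" "ext V \<subseteq> ext X" for U V
    using that by (intro Fin_subset[OF that(1)]) auto
  have F_Int: "?F W" if "?F U" "?F V" "ext W = ext U \<inter> ext V" for U V W
    using that by (simp add: Diff_Int)
  have F_Diff: "?F V" if "y \<epsilon> X" "y \<noteq> x0" "ext V = ext X - {y}" for y V
    using that by (simp add: double_diff mem_ext Diff_Diff_Int Fin_subset[of "{y}"])
  have *: "nbhd_filter X x0 ?F"
    unfolding nbhd_filter_def
    by (intro conjI allI impI dfn x0 FX; (rule F_mono F_Int F_Diff; assumption))
  have memT: "U \<epsilon> ?T \<longleftrightarrow> ext U \<subseteq> ext X \<and> (x0 \<epsilon> U \<longrightarrow> ?F U)" for U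
    by (rule mem_point_top[OF *])
  have "Pspace X ?T"
    unfolding Pspace_def
  proof (intro allI impI)
    fix G assume "Gdelta X ?T G"
    then obtain u where u: "app u ` N \<subseteq> ext ?T" and G: "ext G = {x \<in> ext X. \<forall>n\<in>N. x \<epsilon> app u n}"
      unfolding Gdelta_iff by blast
    have "?F G" if "x0 \<epsilon> G"
    proof -
      \<comment> \<open>The finite complements form a sequence in \<open>FinPow (ext X)\<close>;
        their union could be infinite only if that set were Dedekind-infinite.\<close>
      let ?w = "\<lambda>n. Coll (ext X - ext (app u n))"
      have "x0 \<epsilon> app u n" if "n \<in> N" for n using \<open>x0 \<epsilon> G\<close> that by (simp add: mem_if_ext[OF G])
      moreover have "app u n \<epsilon> ?T" if "n \<in> N" for n using u that by (auto simp: mem_ext)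
      ultimately have "?F (app u n)" if "n \<in> N" for n using memT that by blast
      then have "?w n \<in> FinPow (ext X)" if "n \<in> N" for n using that by (auto simp: FinPow_def ext_Coll)
      moreover have "dfn1 ?w" by (intro dfn_intros)
      ultimately have "Fin (\<Union>n\<in>N. ext (?w n))" using Dinf_FinPow_if_sequence[of ?w] qDf by blast
      moreover have "ext X - ext G = (\<Union>n\<in>N. ext (?w n))" by (auto simp: G ext_Coll mem_ext)
      ultimately show ?thesis by simp
    qed
    moreover have "ext G \<subseteq> ext X" using G by blast
    ultimately show "G \<epsilon> ?T" using memT by blast
  qed
  moreover have "cpt ?T X"
    unfolding cpt_def
  proof (intro allI impI)
    fix S assume S: "ext S \<subseteq> ext ?T \<and> (\<forall>x. x \<epsilon> X \<longrightarrow> (\<exists>U. U \<epsilon> S \<and> x \<epsilon> U))"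
    then obtain U0 where U0: "U0 \<epsilon> S" "x0 \<epsilon> U0" using x0 by blast
    then have "U0 \<epsilon> ?T" using S by (auto simp: mem_ext)
    then have "Fin (ext X - ext U0)" using memT U0(2) by blast
    \<comment> \<open>Members of the cover for finitely many points are selected by induction, one
      point at a time.\<close>
    have "C \<subseteq> ext X \<longrightarrow> (\<exists>F. ext F \<subseteq> ext S \<and> Fin (ext F) \<and> (\<forall>x\<in>C. \<exists>U\<in>ext F. x \<epsilon> U))" if "Fin C" for C
      using that
    proof (induction C rule: Fin_induct)
      case dfn
      show ?case by (intro dfn_intros)
    next
      case empty
      show ?case by (auto intro!: exI[of _ zero])
    next
      case (insert x C)
      show ?case
      proof (intro impI)
        assume C: "insert x C \<subseteq> ext X"
        then obtain F where F: "ext F \<subseteq> ext S" "Fin (ext F)" "\<forall>x\<in>C. \<exists>U\<in>ext F. x \<epsilon> U" using insert by auto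
        obtain U where U: "U \<epsilon> S" "x \<epsilon> U" using C S by (auto simp: mem_ext)
        have "ext (Coll (insert U (ext F))) = insert U (ext F)" by (simp add: ext_Coll)
        then show "\<exists>F. ext F \<subseteq> ext S \<and> Fin (ext F) \<and> (\<forall>x\<in>insert x C. \<exists>U\<in>ext F. x \<epsilon> U)"
          using F U by (intro exI[of _ "Coll (insert U (ext F))"]) (auto simp: mem_ext)
      qed
    qed
    from this[OF \<open>Fin (ext X - ext U0)\<close>] obtain F where F: "ext F \<subseteq> ext S" "Fin (ext F)"
      "\<forall>x\<in>ext X - ext U0. \<exists>U\<in>ext F. x \<epsilon> U" by auto
    let ?F = "Coll (insert U0 (ext F))"
    have F': "ext ?F = insert U0 (ext F)" by (simp add: ext_Coll)
    show "\<exists>F. ext F \<subseteq> ext S \<and> Fin (ext F) \<and> (\<forall>x. x \<epsilon> X \<longrightarrow> (\<exists>U. U \<epsilon> F \<and> x \<epsilon> U))"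
    proof (rule exI[of _ ?F], intro conjI allI impI)
      show "ext ?F \<subseteq> ext S" "Fin (ext ?F)" using F(1,2) U0(1) by (simp_all add: F' mem_ext)
      fix x assume x: "x \<epsilon> X"
      show "\<exists>U. U \<epsilon> ?F \<and> x \<epsilon> U"
      proof (cases "x \<epsilon> U0")
        case True
        then show ?thesis by (auto simp: mem_if_ext[OF F'])
      next
        case False
        then have "x \<in> ext X - ext U0" using x by (simp add: mem_ext)
        then obtain U where "U \<in> ext F" "x \<epsilon> U" using F(3) by blast
        then show ?thesis by (auto simp: mem_if_ext[OF F'])
      qed
    qed
  qed
  moreover have "lpc X ?T"
    unfolding lpc_def
  proof (intro allI impI)
    fix A assume A: "ext A \<subseteq> ext X \<and> \<not> Fin (ext A)"
    have "\<exists>y. y \<epsilon> U \<and> y \<epsilon> A \<and> y \<noteq> x0" if U: "U \<epsilon> ?T \<and> x0 \<epsilon> U" for U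
    proof (rule ccontr)
      assume "\<nexists>y. y \<epsilon> U \<and> y \<epsilon> A \<and> y \<noteq> x0"
      then have "y \<in> ext A \<Longrightarrow> y \<notin> ext U \<or> y = x0" for y by (auto simp: mem_ext)
      then have "ext A \<subseteq> insert x0 (ext X - ext U)" using A by blast
      moreover have "Fin (insert x0 (ext X - ext U))" using U memT by simp
      ultimately show False using A Fin_subset isset_ext by blast
    qed
    then show "\<exists>x. x \<epsilon> X \<and> (\<forall>U. U \<epsilon> ?T \<and> x \<epsilon> U \<longrightarrow> (\<exists>y. y \<epsilon> U \<and> y \<epsilon> A \<and> y \<noteq> x))" using x0 by blast
  qed
  moreover have "\<not> discr X ?T"
  proof
    assume "discr X ?T"
    moreover have x0': "ext (Coll {x0}) = {x0}" by (simp add: ext_Coll)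
    ultimately have "Coll {x0} \<epsilon> ?T" using x0 by (simp add: discr_def mem_ext)
    then have "Fin (ext X - {x0})" unfolding memT x0' by (simp add: mem_Coll)
    then have "Fin (insert x0 (ext X - {x0}))" by (rule Fin_insert)
    then show False using inf x0 by (simp add: insert_absorb mem_ext)
  qed
  ultimately show ?thesis
    using is_top_point_top[OF *] creg_point_top[OF *] t1_point_top[OF *] by blast
qed

lemma cpt_imp_lcpt: "is_top X T \<Longrightarrow> cpt T X \<Longrightarrow> lcpt X T"
proof -
  assume "is_top X T" and cpt: "cpt T X"
  then have "X \<epsilon> T" unfolding is_top_def by (elim conjE)
  then show "lcpt X T" unfolding lcpt_def using cpt by blast
qed

subsection \<open>Limit point compact P-spaces\<close>

lemma Fin_complement_open:
  assumes T: "is_top X T" and t1: "t1 X T" and "Fin C" and V: "ext V = ext X - C"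
  shows "V \<epsilon> T"
proof -
  have Int: "W \<epsilon> T" if "U \<epsilon> T" "U' \<epsilon> T" "ext W = ext U \<inter> ext U'" for U U' W
    using T that unfolding is_top_def by blast
  have single: "V \<epsilon> T" if V: "ext V = ext X - {y}" for V y
  proof (cases "y \<epsilon> X")
    case False
    then have "V = X" using V by (simp add: ext_inject[symmetric] mem_ext)
    then show ?thesis using T unfolding is_top_def by blast
  next
    case True
    \<comment> \<open>All open sets that avoid \<open>y\<close> are taken, so that no neighbourhood
      has to be chosen for each point.\<close>
    let ?S = "Coll {U \<in> ext T. \<not> y \<epsilon> U}"
    have S: "ext ?S = {U \<in> ext T. \<not> y \<epsilon> U}" by (intro ext_Coll isset_Collect isset_ext dfn_intros)
    have "ext V = (\<Union>A\<in>ext ?S. ext A)"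
    proof (intro equalityI subsetI)
      fix x assume "x \<in> ext V"
      then have "x \<epsilon> X" "x \<noteq> y" using V by (auto simp: mem_ext)
      then obtain U where "U \<epsilon> T" "x \<epsilon> U" "\<not> y \<epsilon> U" using t1 True unfolding t1_def by blast
      then show "x \<in> (\<Union>A\<in>ext ?S. ext A)" unfolding S by (auto simp: mem_ext)
    next
      fix x assume "x \<in> (\<Union>A\<in>ext ?S. ext A)"
      then obtain U where U: "U \<epsilon> T" "x \<epsilon> U" "\<not> y \<epsilon> U" unfolding S by (auto simp: mem_ext)
      then have "ext U \<subseteq> ext X" using T unfolding is_top_def by blast
      moreover have "x \<in> ext U" "x \<noteq> y" using U by (auto simp: mem_ext)
      ultimately show "x \<in> ext V" using V by blast
    qed
    moreover have "ext ?S \<subseteq> ext T" unfolding S by blast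
    ultimately show ?thesis using T unfolding is_top_def by blast
  qed
  have "\<forall>V. ext V = ext X - C \<longrightarrow> V \<epsilon> T"
    using \<open>Fin C\<close>
  proof (induction C rule: Fin_induct)
    case dfn
    show ?case by (intro dfn_intros)
  next
    case empty
    show ?case using T unfolding is_top_def by (simp add: ext_inject)
  next
    case (insert x C)
    have C: "ext (Coll (ext X - C)) = ext X - C" "ext (Coll (ext X - {x})) = ext X - {x}"
      using Fin_isset[OF insert(1)] by (simp_all add: ext_Coll)
    show ?case
    proof (intro allI impI)
      fix V assume "ext V = ext X - insert x C"
      then have "ext V = ext (Coll (ext X - C)) \<inter> ext (Coll (ext X - {x}))" unfolding C by blast
      moreover have "Coll (ext X - C) \<epsilon> T" using insert(3) C(1) by blast
      moreover have "Coll (ext X - {x}) \<epsilon> T" by (rule single[OF C(2)])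
      ultimately show "V \<epsilon> T" using Int[of "Coll (ext X - C)" "Coll (ext X - {x})" V] by blast
    qed
  qed
  then show ?thesis using V by blast
qed

lemma Fin_if_lpc_Pspace:
  assumes IQDI: "\<And>X. \<not> Fin (ext X) \<Longrightarrow> Dinf (FinPow (ext X))"
    and T: "is_top X T" "Pspace X T" "lpc X T" "t1 X T"
  shows "Fin (ext X)"
proof (rule ccontr)
  assume "\<not> Fin (ext X)"
  then obtain u where u: "dfn1 u" "\<And>n. n \<in> N \<Longrightarrow> u n \<in> FinPow (ext X)" and inf: "\<not> Fin (\<Union>n\<in>N. ext (u n))"
    using sequence_if_Dinf_FinPow[OF isset_ext IQDI] by blast
  let ?S = "\<Union>n\<in>N. ext (u n)"
  have S: "isset ?S" by (intro isset_UN isset_N dfn_intros dfn1D[OF u(1)] isset_ext)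
  then have S': "ext (Coll ?S) = ?S" by (rule ext_Coll)
  have sub: "?S \<subseteq> ext X" using u(2) unfolding FinPow_def by blast
  obtain x where x: "x \<epsilon> X" and acc: "\<And>U. U \<epsilon> T \<Longrightarrow> x \<epsilon> U \<Longrightarrow> \<exists>y. y \<epsilon> U \<and> y \<in> ?S \<and> y \<noteq> x"
    using T(3) sub inf S' unfolding lpc_def by (metis mem_ext)
  \<comment> \<open>Leaving \<open>x\<close> in place makes \<open>?V\<close> a neighbourhood of
    \<open>x\<close> that contains no other point of \<open>?S\<close>.\<close>
  let ?V = "Coll (ext X - (?S - {x}))"
  have V: "ext ?V = ext X - (?S - {x})" using S by (intro ext_Coll isset_Diff isset_ext) simp_all
  let ?g = "\<lambda>n. Coll (ext X - (ext (u n) - {x}))"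
  have g: "ext (?g n) = ext X - (ext (u n) - {x})" for n by (simp add: ext_Coll)
  have "Gdelta X T ?V"
  proof (rule GdeltaI)
    show "dfn1 ?g" by (intro dfn_intros dfn1D[OF u(1)])
    show "?g ` N \<subseteq> ext T"
    proof clarify
      fix n assume "n \<in> N"
      then have "Fin (ext (u n))" using u(2)[of n] by (simp add: FinPow_def)
      then have "Fin (ext (u n) - {x})" by (rule Fin_subset) auto
      then show "?g n \<in> ext T" using Fin_complement_open[OF T(1,4) _ g] mem_ext by blast
    qed
    show "ext ?V = {x \<in> ext X. \<forall>n\<in>N. x \<epsilon> ?g n}" unfolding V mem_if_ext[OF g] by blast
  qed
  then have "?V \<epsilon> T" using T(2) unfolding Pspace_def by blast
  moreover have "x \<epsilon> ?V" using x by (simp add: mem_if_ext[OF V] mem_ext)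
  ultimately obtain y where "y \<epsilon> ?V" "y \<in> ?S" "y \<noteq> x" using acc by blast
  then show False by (simp add: mem_if_ext[OF V])
qed

subsection \<open>Infinite Dedekind-finite sets of reals\<close>

text \<open>Inclusion orders all finite subsets of \<open>A\<close> at once, so the layers of a
  sequence of finite sets need no chosen enumerations and \<open>Dinf_layers\<close>
  applies.\<close>

lemma Dinf_chain:
  assumes A: "isset A" and chain: "\<And>r s. r \<in> A \<Longrightarrow> s \<in> A \<Longrightarrow> ext r \<subseteq> ext s \<or> ext s \<subseteq> ext r"
    and "Dinf (FinPow A)"
  shows "Dinf A"
proof -
  obtain u where u: "dfn1 u" "\<And>n. n \<in> N \<Longrightarrow> u n \<in> FinPow A" and inf: "\<not> Fin (\<Union>n\<in>N. ext (u n))"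
    using sequence_if_Dinf_FinPow[OF A assms(3)] by blast
  have sub: "\<And>n. n \<in> N \<Longrightarrow> ext (u n) \<subseteq> A" and fin: "\<And>n. n \<in> N \<Longrightarrow> Fin (ext (u n))"
    using u(2) by (simp_all add: FinPow_def)
  have dfn: "dfn (\<lambda>e. e 0 \<in> ext (u (e (Suc 0))))" by (intro dfn_intros dfn1D[OF u(1)])
  have "Dinf (\<Union>n\<in>N. ext (u n))"
  proof (rule Dinf_layers[OF dfn fin, where M = "\<lambda>s t. ext s \<subseteq> ext t \<and> s \<noteq> t"])
    show "dfn (\<lambda>e. ext (e 0) \<subseteq> ext (e (Suc 0)) \<and> e 0 \<noteq> e (Suc 0))" by (intro dfn_intros)
    show "ext r \<subseteq> ext t \<and> r \<noteq> t" if "ext r \<subseteq> ext s \<and> r \<noteq> s" "ext s \<subseteq> ext t \<and> s \<noteq> t" for r s t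
    proof (rule conjI)
      show "ext r \<subseteq> ext t" using that by blast
      show "r \<noteq> t"
      proof
        assume "r = t"
        then have "ext r = ext s" using that by blast
        then show False using that(1) by (simp add: ext_inject)
      qed
    qed
    show "s = t \<or> (ext s \<subseteq> ext t \<and> s \<noteq> t) \<or> (ext t \<subseteq> ext s \<and> t \<noteq> s)"
      if "n \<in> N" "s \<in> ext (u n)" "t \<in> ext (u n)" for n s t
    proof -
      have "s \<in> A" "t \<in> A" using sub[OF that(1)] that(2,3) by blast+
      from chain[OF this] show ?thesis by blast
    qed
    show "\<not> (ext s \<subseteq> ext s \<and> s \<noteq> s)" for s by simp
  qed (assumption | rule inf)+
  moreover have "isset (\<Union>n\<in>N. ext (u n))" by (rule isset_UN[OF isset_N dfn]) simp
  moreover have "(\<Union>n\<in>N. ext (u n)) \<subseteq> A" using sub by blast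
  ultimately show ?thesis using Dinf_mono[of "\<Union>n\<in>N. ext (u n)" A] by blast
qed

lemma Fin_Times: "Fin A \<Longrightarrow> Fin B \<Longrightarrow> Fin (Times A B)"
proof -
  assume A: "Fin A" and B: "Fin B"
  have "Fin (\<Union>a\<in>A. (\<lambda>b. pair a b) ` B)"
  proof (rule Fin_UN[OF A])
    show "dfn (\<lambda>e. e 0 \<in> (\<lambda>b. pair (e (Suc 0)) b) ` B)"
      by (intro dfn_intros dfn_mem_isset[OF Fin_isset[OF B]])
    show "Fin ((\<lambda>b. pair a b) ` B)" for a by (intro Fin_image[OF B] dfn_intros)
  qed
  moreover have "(\<Union>a\<in>A. (\<lambda>b. pair a b) ` B) = Times A B" by (auto simp: Times_def)
  ultimately show ?thesis by simp
qed

text \<open>An exhaustion of the rationals by finite sets, which takes the place of an enumeration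
  of them.\<close>

definition Rat_below :: "'a \<Rightarrow> 'a set" where
  "Rat_below n = Rat \<inter> Times (Times (ext n) (ext n)) (ext n)"

lemma Fin_Rat_below: "n \<in> N \<Longrightarrow> Fin (Rat_below n)"
  unfolding Rat_below_def
  by (rule Fin_subset[of "Times (Times (ext n) (ext n)) (ext n)"]) (auto intro: Fin_Times Fin_N)

lemma Rat_below_mono: "n \<in> N \<Longrightarrow> m \<epsilon> n \<Longrightarrow> Rat_below m \<subseteq> Rat_below n"
proof -
  assume "n \<in> N" "m \<epsilon> n"
  then have "ext m \<subseteq> ext n" using N_trans by (auto simp: mem_ext)
  then show ?thesis unfolding Rat_below_def by (auto simp: Times_def)
qed

lemma ex_N_greater: "i \<in> N \<Longrightarrow> j \<in> N \<Longrightarrow> \<exists>n\<in>N. i \<epsilon> n \<and> j \<epsilon> n"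
proof -
  assume ij: "i \<in> N" "j \<in> N"
  then consider "i \<epsilon> j" | "i = j" | "j \<epsilon> i" using N_linear by blast
  then show ?thesis
  proof cases
    case 3
    then show ?thesis using ij by (intro bexI[of _ "suc i"]) (simp_all add: mem_suc)
  qed (use ij in \<open>auto intro!: bexI[of _ "suc j"] simp: mem_suc\<close>)
qed

lemma ex_Rat_below: "q \<in> Rat \<Longrightarrow> \<exists>n\<in>N. q \<in> Rat_below n"
proof (elim Rat_cases)
  fix a b c assume q: "q = frac a b c" "a \<in> N" "b \<in> N" "c \<in> N" "c \<noteq> zero"
  obtain m where m: "m \<in> N" "a \<epsilon> m" "b \<epsilon> m" using ex_N_greater q by blast
  obtain n where n: "n \<in> N" "m \<epsilon> n" "c \<epsilon> n" using ex_N_greater m(1) q by blast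
  have "a \<epsilon> n" "b \<epsilon> n" using N_trans[OF n(1,2)] m by blast+
  then have "q \<in> Rat_below n"
    using q n unfolding Rat_below_def frac_def by (auto simp: mem_ext frac_Rat[unfolded frac_def])
  then show ?thesis using n(1) by blast
qed

text \<open>In the proof, \<open>b\<close> is the lower half of the greatest accumulation point of \<open>A\<close>, which may be
  infinite, and \<open>D n\<close> is a punctured neighbourhood of it.\<close>

lemma ex_infinite_shrinking:
  assumes A: "isset A" "A \<subseteq> Reals" and inf: "\<not> Fin A"
  shows "\<exists>D. dfn (\<lambda>e. e 0 \<in> D (e (Suc 0))) \<and> (\<forall>n\<in>N. D n \<subseteq> A \<and> \<not> Fin (D n)) \<and>
    (\<forall>n\<in>N. \<forall>m. m \<epsilon> n \<longrightarrow> D n \<subseteq> D m) \<and> (\<forall>r\<in>A. \<exists>n\<in>N. r \<notin> D n)"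
proof -
  note A' = dfn_mem_isset[OF A(1)]
  have Rat: "ext r \<subseteq> Rat" if "r \<in> A" for r using A(2) that by (auto simp: Reals_def cut_def)
  have chain: "ext r \<subseteq> ext s \<or> ext s \<subseteq> ext r" if "r \<in> A" "s \<in> A" for r s
    using cut_linear that A(2) by (auto simp: Reals_def)
  \<comment> \<open>\<open>b\<close> may be empty, all of \<open>Rat\<close> or have a greatest
    element, so it need not be a cut. The comparison on finite sets of rationals in \<open>D\<close>
    covers all these cases.\<close>
  define b where "b = {q \<in> Rat. \<not> Fin {r \<in> A. q \<epsilon> r}}"
  have b: "isset b" unfolding b_def by (intro isset_Collect isset_Rat dfn_intros A')
  \<comment> \<open>\<open>ext r \<noteq> b\<close> discards the accumulation point itself if it
    belongs to \<open>A\<close>; every other element differs from \<open>b\<close> at some rational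
    and drops out at a stage that contains it.\<close>
  define D where "D = (\<lambda>n. {r \<in> A. ext r \<noteq> b \<and> ext r \<inter> Rat_below n = b \<inter> Rat_below n})"
  have dfn_D: "dfn (\<lambda>e. e 0 \<in> D (e (Suc 0)))"
    unfolding D_def Rat_below_def by (intro dfn_intros A' dfn_mem_isset[OF b] dfn_mem_isset[OF isset_Rat])
  \<comment> \<open>The sets of elements containing a given rational form a chain, so intersecting
    finitely many infinite ones leaves an infinite set.\<close>
  have inf_above: "\<not> Fin {r \<in> A. C \<subseteq> ext r}" if "Fin C" "C \<subseteq> b" for C
  proof -
    have "C \<subseteq> b \<longrightarrow> \<not> Fin {r \<in> A. C \<subseteq> ext r}" using \<open>Fin C\<close>
    proof (induction C rule: Fin_induct)
      case dfn
      show ?case by (intro dfn_intros A' dfn_mem_isset[OF b])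
    next
      case empty
      show ?case using inf by simp
    next
      case (insert q C)
      show ?case
      proof (intro impI)
        assume sub: "insert q C \<subseteq> b"
        let ?P = "{r \<in> A. C \<subseteq> ext r}" let ?R = "{r \<in> A. q \<epsilon> r}"
        have PR: "\<not> Fin ?P" "\<not> Fin ?R" using sub insert(3) unfolding b_def by blast+
        have "?P \<subseteq> ?R \<or> ?R \<subseteq> ?P"
        proof (rule ccontr)
          assume "\<not> (?P \<subseteq> ?R \<or> ?R \<subseteq> ?P)"
          then obtain r s where rs: "r \<in> A" "C \<subseteq> ext r" "q \<notin> ext r" "s \<in> A" "q \<in> ext s" "\<not> C \<subseteq> ext s"
            by (auto simp: mem_ext)
          from chain[OF rs(1,4)] show False using rs(2,3,5,6) by blast
        qed
        moreover have "{r \<in> A. insert q C \<subseteq> ext r} = ?P \<inter> ?R" by (auto simp: mem_ext)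
        ultimately have "{r \<in> A. insert q C \<subseteq> ext r} = ?P \<or> {r \<in> A. insert q C \<subseteq> ext r} = ?R" by blast
        then show "\<not> Fin {r \<in> A. insert q C \<subseteq> ext r}"
        proof (elim disjE)
          assume eq: "{r \<in> A. insert q C \<subseteq> ext r} = ?P"
          show ?thesis unfolding eq by (rule PR(1))
        next
          assume eq: "{r \<in> A. insert q C \<subseteq> ext r} = ?R"
          show ?thesis unfolding eq by (rule PR(2))
        qed
      qed
    qed
    then show ?thesis using that by blast
  qed
  have inf_D: "\<not> Fin (D n)" if n: "n \<in> N" for n
  proof
    assume fin: "Fin (D n)"
    let ?Q = "Rat_below n"
    have isQ: "isset (?Q - b)" "isset (b \<inter> ?Q)" using b Fin_isset[OF Fin_Rat_below[OF n]] by auto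
    have finQ: "Fin (?Q - b)" "Fin (b \<inter> ?Q)"
      by (rule Fin_subset[OF Fin_Rat_below[OF n] isQ(1)], blast, rule Fin_subset[OF Fin_Rat_below[OF n] isQ(2)], blast)
    have finU: "Fin (\<Union>q\<in>?Q - b. {r \<in> A. q \<epsilon> r})"
    proof (rule Fin_UN[OF finQ(1)])
      show "dfn (\<lambda>e. e 0 \<in> {r \<in> A. e (Suc 0) \<epsilon> r})" by (intro dfn_intros A')
      show "Fin {r \<in> A. q \<epsilon> r}" if "q \<in> ?Q - b" for q using that by (auto simp: b_def Rat_below_def)
    qed
    \<comment> \<open>An element above \<open>b \<inter> ?Q\<close> is \<open>b\<close> itself, or
      agrees with \<open>b\<close> on \<open>?Q\<close>, or contains some \<open>q\<close> of
      \<open>?Q - b\<close>; by definition of \<open>b\<close>, each such \<open>q\<close> lies in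
      only finitely many elements of \<open>A\<close>.\<close>
    have "{r \<in> A. b \<inter> ?Q \<subseteq> ext r} \<subseteq> insert (Coll b) (D n \<union> (\<Union>q\<in>?Q - b. {r \<in> A. q \<epsilon> r}))"
    proof
      fix r assume r: "r \<in> {r \<in> A. b \<inter> ?Q \<subseteq> ext r}"
      show "r \<in> insert (Coll b) (D n \<union> (\<Union>q\<in>?Q - b. {r \<in> A. q \<epsilon> r}))"
      proof (cases "ext r = b \<or> (\<exists>q\<in>?Q - b. q \<epsilon> r)")
        case True
        then show ?thesis
        proof
          assume "ext r = b"
          then have "r = Coll b" using Coll_ext[of r] by simp
          then show ?thesis by simp
        qed (use r in blast)
      next
        case False
        then have "q \<in> ext r \<Longrightarrow> q \<in> ?Q \<Longrightarrow> q \<in> b" for q by (auto simp: mem_ext)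
        then have "ext r \<inter> ?Q = b \<inter> ?Q" using r by blast
        then show ?thesis using False r unfolding D_def by blast
      qed
    qed
    moreover have "isset {r \<in> A. b \<inter> ?Q \<subseteq> ext r}"
      by (intro isset_Collect A(1) dfn_intros dfn_mem_isset[OF b] dfn_mem_isset[OF Fin_isset[OF Fin_Rat_below[OF n]]])
    moreover have "Fin (insert (Coll b) (D n \<union> (\<Union>q\<in>?Q - b. {r \<in> A. q \<epsilon> r})))" by (intro Fin_insert Fin_Un fin finU)
    ultimately have "Fin {r \<in> A. b \<inter> ?Q \<subseteq> ext r}" using Fin_subset by blast
    then show False using inf_above[OF finQ(2)] by blast
  qed
  have mono_D: "D n \<subseteq> D m" if "n \<in> N" "m \<epsilon> n" for m n
    using Rat_below_mono[OF that] unfolding D_def by blast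
  have shrink: "\<exists>n\<in>N. r \<notin> D n" if r: "r \<in> A" for r
  proof (cases "ext r = b")
    case True
    then show ?thesis unfolding D_def using zero_N by blast
  next
    case False
    moreover have "b \<subseteq> Rat" unfolding b_def by blast
    ultimately obtain q where q: "q \<in> Rat" "q \<in> ext r \<longleftrightarrow> q \<notin> b" using Rat[OF r] by blast
    then obtain n where n: "n \<in> N" "q \<in> Rat_below n" using ex_Rat_below by blast
    then have "r \<notin> D n" unfolding D_def using q(2) by blast
    then show ?thesis using n(1) by blast
  qed
  have "D n \<subseteq> A" for n unfolding D_def by blast
  then show ?thesis using dfn_D inf_D mono_D shrink by (intro exI[of _ D]) blast
qed

lemma IDI_Reals_if_Pspace:
  assumes P: "\<And>X T. is_top X T \<Longrightarrow> szd X T \<Longrightarrow> t1 X T \<Longrightarrow> \<not> Dinf (FinPow (ext X)) \<Longrightarrow> Pspace X T"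
    and X: "ext X \<subseteq> Reals" and inf: "\<not> Fin (ext X)"
  shows "Dinf (ext X)"
proof (rule ccontr)
  assume not: "\<not> Dinf (ext X)"
  have chain: "ext r \<subseteq> ext s \<or> ext s \<subseteq> ext r" if "r \<in> ext X" "s \<in> ext X" for r s
    using cut_linear that X by (auto simp: Reals_def)
  have qDf: "\<not> Dinf (FinPow (ext X))" using Dinf_chain[OF isset_ext chain] not by blast
  obtain D where dfn_D: "dfn (\<lambda>e. e 0 \<in> D (e (Suc 0)))"
    and D: "\<And>n. n \<in> N \<Longrightarrow> D n \<subseteq> ext X" "\<And>n. n \<in> N \<Longrightarrow> \<not> Fin (D n)"
    and mono: "\<And>n m. n \<in> N \<Longrightarrow> m \<epsilon> n \<Longrightarrow> D n \<subseteq> D m"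
    and shrink: "\<And>r. r \<in> ext X \<Longrightarrow> \<exists>n\<in>N. r \<notin> D n"
    using ex_infinite_shrinking[OF isset_ext X inf] by blast
  note D' = dfn_lift2[where R = "\<lambda>x n. x \<in> D n", OF dfn_D]
  have isset_D: "isset (D n)" if "n \<in> N" for n
    by (rule isset_subset[OF isset_ext D(1)[OF that]]) (intro D' dfn_intros)
  \<comment> \<open>Any point will do as \<open>x0\<close>: it is unrelated to the accumulation
    point behind \<open>D\<close>, and the topology is not defined by the order of the
    reals.\<close>
  have "ext X \<noteq> {}" using inf by auto
  then obtain x0 where x0: "x0 \<epsilon> X" by (auto simp: mem_ext)
  let ?F = "\<lambda>U. \<exists>n\<in>N. D n \<subseteq> ext U" let ?T = "point_top X x0 ?F"
  have dfn: "dfn (\<lambda>e. ?F (e 0))" by (intro dfn_intros D')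
  have FX: "?F X" using D(1) zero_N by blast
  have F_mono: "?F V" if "?F U" "ext U \<subseteq> ext V" "ext V \<subseteq> ext X" for U V using that by blast
  have F_Int: "?F W" if U: "?F U" and V: "?F V" and W: "ext W = ext U \<inter> ext V" for U V W
  proof -
    obtain m n where mn: "m \<in> N" "n \<in> N" "D m \<subseteq> ext U" "D n \<subseteq> ext V" using U V by blast
    then consider "D m \<subseteq> D n" | "D n \<subseteq> D m" using N_linear mono by blast
    then show ?thesis by cases (use mn W in blast)+
  qed
  have F_Diff: "?F V" if y: "y \<epsilon> X" and V: "ext V = ext X - {y}" for y V
  proof -
    obtain n where "n \<in> N" "y \<notin> D n" using shrink[of y] y unfolding mem_ext by blast
    then have "D n \<subseteq> ext V" using D(1)[of n] V by blast
    then show ?thesis using \<open>n \<in> N\<close> by blast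
  qed
  have *: "nbhd_filter X x0 ?F"
    unfolding nbhd_filter_def
    by (intro conjI allI impI dfn x0 FX; (rule F_mono F_Int F_Diff; assumption))
  have memT: "U \<epsilon> ?T \<longleftrightarrow> ext U \<subseteq> ext X \<and> (x0 \<epsilon> U \<longrightarrow> ?F U)" for U
    by (rule mem_point_top[OF *])
  have Pspace: "Pspace X ?T"
    using P[OF is_top_point_top[OF *] szd_point_top[OF *] t1_point_top[OF *] qDf] .
  \<comment> \<open>Adding \<open>x0\<close> to \<open>D n\<close> gives open neighbourhoods, which
    shrink to \<open>{x0}\<close>.\<close>
  let ?g = "\<lambda>n. Coll (insert x0 (D n))"
  have g: "ext (?g n) = insert x0 (D n)" if "n \<in> N" for n using isset_D[OF that] by (simp add: ext_Coll)
  have single: "ext (Coll {x0}) = {x0}" by (simp add: ext_Coll)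
  have "Gdelta X ?T (Coll {x0})"
  proof (rule GdeltaI)
    show "dfn1 ?g" by (intro dfn_intros D')
    show "?g ` N \<subseteq> ext ?T"
    proof clarify
      fix n assume n: "n \<in> N"
      have "ext (?g n) \<subseteq> ext X" using D(1)[OF n] x0 g[OF n] by (simp add: mem_ext)
      moreover have "?F (?g n)" using n g[OF n] by blast
      ultimately have "?g n \<epsilon> ?T" using memT by blast
      then show "?g n \<in> ext ?T" by (simp add: mem_ext)
    qed
    have "x \<epsilon> ?g n \<longleftrightarrow> x = x0 \<or> x \<in> D n" if "n \<in> N" for x n
      by (simp add: mem_if_ext[OF g[OF that]])
    then have "{x \<in> ext X. \<forall>n\<in>N. x \<epsilon> ?g n} = {x \<in> ext X. \<forall>n\<in>N. x = x0 \<or> x \<in> D n}" by blast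
    also have "\<dots> = {x0}" using shrink x0 by (auto simp: mem_ext)
    finally show "ext (Coll {x0}) = {x \<in> ext X. \<forall>n\<in>N. x \<epsilon> ?g n}" unfolding single by (rule sym)
  qed
  then have "Coll {x0} \<epsilon> ?T" using Pspace unfolding Pspace_def by blast
  moreover have "x0 \<epsilon> Coll {x0}" by (simp add: mem_Coll)
  \<comment> \<open>An open \<open>{x0}\<close> would include some \<open>D n\<close>, which is
    infinite.\<close>
  ultimately obtain n where n: "n \<in> N" "D n \<subseteq> {x0}" using memT[of "Coll {x0}"] single by auto
  have "Fin (D n)" by (rule Fin_subset[OF _ isset_D[OF n(1)] n(2)]) simp
  then show False using D(2)[OF n(1)] by blast
qed

end

theorem theorem4p3:
  "ZF_proves (compact_Tychonoff_P_spaces_finite \<^bold>\<longrightarrow> IQDI) \<and>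
   ZF_proves (locally_compact_Tychonoff_P_spaces_discrete \<^bold>\<longrightarrow> IQDI) \<and>
   ZF_proves (IQDI \<^bold>\<longleftrightarrow> limit_point_compact_T1_P_spaces_finite) \<and>
   ZF_proves (quasi_Dedekind_finite_strongly_zero_dimensional_T1_spaces_P \<^bold>\<longrightarrow> IDI_Reals)"
proof (intro conjI ZF_proves_if_models)
  fix E :: "nat \<Rightarrow> nat \<Rightarrow> bool" and c v
  assume "satisfies_ZF E (=)"
  then interpret zf_model E by (rule zf_model.intro)
  note space = ex_space_if_quasi_Dedekind_finite
  have compact: "sem c v 0 compact_Tychonoff_P_spaces_finite \<longleftrightarrow>
      (\<forall>X T. is_top X T \<and> cpt T X \<and> (creg X T \<and> t1 X T) \<and> Pspace X T \<longrightarrow> Fin (ext X))"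
    by (simp add: compact_Tychonoff_P_spaces_finite_def psat_simps sem_is_topology compact_space_def
        sem_compact_subset Tychonoff_def sem_completely_regular sem_T1_space sem_P_space sem_is_finite)
  have locally_compact: "sem c v 0 locally_compact_Tychonoff_P_spaces_discrete \<longleftrightarrow>
      (\<forall>X T. is_top X T \<and> lcpt X T \<and> (creg X T \<and> t1 X T) \<and> Pspace X T \<longrightarrow> discr X T)"
    by (simp add: locally_compact_Tychonoff_P_spaces_discrete_def psat_simps sem_is_topology
        sem_locally_compact_space Tychonoff_def sem_completely_regular sem_T1_space sem_P_space sem_discrete_space)
  have limit_point_compact: "sem c v 0 limit_point_compact_T1_P_spaces_finite \<longleftrightarrow>
      (\<forall>X T. is_top X T \<and> Pspace X T \<and> lpc X T \<and> t1 X T \<longrightarrow> Fin (ext X))"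
    by (simp add: limit_point_compact_T1_P_spaces_finite_def psat_simps sem_is_topology
        sem_limit_point_compact sem_T1_space sem_P_space sem_is_finite)
  have zero_dimensional: "sem c v 0 quasi_Dedekind_finite_strongly_zero_dimensional_T1_spaces_P \<longleftrightarrow>
      (\<forall>X T. is_top X T \<and> szd X T \<and> t1 X T \<and> \<not> Dinf (FinPow (ext X)) \<longrightarrow> Pspace X T)"
    by (simp add: quasi_Dedekind_finite_strongly_zero_dimensional_T1_spaces_P_def psat_simps sem_is_topology
        sem_strongly_zero_dimensional sem_T1_space quasi_Dedekind_finite_def sem_quasi_Dedekind_infinite sem_P_space)
  show "sem c v 0 (compact_Tychonoff_P_spaces_finite \<^bold>\<longrightarrow> IQDI)"
    unfolding psat_imp compact sem_IQDI using space by blast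
  show "sem c v 0 (locally_compact_Tychonoff_P_spaces_discrete \<^bold>\<longrightarrow> IQDI)"
    unfolding psat_imp locally_compact sem_IQDI using space cpt_imp_lcpt by blast
  show "sem c v 0 (IQDI \<^bold>\<longleftrightarrow> limit_point_compact_T1_P_spaces_finite)"
    unfolding psat_iff limit_point_compact sem_IQDI using space Fin_if_lpc_Pspace by blast
  show "sem c v 0 (quasi_Dedekind_finite_strongly_zero_dimensional_T1_spaces_P \<^bold>\<longrightarrow> IDI_Reals)"
    unfolding psat_imp zero_dimensional sem_IDI_Reals using IDI_Reals_if_Pspace by blast
qed

end
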